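(* Let $\varepsilon>0$ be a fixed constant and $q=(1+\varepsilon)n$. Let $\mathbf{x}_1,\dots,\mathbf{x}_n$ be independent uniformly random points of $[0,1]^2$, and consider the complete graph on these points where the cost of edge $\{\mathbf{x}_i,\mathbf{x}_j\}$ is $|\mathbf{x}_i-\mathbf{x}_j|$. Color each edge independently and uniformly at random with one of $q$ colors. Let $Z_{\mathrm{TSP}}$ be the minimum total length of a rainbow Hamilton cycle (a Hamilton cycle whose edges have pairwise distinct colors) and $Z^*_{\mathrm{TSP}}$ the minimum total length of a Hamilton cycle (no color constraint). Then w.h.p. (a) $Z_{\mathrm{TSP}}=O(n^{1/2}\log n)$, and (b) $Z_{\mathrm{TSP}}-Z^*_{\mathrm{TSP}}=\Omega(\sqrt n)$. Moreover, statement (a) holds for any (arbitrary, not necessarily random) set of $n$ points in $[0,1]^2$ whose edges are colored independently and uniformly at random with $q$ colors.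
   Context: "W.h.p." means with probability tending to $1$ as $n\to\infty$. Colors are independent of the point positions. *)

theory Defs
  imports "HOL-Probability.Probability"
begin

definition unit_square :: "(real \<times> real) set" where
  "unit_square = {0..1} \<times> {0..1}"

definition edges :: "nat \<Rightarrow> nat set set" where
  "edges n = {e. e \<subseteq> {..<n} \<and> card e = 2}"

text \<open>A Hamilton cycle of the complete graph on the vertices \<open>0, \<dots>, n - 1\<close> is given by the list
  of its vertices in cyclic order. The condition \<open>3 \<le> n\<close> makes the consecutive pairs, including
  the closing one, \<open>n\<close> different edges.\<close>

definition hamilton_cycle :: "nat \<Rightarrow> nat list \<Rightarrow> bool" where
  "hamilton_cycle n vs \<longleftrightarrow> 3 \<le> n \<and> distinct vs \<and> set vs = {..<n}"

definition cycle_edges :: "nat list \<Rightarrow> nat set set" where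
  "cycle_edges vs = {{vs ! i, vs ! (Suc i mod length vs)} | i. i < length vs}"

definition cycle_length :: "(nat \<Rightarrow> real \<times> real) \<Rightarrow> nat list \<Rightarrow> real" where
  "cycle_length x vs = (\<Sum>i<length vs. dist (x (vs ! i)) (x (vs ! (Suc i mod length vs))))"

definition rainbow :: "(nat set \<Rightarrow> nat) \<Rightarrow> nat list \<Rightarrow> bool" where
  "rainbow col vs \<longleftrightarrow> inj_on col (cycle_edges vs)"

text \<open>There are finitely many Hamilton cycles, so each infimum below is a minimum, or \<open>\<infinity>\<close> if
  there is no cycle of the required kind.\<close>

definition Z_opt :: "nat \<Rightarrow> (nat \<Rightarrow> real \<times> real) \<Rightarrow> ereal" where
  "Z_opt n x = (INF vs\<in>{vs. hamilton_cycle n vs}. ereal (cycle_length x vs))"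

definition Z_rainbow :: "nat \<Rightarrow> (nat \<Rightarrow> real \<times> real) \<Rightarrow> (nat set \<Rightarrow> nat) \<Rightarrow> ereal" where
  "Z_rainbow n x col =
     (INF vs\<in>{vs. hamilton_cycle n vs \<and> rainbow col vs}. ereal (cycle_length x vs))"

definition random_points :: "nat \<Rightarrow> (nat \<Rightarrow> real \<times> real) measure" where
  "random_points n = (\<Pi>\<^sub>M i\<in>{..<n}. uniform_measure lborel unit_square)"

definition random_coloring :: "nat \<Rightarrow> nat \<Rightarrow> (nat set \<Rightarrow> nat) measure" where
  "random_coloring n q = (\<Pi>\<^sub>M e\<in>edges n. uniform_count_measure {..<q})"

definition whp :: "(nat \<Rightarrow> 'a measure) \<Rightarrow> (nat \<Rightarrow> 'a \<Rightarrow> bool) \<Rightarrow> bool" where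
  "whp M P \<longleftrightarrow> (\<lambda>n. \<P>(\<omega> in M n. P n \<omega>)) \<longlonglongrightarrow> 1"

end

theory Submission imports Defs begin

text \<open>
  Upper bound: split the vertices into halves \<open>A\<close> and \<open>D\<close> and let
  \<open>B = O(log n)\<close>. Grow a path greedily in \<open>A\<close>, each step going from the current end to one of its
  \<open>B\<close> nearest unvisited vertices along an edge of an unused colour, until \<open>B\<close> vertices are left; then
  do the same in \<open>D\<close>. At most \<open>n\<close> of the \<open>(1 + \<epsilon>) n\<close> colours are ever in use, so a step fails with
  probability at most \<open>r ^ B\<close> for a constant \<open>r < 1\<close>. The path is closed through one of the vertices left
  over in \<open>D\<close>, and the remaining ones are inserted into path edges of the other half, all
  relevant edges still being unexposed. Among the vertices of a cell of diameter \<open>\<delta>\<close> at most \<open>B\<close> are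
  left by steps longer than \<open>\<delta>\<close>, so the length is \<open>O(B sqrt n)\<close> by summing over dyadic scales;
  the \<open>O(B)\<close> insertions cost \<open>O(B)\<close>.

  Gap: a gadget consists of a very close pair \<open>a\<close>, \<open>b\<close>, two further vertices at distance about 1 (in units
  of order \<open>1 / sqrt n\<close>) in perpendicular directions, and no other vertex nearby. If a tour
  avoids the edge \<open>ab\<close> and cannot be shortened by a constant by a 2-opt move or by moving one vertex,
  then the four neighbours of \<open>a\<close> and \<open>b\<close> lie on a line through \<open>a\<close>, two on each side, and examining the
  neighbours of a gadget vertex off this line leads to a contradiction. By a second moment
  argument a random point set contains linearly many gadgets. The colours of their edges \<open>ab\<close> have
  linearly many repetitions, so a rainbow tour avoids linearly many of these edges, and each
  shortening move introduces at most three new edges.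
\<close>

section \<open>Exposing colours edge by edge\<close>

text \<open>A path that has to visit every vertex runs out of candidates near its end, and a vertex
  that it skipped has already exposed edges to the path. The halves resolve this: a skipped vertex
  has no exposed edge to the interior of the path in the other half, where linearly many disjoint
  edges can receive it. Putting a vertex between two others needs two new colours at once, so the
  trial fails with probability at most \<open>1 - (1 - r)\<^sup>2\<close>. This is still a constant
  below 1, hence a multiple of log n trials suffices.

  For the gap, a close pair alone is not enough. A tour may pass \<open>a\<close> and
  \<open>b\<close> along one line in opposite senses, and then neither joining them by a 2-opt move
  nor moving one next to the other gains anything. A third nearby vertex off this line destroys the
  configuration. As the line is not known in advance, two vertices in perpendicular directions are
  provided, at least one of which is off the line. Each move gains a fixed amount in units of order
  1 / sqrt n, so linearly many moves gain order sqrt n.\<close>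

definition extensions :: "'e set \<Rightarrow> nat \<Rightarrow> 'e set \<Rightarrow> ('e \<Rightarrow> nat) \<Rightarrow> ('e \<Rightarrow> nat) set" where
  "extensions E q X c = {col \<in> E \<rightarrow>\<^sub>E {..<q}. \<forall>e\<in>X. col e = c e}"

text \<open>The probability of \<open>Bad\<close> given that the edges in \<open>X\<close> have been exposed and have the colours \<open>c\<close>.
  Adaptive exposure is expressed by bounding this quantity for all admissible \<open>X\<close> and \<open>c\<close>.\<close>

definition cond_prob :: "'e set \<Rightarrow> nat \<Rightarrow> (('e \<Rightarrow> nat) \<Rightarrow> bool) \<Rightarrow> 'e set \<Rightarrow> ('e \<Rightarrow> nat) \<Rightarrow> real" where
  "cond_prob E q Bad X c =
     real (card {col \<in> extensions E q X c. Bad col}) / real q ^ card (E - X)"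

lemma finite_extensions: "finite E \<Longrightarrow> finite (extensions E q X c)"
  unfolding extensions_def by (simp add: finite_PiE)

lemma cond_prob_eq_0:
  assumes "\<And>col. col \<in> extensions E q X c \<Longrightarrow> \<not> Bad col"
  shows "cond_prob E q Bad X c = 0"
proof -
  have "{col \<in> extensions E q X c. Bad col} = {}" using assms by auto
  then show ?thesis unfolding cond_prob_def by (simp only: card.empty)
qed

lemma card_Diff_insert_Suc:
  assumes "finite E" "e \<in> E" "e \<notin> X"
  shows "card (E - X) = Suc (card (E - insert e X))"
  using card.remove[of "E - X" e] assms by (simp add: Diff_insert[symmetric])

text \<open>The law of total probability over the colour of the next edge. All later bounds expose
  edges through this identity.\<close>

lemma cond_prob_average:
  assumes "finite E" "q > 0" "e \<in> E" "e \<notin> X"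
  shows "cond_prob E q Bad X c = (\<Sum>k<q. cond_prob E q Bad (insert e X) (c(e := k))) / real q"
proof -
  have eq: "{col \<in> extensions E q X c. Bad col} =
      (\<Union>k<q. {col \<in> extensions E q (insert e X) (c(e := k)). Bad col})" (is "?L = ?R")
  proof
    show "?L \<subseteq> ?R"
    proof
      fix col assume "col \<in> ?L"
      moreover from this have "col e < q" using assms(3) by (auto simp: extensions_def PiE_iff)
      ultimately show "col \<in> ?R" using assms(4) by (auto simp: extensions_def)
    qed
    show "?R \<subseteq> ?L" using assms(4) by (auto simp: extensions_def)
  qed
  have "card ?L = (\<Sum>k<q. card {col \<in> extensions E q (insert e X) (c(e := k)). Bad col})"
    unfolding eq
  proof (rule card_UN_disjoint)
    show "\<forall>i\<in>{..<q}. finite {col \<in> extensions E q (insert e X) (c(e := i)). Bad col}"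
      using finite_extensions[OF assms(1)] by simp
    show "\<forall>i\<in>{..<q}. \<forall>j\<in>{..<q}. i \<noteq> j \<longrightarrow>
        {col \<in> extensions E q (insert e X) (c(e := i)). Bad col} \<inter>
        {col \<in> extensions E q (insert e X) (c(e := j)). Bad col} = {}"
      by (auto simp: extensions_def)
  qed simp
  moreover have "card (E - X) = Suc (card (E - insert e X))"
    using card_Diff_insert_Suc[OF assms(1,3,4)] .
  ultimately show ?thesis using assms(2)
    by (simp add: cond_prob_def sum_divide_distrib mult.commute)
qed

lemma cond_prob_le_1:
  assumes "finite E" "q > 0"
  shows "cond_prob E q Bad X c \<le> 1"
proof (induction "card (E - X)" arbitrary: X c)
  case 0
  then have "E \<subseteq> X" using assms by auto
  then have "col = col'" if "col \<in> extensions E q X c" "col' \<in> extensions E q X c" for col col'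
    using that unfolding extensions_def by (intro ext) (smt (verit) PiE_arb mem_Collect_eq subsetD)
  then have "card {col \<in> extensions E q X c. Bad col} \<le> 1"
    using finite_extensions[OF assms(1)] by (auto simp: card_le_Suc0_iff_eq)
  then show ?case using 0 by (simp add: cond_prob_def)
next
  case (Suc m)
  then obtain e where e: "e \<in> E" "e \<notin> X" by (metis DiffE card.empty equals0I nat.distinct(1))
  have "m = card (E - insert e X)"
    using card_Diff_insert_Suc[OF assms(1) e] Suc by simp
  then have "\<And>k. cond_prob E q Bad (insert e X) (c(e := k)) \<le> 1" using Suc.hyps(1) by blast
  then have "(\<Sum>k<q. cond_prob E q Bad (insert e X) (c(e := k))) \<le> (\<Sum>k<q. 1)"
    by (intro sum_mono) auto
  then show ?case using cond_prob_average[OF assms e] assms(2) by simp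
qed

text \<open>\<open>U\<close> collects the colours that count as failure. The bound \<open>a\<close>
  applies after a success and the weaker \<open>b\<close> after any colour, so the worst case is
  that failures make up the full fraction \<open>r\<close>.\<close>

lemma cond_prob_expose:
  assumes "finite E" "q > 0" "e \<in> E" "e \<notin> X" and U: "finite U" "real (card U) \<le> r * real q"
    and a: "\<And>k. k < q \<Longrightarrow> k \<notin> U \<Longrightarrow> cond_prob E q Bad (insert e X) (c(e := k)) \<le> a"
    and b: "\<And>k. k < q \<Longrightarrow> cond_prob E q Bad (insert e X) (c(e := k)) \<le> b"
    and ab: "a \<le> b"
  shows "cond_prob E q Bad X c \<le> (1 - r) * a + r * b"
proof -
  have "(\<Sum>k<q. cond_prob E q Bad (insert e X) (c(e := k)))
      \<le> (\<Sum>k<q. a + (if k \<in> U then b - a else 0))"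
    using a b by (intro sum_mono) auto
  also have "\<dots> = real q * a + real (card ({..<q} \<inter> U)) * (b - a)"
    by (simp add: sum.distrib sum.If_cases)
  also have "\<dots> \<le> real q * a + (r * real q) * (b - a)"
  proof -
    have "card ({..<q} \<inter> U) \<le> card U" using U by (intro card_mono) auto
    then have "real (card ({..<q} \<inter> U)) \<le> r * real q" using U by linarith
    then show ?thesis using ab by (intro add_left_mono mult_right_mono) auto
  qed
  finally have "(\<Sum>k<q. cond_prob E q Bad (insert e X) (c(e := k))) \<le> ((1 - r) * a + r * b) * real q"
    by (simp add: algebra_simps)
  then show ?thesis using assms(2) cond_prob_average[OF assms(1-4)] by (simp add: divide_le_eq)
qed

text \<open>The edges of \<open>T\<close> are exposed one after another until a colour outside
  \<open>U\<close> appears; only a run of \<open>card T\<close> failures remains. Which edges have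
  been exposed at the first success is random, so \<open>succ\<close> is assumed for every possible
  set \<open>F\<close>.\<close>

lemma cond_prob_trials:
  assumes "finite E" "q > 0" "finite U" "real (card U) \<le> r * real q" "0 \<le> a" "0 \<le> r"
    and T: "finite T" "T \<subseteq> E" "T \<inter> X = {}" and ran: "\<And>e. c e < q"
    and succ: "\<And>F c' e. F \<subseteq> T \<Longrightarrow> e \<in> F \<Longrightarrow> c' e \<notin> U \<Longrightarrow> (\<And>e. e \<in> X \<Longrightarrow> c' e = c e)
      \<Longrightarrow> (\<And>e. c' e < q) \<Longrightarrow> cond_prob E q Bad (X \<union> F) c' \<le> a"
  shows "cond_prob E q Bad X c \<le> a + r ^ card T"
  using T ran succ
proof (induction "card T" arbitrary: T X c)
  case 0
  then show ?case using cond_prob_le_1[OF assms(1,2), of Bad X c] assms(5) by simp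
next
  case (Suc m)
  then obtain e where e: "e \<in> T" by fastforce
  have m: "m = card (T - {e})" using Suc.hyps(2) e by simp
  have b: "cond_prob E q Bad (insert e X) (c(e := k)) \<le> a + r ^ m" if "k < q" for k
  proof -
    have "cond_prob E q Bad (insert e X) (c(e := k)) \<le> a + r ^ card (T - {e})"
    proof (rule Suc.hyps(1)[OF m])
      fix F c' e' assume F: "F \<subseteq> T - {e}" "e' \<in> F" "c' e' \<notin> U"
        "\<And>ea. ea \<in> insert e X \<Longrightarrow> c' ea = (c(e := k)) ea" "\<And>e. c' e < q"
      have "cond_prob E q Bad (X \<union> insert e F) c' \<le> a"
        by (rule Suc.prems(5)[of _ e'])
          (use F e Suc.prems(3) in \<open>auto split: if_splits simp: fun_upd_apply\<close>)
      then show "cond_prob E q Bad (insert e X \<union> F) c' \<le> a" by simp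
    qed (use Suc.prems that in auto)
    then show ?thesis using m by simp
  qed
  have "cond_prob E q Bad X c \<le> (1 - r) * a + r * (a + r ^ m)"
  proof (rule cond_prob_expose[OF assms(1,2) _ _ assms(3,4)])
    show "cond_prob E q Bad (insert e X) (c(e := k)) \<le> a" if "k < q" "k \<notin> U" for k
    proof -
      have "cond_prob E q Bad (X \<union> {e}) (c(e := k)) \<le> a"
        by (rule Suc.prems(5)[of _ e]) (use that e Suc.prems(3,4) in auto)
      then show ?thesis by simp
    qed
  qed (use e Suc.prems b assms in auto)
  also have "\<dots> = a + r ^ Suc m" by (simp add: algebra_simps)
  finally show ?case using Suc.hyps(2) by simp
qed

text \<open>Trial \<open>j\<close> exposes two edges and succeeds if both colours are outside
  \<open>U\<close> and different. The second colour must also avoid the first, which the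
  \<open>+ 1\<close> in the bound on \<open>U\<close> pays for; so both edges succeed with
  probability at least \<open>1 - r\<close> each.\<close>

lemma cond_prob_pair_trials:
  assumes "finite E" "q > 0" "finite U" "real (card U) + 1 \<le> r * real q" "0 \<le> a" "0 \<le> r" "r \<le> 1"
    and J: "finite J" "f ` J \<union> g ` J \<subseteq> E" "(f ` J \<union> g ` J) \<inter> X = {}"
      "inj_on f J" "inj_on g J" "f ` J \<inter> g ` J = {}"
    and ran: "\<And>e. c e < q"
    and succ: "\<And>F c' j. F \<subseteq> f ` J \<union> g ` J \<Longrightarrow> j \<in> J \<Longrightarrow> f j \<in> F \<Longrightarrow> g j \<in> F \<Longrightarrow> c' (f j) \<notin> U
      \<Longrightarrow> c' (g j) \<notin> U \<Longrightarrow> c' (f j) \<noteq> c' (g j) \<Longrightarrow> (\<And>e. e \<in> X \<Longrightarrow> c' e = c e)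
      \<Longrightarrow> (\<And>e. c' e < q) \<Longrightarrow> cond_prob E q Bad (X \<union> F) c' \<le> a"
  shows "cond_prob E q Bad X c \<le> a + (1 - (1 - r)\<^sup>2) ^ card J"
  using J ran succ
proof (induction "card J" arbitrary: J X c)
  case 0
  then show ?case using cond_prob_le_1[OF assms(1,2), of Bad X c] assms(5) by simp
next
  case (Suc m)
  then obtain j where j: "j \<in> J" by fastforce
  let ?s = "1 - (1 - r)\<^sup>2"
  let ?e = "f j" and ?e' = "g j"
  have s0: "0 \<le> ?s" using assms(6,7) by (simp add: power_le_one)
  have m: "m = card (J - {j})" using Suc.hyps(2) j by simp
  have ne: "?e \<noteq> ?e'" using Suc.prems(6) j by blast
  have b: "cond_prob E q Bad (insert ?e' (insert ?e X)) (c(?e := k, ?e' := k')) \<le> a + ?s ^ m"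
    if "k < q" "k' < q" for k k'
  proof -
    have "cond_prob E q Bad (insert ?e' (insert ?e X)) (c(?e := k, ?e' := k')) \<le> a + ?s ^ card (J - {j})"
    proof (rule Suc.hyps(1)[OF m])
      show "(f ` (J - {j}) \<union> g ` (J - {j})) \<inter> insert ?e' (insert ?e X) = {}"
        using Suc.prems(3-6) j by (auto dest: inj_onD)
      show "inj_on f (J - {j})" "inj_on g (J - {j})" "f ` (J - {j}) \<inter> g ` (J - {j}) = {}"
        using Suc.prems(4-6) by (auto intro: inj_on_subset)
      fix F c' i assume F: "F \<subseteq> f ` (J - {j}) \<union> g ` (J - {j})" "i \<in> J - {j}" "f i \<in> F" "g i \<in> F"
        "c' (f i) \<notin> U" "c' (g i) \<notin> U" "c' (f i) \<noteq> c' (g i)"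
        "\<And>ea. ea \<in> insert ?e' (insert ?e X) \<Longrightarrow> c' ea = (c(?e := k, ?e' := k')) ea" "\<And>e. c' e < q"
      have "cond_prob E q Bad (X \<union> insert ?e (insert ?e' F)) c' \<le> a"
      proof (rule Suc.prems(8)[of _ i])
        fix ea assume "ea \<in> X"
        moreover then have "ea \<noteq> ?e" "ea \<noteq> ?e'" using Suc.prems(3) j by auto
        ultimately show "c' ea = c ea" using F(8)[of ea] by simp
      qed (use F j in auto)
      moreover have "X \<union> insert ?e (insert ?e' F) = insert ?e' (insert ?e X) \<union> F" by auto
      ultimately show "cond_prob E q Bad (insert ?e' (insert ?e X) \<union> F) c' \<le> a" by simp
    qed (use Suc.prems that in auto)
    then show ?thesis using m by simp
  qed
  have sm: "0 \<le> ?s ^ m" using s0 by simp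
  have first: "cond_prob E q Bad (insert ?e X) (c(?e := k)) \<le> (1 - r) * a + r * (a + ?s ^ m)"
    if k: "k < q" "k \<notin> U" for k
  proof (rule cond_prob_expose[OF assms(1,2)])
    show "finite (insert k U)" using assms(3) by simp
    show "real (card (insert k U)) \<le> r * real q" using assms(3,4) by (simp add: card_insert_if)
    show "cond_prob E q Bad (insert ?e' (insert ?e X)) (c(?e := k, ?e' := k')) \<le> a"
      if "k' < q" "k' \<notin> insert k U" for k'
    proof -
      have "cond_prob E q Bad (X \<union> {?e, ?e'}) (c(?e := k, ?e' := k')) \<le> a"
      proof (rule Suc.prems(8)[of _ j])
        fix ea assume "ea \<in> X"
        moreover then have "ea \<noteq> ?e" "ea \<noteq> ?e'" using Suc.prems(3) j by auto
        ultimately show "(c(?e := k, ?e' := k')) ea = c ea" by simp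
      qed (use k that j ne Suc.prems(7) in auto)
      then show ?thesis by (simp add: insert_commute)
    qed
  qed (use j ne Suc.prems(2,3) b k sm in auto)
  have second: "cond_prob E q Bad (insert ?e X) (c(?e := k)) \<le> a + ?s ^ m" if k: "k < q" for k
  proof -
    \<comment> \<open>With every colour declared a failure and \<open>r = 1\<close>, exposure is
      plain averaging. After a failed first edge the second is exposed all the same, so the trial is
      used up and the induction hypothesis applies.\<close>
    have "cond_prob E q Bad (insert ?e X) (c(?e := k)) \<le> (1 - 1) * a + 1 * (a + ?s ^ m)"
      by (rule cond_prob_expose[OF assms(1,2), of ?e' _ "{..<q}"])
        (use j ne Suc.prems(2,3) b k sm in auto)
    then show ?thesis by simp
  qed
  have "cond_prob E q Bad X c \<le> (1 - r) * ((1 - r) * a + r * (a + ?s ^ m)) + r * (a + ?s ^ m)"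
  proof (rule cond_prob_expose[OF assms(1,2) _ _ assms(3) _ first second])
    show "(1 - r) * a + r * (a + ?s ^ m) \<le> a + ?s ^ m"
      using sm assms(7) mult_right_mono[of r 1 "?s ^ m"] by (simp add: algebra_simps)
  qed (use j Suc.prems(2,3) assms(4) in auto)
  also have "\<dots> = a + ?s ^ Suc m" by (simp add: algebra_simps power2_eq_square)
  finally show ?case using Suc.hyps(2) by simp
qed

section \<open>Paths and tours as lists\<close>

definition pairs :: "'a list \<Rightarrow> ('a \<times> 'a) list" where
  "pairs xs = zip xs (tl xs)"

definition pair_edge :: "'a \<times> 'a \<Rightarrow> 'a set" where
  "pair_edge p = {fst p, snd p}"

definition path_length :: "('v \<Rightarrow> 'a::metric_space) \<Rightarrow> 'v list \<Rightarrow> real" where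
  "path_length x xs = (\<Sum>(u, v)\<leftarrow>pairs xs. dist (x u) (x v))"

lemma pair_edge_Pair [simp]: "pair_edge (u, v) = {u, v}"
  by (simp add: pair_edge_def)

lemma pairs_simps [simp]: "pairs [] = []" "pairs [a] = []" "pairs (a # b # xs) = (a, b) # pairs (b # xs)"
  by (simp_all add: pairs_def)

lemma pairs_append: "pairs (xs @ a # ys) = pairs (xs @ [a]) @ pairs (a # ys)"
  by (induction xs rule: induct_list012) auto

lemma pairs_snoc: "xs \<noteq> [] \<Longrightarrow> pairs (xs @ [u]) = pairs xs @ [(last xs, u)]"
  by (induction xs rule: induct_list012) auto

lemma pairs_insert:
  "set (pairs (xs @ [a, w, b] @ ys)) =
     set (pairs (xs @ [a])) \<union> {(a, w), (w, b)} \<union> set (pairs (b # ys))"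
  by (subst append_Cons, subst pairs_append) auto

lemma set_pairsD: "(u, v) \<in> set (pairs xs) \<Longrightarrow> u \<in> set xs \<and> v \<in> set xs"
  unfolding pairs_def by (metis in_set_zipE list.set_sel(2) tl_Nil)

lemma length_pairs [simp]: "length (pairs xs) = length xs - 1"
  by (simp add: pairs_def)

lemma set_pairs_split:
  assumes "(a, b) \<in> set (pairs xs)"
  obtains ys zs where "xs = ys @ [a, b] @ zs"
proof -
  obtain i where i: "i < length xs - 1" "xs ! i = a" "xs ! Suc i = b"
    using assms by (auto simp: pairs_def in_set_zip nth_tl)
  have "xs = take i xs @ xs ! i # drop (Suc i) xs" using i(1) by (intro id_take_nth_drop) simp
  also have "drop (Suc i) xs = xs ! Suc i # drop (Suc (Suc i)) xs"
    using i(1) by (intro Cons_nth_drop_Suc[symmetric]) simp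
  finally have "xs = take i xs @ [a, b] @ drop (Suc (Suc i)) xs" using i by simp
  then show ?thesis using that by blast
qed

lemma path_length_snoc:
  "xs \<noteq> [] \<Longrightarrow> path_length x (xs @ [u]) = path_length x xs + dist (x (last xs)) (x u)"
  by (simp add: path_length_def pairs_snoc)

lemma path_length_append:
  "path_length x (xs @ a # ys) = path_length x (xs @ [a]) + path_length x (a # ys)"
  by (simp add: path_length_def pairs_append[of xs a ys])

lemma path_length_nth: "path_length x xs = (\<Sum>i<length xs - 1. dist (x (xs ! i)) (x (xs ! Suc i)))"
  unfolding path_length_def sum_list_sum_nth length_map length_pairs
  by (intro sum.cong) (auto simp: pairs_def nth_tl)

section \<open>Cycles as closed paths\<close>

lemma cycle_pairs:
  assumes "vs \<noteq> []"
  shows "zip vs (rotate1 vs) = pairs vs @ [(last vs, hd vs)]"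
proof -
  obtain v ws where vs: "vs = v # ws" using assms by (cases vs) auto
  have "zip (v # ws) (ws @ [y]) = zip (v # ws) ws @ [(last (v # ws), y)]" for y
    by (induction ws arbitrary: v) auto
  then show ?thesis using vs by (simp add: pairs_def)
qed

lemma cycle_edges_zip: "cycle_edges vs = pair_edge ` set (zip vs (rotate1 vs))"
  unfolding cycle_edges_def
  by (force simp: set_zip nth_rotate1 image_iff)

lemma cycle_length_zip: "cycle_length x vs = (\<Sum>(u, v)\<leftarrow>zip vs (rotate1 vs). dist (x u) (x v))"
  unfolding cycle_length_def sum_list_sum_nth length_map length_zip
  by (rule sum.cong) (auto simp: nth_rotate1 lessThan_atLeast0)

lemma cycle_edges_pairs:
  "vs \<noteq> [] \<Longrightarrow> cycle_edges vs = insert {last vs, hd vs} (pair_edge ` set (pairs vs))"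
  unfolding cycle_edges_zip cycle_pairs by auto

lemma cycle_length_path:
  "vs \<noteq> [] \<Longrightarrow> cycle_length x vs = path_length x vs + dist (x (last vs)) (x (hd vs))"
  unfolding cycle_length_zip cycle_pairs path_length_def by simp

text \<open>Counting the strictly nearer unvisited vertices expresses "one of the \<open>L\<close>
  nearest" without a convention on ties. The first vertex may lie outside \<open>S\<close>, as at
  the passage from one half to the other.\<close>

definition near_path :: "('v \<Rightarrow> 'a::metric_space) \<Rightarrow> 'v set \<Rightarrow> nat \<Rightarrow> 'v list \<Rightarrow> bool" where
  "near_path x S L vs \<longleftrightarrow> (\<forall>i. Suc i < length vs \<longrightarrow>
     card {u \<in> S - set (take (Suc i) vs). dist (x (vs ! i)) (x u) < dist (x (vs ! i)) (x (vs ! Suc i))} < L)"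

lemma near_path_snoc:
  assumes "vs \<noteq> []" "near_path x S L vs"
    "card {u \<in> S - set vs. dist (x (last vs)) (x u) < dist (x (last vs)) (x v)} < L"
  shows "near_path x S L (vs @ [v])"
  unfolding near_path_def
proof (intro allI impI)
  fix i assume i: "Suc i < length (vs @ [v])"
  show "card {u \<in> S - set (take (Suc i) (vs @ [v])).
      dist (x ((vs @ [v]) ! i)) (x u) < dist (x ((vs @ [v]) ! i)) (x ((vs @ [v]) ! Suc i))} < L"
  proof (cases "Suc i < length vs")
    case True
    then show ?thesis using assms(2) by (simp add: near_path_def nth_append)
  next
    case False
    then have "i = length vs - 1" "Suc i = length vs" using i assms(1) by auto
    then show ?thesis using assms(1,3) by (simp add: nth_append last_conv_nth)
  qed
qed

text \<open>Consider vertices that are left by steps longer than \<open>\<delta>\<close> and lie within \<open>\<delta>\<close> of each other: the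
  first of them to be left sees all the others as closer unvisited vertices.\<close>

lemma near_path_long_steps_within:
  assumes "near_path x S L vs" "distinct vs" "finite S" "set (tl vs) \<subseteq> S"
    and I: "I \<subseteq> {i. Suc i < length vs \<and> dist (x (vs ! i)) (x (vs ! Suc i)) > \<delta>}"
    and close: "\<And>i j. i \<in> I \<Longrightarrow> j \<in> I \<Longrightarrow> dist (x (vs ! i)) (x (vs ! j)) \<le> \<delta>"
  shows "card I \<le> L"
proof (cases "I = {}")
  case False
  have "finite I" by (rule finite_subset[OF I]) (rule finite_subset[of _ "{..<length vs}"], auto)
  define k where "k = Min I"
  have k: "k \<in> I" "\<And>i. i \<in> I \<Longrightarrow> k \<le> i" using False \<open>finite I\<close> by (auto simp: k_def)
  let ?V = "{u \<in> S - set (take (Suc k) vs). dist (x (vs ! k)) (x u) < dist (x (vs ! k)) (x (vs ! Suc k))}"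
  have "(!) vs ` (I - {k}) \<subseteq> ?V"
  proof
    fix u assume "u \<in> (!) vs ` (I - {k})"
    then obtain i where i: "i \<in> I" "i \<noteq> k" "u = vs ! i" by auto
    then have ki: "k < i" "i < length vs" using k(2) I by (force simp: less_le)+
    have "u \<in> set (tl vs)" using ki i(3) nth_mem[of "i - 1" "tl vs"] by (cases i) (auto simp: nth_tl)
    moreover have "u \<notin> set (take (Suc k) vs)"
      using ki i(3) assms(2) by (auto simp: in_set_conv_nth nth_eq_iff_index_eq)
    moreover have "dist (x (vs ! k)) (x u) \<le> \<delta>" using close[OF k(1) i(1)] i(3) by simp
    moreover have "\<delta> < dist (x (vs ! k)) (x (vs ! Suc k))" using k(1) I by auto
    ultimately show "u \<in> ?V" using assms(4) by auto
  qed
  moreover have "inj_on ((!) vs) (I - {k})"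
    using I assms(2) by (auto intro!: inj_on_nth)
  ultimately have "card (I - {k}) \<le> card ?V"
    using assms(3) by (intro card_inj_on_le[of "(!) vs"]) auto
  also have "card ?V < L" using assms(1) k(1) I unfolding near_path_def by blast
  finally show ?thesis using k(1) \<open>finite I\<close> by (simp add: card_Diff_singleton)
qed simp

section \<open>Length of greedy paths by dyadic scales\<close>

lemma dist_le_abs_sum:
  fixes p q :: "real \<times> real"
  shows "dist p q \<le> \<bar>fst p - fst q\<bar> + \<bar>snd p - snd q\<bar>"
  unfolding dist_prod_def dist_real_def
  by (rule order_trans[OF sqrt_sum_squares_le_sum_abs]) simp

lemma dist_unit_square:
  assumes "p \<in> unit_square" "q \<in> unit_square"
  shows "dist p q \<le> 2"
  using dist_le_abs_sum[of p q] assms by (auto simp: unit_square_def)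

text \<open>Grid cells of side \<open>1 / 2 ^ j\<close> have diameter at most
  \<open>2 / 2 ^ j\<close>, so each is left by at most \<open>L\<close> long steps. There are
  \<open>2 ^ j + 1\<close> rows and columns because a coordinate may equal 1; their product is at
  most \<open>4 * 4 ^ j\<close>.\<close>

lemma near_path_long_steps:
  fixes x :: "'v \<Rightarrow> real \<times> real"
  assumes "near_path x S L vs" "distinct vs" "finite S" "set (tl vs) \<subseteq> S"
    "\<And>v. v \<in> set vs \<Longrightarrow> x v \<in> unit_square"
  shows "card {i. Suc i < length vs \<and> dist (x (vs ! i)) (x (vs ! Suc i)) > 2 / 2 ^ j} \<le> L * (4 * 4 ^ j)"
    (is "card ?A \<le> _")
proof -
  define cell where "cell i = (nat \<lfloor>2 ^ j * fst (x (vs ! i))\<rfloor>, nat \<lfloor>2 ^ j * snd (x (vs ! i))\<rfloor>)" for i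
  let ?B = "{0..2 ^ j :: nat} \<times> {0..2 ^ j :: nat}"
  have finA: "finite ?A" by (rule finite_subset[of _ "{..<length vs}"]) auto
  have "cell ` ?A \<subseteq> ?B"
  proof
    fix b assume "b \<in> cell ` ?A"
    then obtain i where "Suc i < length vs" "b = cell i" by blast
    then have "x (vs ! i) \<in> unit_square" using assms(5) by simp
    then have "2 ^ j * fst (x (vs ! i)) \<le> 2 ^ j" "2 ^ j * snd (x (vs ! i)) \<le> 2 ^ j"
      by (auto simp: unit_square_def)
    then have "\<lfloor>2 ^ j * fst (x (vs ! i))\<rfloor> \<le> 2 ^ j" "\<lfloor>2 ^ j * snd (x (vs ! i))\<rfloor> \<le> 2 ^ j"
      unfolding floor_le_iff of_int_power of_int_numeral by linarith+
    then show "b \<in> ?B" using \<open>b = cell i\<close> by (simp add: cell_def nat_le_iff)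
  qed
  then have "card ?A = (\<Sum>b\<in>?B. card {i \<in> ?A. cell i = b})"
    using sum.group[OF finA, of ?B cell "\<lambda>_. 1 :: nat"] by simp
  also have "\<dots> \<le> (\<Sum>b\<in>?B. L)"
  proof (intro sum_mono near_path_long_steps_within[OF assms(1-4), where \<delta> = "2 / 2 ^ j"])
    fix b i k assume *: "i \<in> {i \<in> ?A. cell i = b}" "k \<in> {i \<in> ?A. cell i = b}"
    then have sq: "x (vs ! i) \<in> unit_square" "x (vs ! k) \<in> unit_square" using assms(5) by auto
    have "cell i = cell k" using * by auto
    then have "\<lfloor>2 ^ j * fst (x (vs ! i))\<rfloor> = \<lfloor>2 ^ j * fst (x (vs ! k))\<rfloor>"
        "\<lfloor>2 ^ j * snd (x (vs ! i))\<rfloor> = \<lfloor>2 ^ j * snd (x (vs ! k))\<rfloor>"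
      using sq by (auto simp: cell_def unit_square_def eq_nat_nat_iff)
    then have "\<bar>2 ^ j * fst (x (vs ! i)) - 2 ^ j * fst (x (vs ! k))\<bar> \<le> 1"
        "\<bar>2 ^ j * snd (x (vs ! i)) - 2 ^ j * snd (x (vs ! k))\<bar> \<le> 1"
      by linarith+
    then have "2 ^ j * \<bar>fst (x (vs ! i)) - fst (x (vs ! k))\<bar> \<le> 1" "2 ^ j * \<bar>snd (x (vs ! i)) - snd (x (vs ! k))\<bar> \<le> 1"
      by (simp_all add: abs_mult flip: right_diff_distrib)
    then have "2 ^ j * (\<bar>fst (x (vs ! i)) - fst (x (vs ! k))\<bar> + \<bar>snd (x (vs ! i)) - snd (x (vs ! k))\<bar>) \<le> 2"
      by (simp add: distrib_left)
    moreover have "2 ^ j * dist (x (vs ! i)) (x (vs ! k))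
        \<le> 2 ^ j * (\<bar>fst (x (vs ! i)) - fst (x (vs ! k))\<bar> + \<bar>snd (x (vs ! i)) - snd (x (vs ! k))\<bar>)"
      by (intro mult_left_mono dist_le_abs_sum) simp
    ultimately have "2 ^ j * dist (x (vs ! i)) (x (vs ! k)) \<le> 2" by linarith
    then show "dist (x (vs ! i)) (x (vs ! k)) \<le> 2 / 2 ^ j"
      by (simp add: pos_le_divide_eq mult.commute)
  qed auto
  also have "\<dots> = L * ((2 ^ j + 1) * (2 ^ j + 1))" by simp
  also have "\<dots> \<le> L * ((2 * 2 ^ j) * (2 * 2 ^ j))"
    by (intro mult_le_mono order_refl) auto
  also have "\<dots> = L * (4 * 4 ^ j)" by (simp flip: power_mult_distrib)
  finally show ?thesis .
qed

text \<open>A layer-cake bound. Passing from \<open>J\<close> to \<open>Suc J\<close> halves the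
  first term; if \<open>l\<close> exceeds the new threshold, the added summand
  \<open>4 / 2 ^ Suc J = 2 / 2 ^ J\<close> makes up for the loss, and otherwise the first term alone
  suffices.\<close>

lemma dyadic_layers:
  fixes l :: real
  assumes "l \<le> 2"
  shows "l \<le> 2 / 2 ^ J + (\<Sum>j=1..J. if l > 2 / 2 ^ j then 4 / 2 ^ j else 0)"
proof (induction J)
  case (Suc J)
  have "0 \<le> (\<Sum>j=1..J. if l > 2 / 2 ^ j then 4 / 2 ^ j else (0::real))" by (intro sum_nonneg) auto
  then have "0 \<le> (\<Sum>j=1..J. if l > 2 / 2 ^ j then 4 / 2 ^ j else (0::real)) * 2 ^ J" by simp
  then show ?case using Suc by (auto simp: divide_simps)
qed (use assms in simp)

text \<open>On scale \<open>j\<close> at most \<open>L * (4 * 4 ^ j)\<close> long steps are charged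
  \<open>4 / 2 ^ j\<close> each. The result \<open>16 * L * 2 ^ j\<close> grows geometrically, so
  the finest scale dominates. With \<open>2 ^ J\<close> of order sqrt n and at most n vertices, both
  terms are O(L sqrt n).\<close>

lemma near_path_length:
  fixes x :: "'v \<Rightarrow> real \<times> real"
  assumes "near_path x S L vs" "distinct vs" "finite S" "set (tl vs) \<subseteq> S"
    "\<And>v. v \<in> set vs \<Longrightarrow> x v \<in> unit_square"
  shows "path_length x vs \<le> 2 * real (length vs) / 2 ^ J + 32 * real L * 2 ^ J"
proof -
  define l where "l i = dist (x (vs ! i)) (x (vs ! Suc i))" for i
  let ?k = "length vs - 1"
  have l2: "l i \<le> 2" if "i < ?k" for i
    unfolding l_def using that assms(5) by (intro dist_unit_square) auto
  have "path_length x vs = (\<Sum>i<?k. l i)" by (simp add: path_length_nth l_def)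
  also have "\<dots> \<le> (\<Sum>i<?k. 2 / 2 ^ J + (\<Sum>j=1..J. if l i > 2 / 2 ^ j then 4 / 2 ^ j else 0))"
    using l2 by (intro sum_mono dyadic_layers) auto
  also have "\<dots> = 2 * real ?k / 2 ^ J + (\<Sum>j=1..J. \<Sum>i<?k. if l i > 2 / 2 ^ j then 4 / 2 ^ j else 0)"
    unfolding sum.distrib by (subst sum.swap) simp
  also have "\<dots> \<le> 2 * real (length vs) / 2 ^ J + (\<Sum>j=1..J. 16 * real L * 2 ^ j)"
  proof (intro add_mono sum_mono)
    fix j
    have eq: "{..<?k} \<inter> {i. l i > 2 / 2 ^ j} = {i. Suc i < length vs \<and> l i > 2 / 2 ^ j}" by auto
    have "real (card {i. Suc i < length vs \<and> l i > 2 / 2 ^ j}) \<le> real (L * (4 * 4 ^ j))"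
      using near_path_long_steps[OF assms, of j] unfolding l_def by (rule of_nat_mono)
    then have "4 / 2 ^ j * real (card {i. Suc i < length vs \<and> l i > 2 / 2 ^ j}) \<le> 4 / 2 ^ j * real (L * (4 * 4 ^ j))"
      by (intro mult_left_mono) auto
    also have "\<dots> = 16 * real L * 2 ^ j"
    proof -
      have "(4::real) ^ j = 2 ^ j * 2 ^ j" by (simp flip: power_mult_distrib)
      then show ?thesis by simp
    qed
    finally show "(\<Sum>i<?k. if l i > 2 / 2 ^ j then 4 / 2 ^ j else 0) \<le> 16 * real L * 2 ^ j"
      using eq by (simp add: sum.If_cases mult.commute)
  qed (auto intro!: divide_right_mono)
  also have "(\<Sum>j=1..J. 16 * real L * 2 ^ j) \<le> 32 * real L * 2 ^ J"
    by (induction J) (auto simp: algebra_simps)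
  finally show ?thesis by simp
qed

section \<open>A short rainbow Hamilton cycle\<close>

text \<open>Taking a minimum of the rest \<open>B\<close> times gives a set whose elements are below
  all others. Whatever is smaller than a chosen \<open>k\<close> is then itself chosen and different
  from \<open>k\<close>.\<close>

lemma nearest_subset:
  fixes f :: "'v \<Rightarrow> real"
  assumes "finite N" "B \<le> card N"
  shows "\<exists>K \<subseteq> N. card K = B \<and> (\<forall>k\<in>K. card {u \<in> N. f u < f k} < B)"
proof -
  have "\<exists>K \<subseteq> N. card K = B \<and> (\<forall>k\<in>K. \<forall>u\<in>N - K. f k \<le> f u)"
    using assms(2)
  proof (induction B)
    case (Suc B)
    then obtain K where K: "K \<subseteq> N" "card K = B" "\<forall>k\<in>K. \<forall>u\<in>N - K. f k \<le> f u" by auto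
    have fin: "finite K" using K(1) assms(1) by (rule finite_subset)
    have "N - K \<noteq> {}" using K Suc.prems fin card_mono[of K N] by force
    then obtain m where m: "m \<in> N - K" "\<forall>u\<in>N - K. f m \<le> f u"
      using ex_min_if_finite[of "f ` (N - K)"] assms(1) by (fastforce simp: not_less)
    have "insert m K \<subseteq> N" "card (insert m K) = Suc B"
        "\<forall>k\<in>insert m K. \<forall>u\<in>N - insert m K. f k \<le> f u"
      using K m fin by auto
    then show ?case by blast
  qed (auto intro!: exI[of _ "{}"])
  then obtain K where K: "K \<subseteq> N" "card K = B" "\<forall>k\<in>K. \<forall>u\<in>N - K. f k \<le> f u" by auto
  have fin: "finite K" using K(1) assms(1) by (rule finite_subset)
  have "card {u \<in> N. f u < f k} < B" if "k \<in> K" for k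
  proof -
    have "card {u \<in> N. f u < f k} \<le> card (K - {k})"
      by (rule card_mono) (use K(3) that fin in \<open>force+\<close>)
    also have "\<dots> < B" using K(2) that fin by (metis card_Diff1_less)
    finally show ?thesis .
  qed
  then show ?thesis using K by blast
qed

text \<open>Every second edge of a path, a matching. Inserting a vertex into edges of a matching
  gives trial edges that are pairwise different, and one insertion leaves all other places
  intact.\<close>

fun disjoint_pairs :: "'a list \<Rightarrow> ('a \<times> 'a) list" where
  "disjoint_pairs (a # b # xs) = (a, b) # disjoint_pairs xs"
| "disjoint_pairs _ = []"

lemma length_disjoint_pairs: "length (disjoint_pairs xs) = length xs div 2"
  by (induction xs rule: disjoint_pairs.induct) auto

lemma disjoint_pairs_subset: "set (disjoint_pairs xs) \<subseteq> set (pairs xs)"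
proof (induction xs rule: disjoint_pairs.induct)
  case (1 a b xs)
  then show ?case by (cases xs) auto
qed auto

lemma disjoint_pairs_elems: "p \<in> set (disjoint_pairs xs) \<Longrightarrow> fst p \<in> set xs \<and> snd p \<in> set xs"
  by (induction xs rule: disjoint_pairs.induct) auto

lemma distinct_disjoint_pairs: "distinct xs \<Longrightarrow> distinct (disjoint_pairs xs)"
  by (induction xs rule: disjoint_pairs.induct) (auto dest: disjoint_pairs_elems)

lemma disjoint_pairs_disjoint:
  assumes "distinct xs" "p \<in> set (disjoint_pairs xs)" "p' \<in> set (disjoint_pairs xs)" "p \<noteq> p'"
  shows "pair_edge p \<inter> pair_edge p' = {}"
  using assms
  by (induction xs rule: disjoint_pairs.induct) (auto simp: pair_edge_def dest: disjoint_pairs_elems)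

lemma pairs_infix: "set (pairs xs) \<subseteq> set (pairs (ys @ xs @ zs))"
proof (cases xs)
  case (Cons a as)
  have "set (pairs xs) \<subseteq> set (pairs (xs @ zs))"
  proof (cases zs)
    case (Cons z zs')
    then show ?thesis using pairs_append[of xs z zs'] pairs_snoc[of xs z] \<open>xs = a # as\<close> by auto
  qed simp
  then show ?thesis using pairs_append[of ys a "as @ zs"] Cons by auto
qed simp

lemma pairs_neq: "distinct xs \<Longrightarrow> (a, b) \<in> set (pairs xs) \<Longrightarrow> a \<noteq> b"
  by (induction xs rule: induct_list012) auto

section \<open>Random colours on fixed points\<close>

lemma finite_edges: "finite (edges n)"
  unfolding edges_def by (rule finite_subset[of _ "Pow {..<n}"]) auto

lemma pair_in_edges: "u < n \<Longrightarrow> v < n \<Longrightarrow> u \<noteq> v \<Longrightarrow> {u, v} \<in> edges n"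
  by (simp add: edges_def)

text \<open>\<open>r\<close> bounds the fraction of colours that a tour can occupy, \<open>B\<close>
  is the number of candidates offered in each step, and \<open>\<Lambda>\<close> is the length to be
  achieved.\<close>

locale points_and_colors =
  fixes n q :: nat and x :: "nat \<Rightarrow> real \<times> real" and r :: real and B :: nat and \<Lambda> :: real
  assumes unit_square: "\<And>i. i < n \<Longrightarrow> x i \<in> unit_square"
    and q_pos: "q > 0" and n_le: "real n \<le> r * real q" and r_ge_0: "0 \<le> r" and r_le_1: "r \<le> 1"
begin

definition bad :: "(nat set \<Rightarrow> nat) \<Rightarrow> bool" where
  "bad col \<longleftrightarrow> (\<forall>vs. hamilton_cycle n vs \<longrightarrow> rainbow col vs \<longrightarrow> cycle_length x vs > \<Lambda>)"

abbreviation "prob \<equiv> cond_prob (edges n) q bad"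

text \<open>Bound on the failure probability of a trial that needs two fresh and different
  colours.\<close>

abbreviation "s \<equiv> 1 - (1 - r)\<^sup>2"

lemma s_ge_0: "0 \<le> s"
  using r_ge_0 r_le_1 by (simp add: power_le_one)

lemma dist_le_2: "i < n \<Longrightarrow> j < n \<Longrightarrow> dist (x i) (x j) \<le> 2"
  using unit_square by (intro dist_unit_square) auto

text \<open>The vertices of \<open>W\<close> are inserted one by one into edges of the matching
  \<open>M\<close>. An insertion destroys one place and exposes only edges at the inserted vertex,
  so the count \<open>B + card W\<close> drops in step with \<open>W\<close> and \<open>B\<close>
  places are always left. It adds at most two distances of at most 2, hence the allowance of 4 per
  vertex. At the end the whole tour is exposed and rainbow, which rules out
  \<open>bad\<close>.\<close>

lemma prob_insert:
  assumes "finite W" "W \<inter> set vs = {}" "distinct vs" "set vs \<union> W = {..<n}" "3 \<le> length vs"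
    "inj_on c (cycle_edges vs)" "cycle_edges vs \<subseteq> X" "\<And>e. c e < q"
    "finite M" "M \<subseteq> set (pairs vs)"
    "\<And>p p'. p \<in> M \<Longrightarrow> p' \<in> M \<Longrightarrow> p \<noteq> p' \<Longrightarrow> pair_edge p \<inter> pair_edge p' = {}"
    "\<And>w. w \<in> W \<Longrightarrow> B + card W \<le> card {p \<in> M. {w, fst p} \<notin> X \<and> {w, snd p} \<notin> X}"
    "cycle_length x vs + 4 * real (card W) \<le> \<Lambda>"
  shows "prob X c \<le> real (card W) * s ^ B"
  using assms
proof (induction "card W" arbitrary: W vs X c M)
  case 0
  have "hamilton_cycle n vs" "cycle_length x vs \<le> \<Lambda>"
    using 0 distinct_card[of vs] by (auto simp: hamilton_cycle_def)
  have "\<not> bad col" if "col \<in> extensions (edges n) q X c" for col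
  proof -
    have "inj_on col (cycle_edges vs)"
      using 0(7,8) that by (subst inj_on_cong[of _ _ c]) (auto simp: extensions_def)
    then show ?thesis using \<open>hamilton_cycle n vs\<close> \<open>cycle_length x vs \<le> \<Lambda>\<close>
      by (auto simp: bad_def rainbow_def)
  qed
  then have "prob X c = 0" by (rule cond_prob_eq_0)
  then show ?case using s_ge_0 by simp
next
  case (Suc m)
  then obtain w where w: "w \<in> W" by fastforce
  have vs_ne: "vs \<noteq> []" using Suc.prems(5) by auto
  have wn: "w < n" "w \<notin> set vs" using w Suc.prems(2,4) by auto
  have vn: "v < n" if "v \<in> set vs" for v using that Suc.prems(4) by auto
  let ?J = "{p \<in> M. {w, fst p} \<notin> X \<and> {w, snd p} \<notin> X}"
  obtain J where J: "J \<subseteq> ?J" "card J = B" "finite J"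
    using Suc.prems(12)[OF w] obtain_subset_with_card_n[of B ?J] by auto
  have Jvs: "fst p \<in> set vs" "snd p \<in> set vs" "fst p \<noteq> snd p" if "p \<in> J" for p
    using that J(1) Suc.prems(10) set_pairsD[of "fst p" "snd p" vs]
      pairs_neq[OF Suc.prems(3), of "fst p" "snd p"] by auto
  have Jdis: "pair_edge p \<inter> pair_edge p' = {}" if "p \<in> J" "p' \<in> J" "p \<noteq> p'" for p p'
    using that J(1) Suc.prems(11) by blast
  \<comment> \<open>\<open>w\<close> is still outside the tour, so the tour uses fewer than
    \<open>n\<close> colours; the spare one accounts for the \<open>+ 1\<close> in
    \<open>cond_prob_pair_trials\<close>.\<close>
  have "card (cycle_edges vs) \<le> length vs"
    unfolding cycle_edges_zip
    using card_image_le[of "set (zip vs (rotate1 vs))" pair_edge] card_length[of "zip vs (rotate1 vs)"]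
    by simp
  moreover have "length vs + card W = n"
    using Suc.prems(1-4) by (metis card_Un_disjoint card_lessThan distinct_card finite_set inf_commute)
  ultimately have "card (cycle_edges vs) + 1 \<le> n" using Suc.hyps(2) by linarith
  moreover have finU: "finite (cycle_edges vs)" unfolding cycle_edges_zip by simp
  ultimately have "card (c ` cycle_edges vs) + 1 \<le> n" using card_image_le[OF finU, of c] by linarith
  then have U: "real (card (c ` cycle_edges vs)) + 1 \<le> r * real q" using n_le by linarith
  have "prob X c \<le> real m * s ^ B + s ^ card J"
  proof (rule cond_prob_pair_trials[where U = "c ` cycle_edges vs" and f = "\<lambda>p. {w, fst p}"
        and g = "\<lambda>p. {w, snd p}" and r = r])
    have eqI: "p = p'" if "p \<in> J" "p' \<in> J" "u \<in> {fst p, snd p}" "u \<in> {fst p', snd p'}" for p p' u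
      using Jdis[OF that(1,2)] that(3,4) unfolding pair_edge_def by blast
    show "inj_on (\<lambda>p. {w, fst p}) J"
    proof (rule inj_onI)
      fix p p' assume *: "p \<in> J" "p' \<in> J" "{w, fst p} = {w, fst p'}"
      then have "fst p = fst p'" by (metis doubleton_eq_iff)
      then show "p = p'" using eqI[OF *(1,2), of "fst p"] by simp
    qed
    show "inj_on (\<lambda>p. {w, snd p}) J"
    proof (rule inj_onI)
      fix p p' assume *: "p \<in> J" "p' \<in> J" "{w, snd p} = {w, snd p'}"
      then have "snd p = snd p'" by (metis doubleton_eq_iff)
      then show "p = p'" using eqI[OF *(1,2), of "snd p"] by simp
    qed
    have "{w, fst p} \<noteq> {w, snd p'}" if *: "p \<in> J" "p' \<in> J" for p p'
    proof
      assume "{w, fst p} = {w, snd p'}"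
      then have "fst p = snd p'" by (metis doubleton_eq_iff)
      then show False using eqI[OF *, of "fst p"] Jvs(3)[OF *(1)] by auto
    qed
    then show "(\<lambda>p. {w, fst p}) ` J \<inter> (\<lambda>p. {w, snd p}) ` J = {}" by blast
    show "(\<lambda>p. {w, fst p}) ` J \<union> (\<lambda>p. {w, snd p}) ` J \<subseteq> edges n"
      using Jvs wn vn by (auto intro!: pair_in_edges)
    show "((\<lambda>p. {w, fst p}) ` J \<union> (\<lambda>p. {w, snd p}) ` J) \<inter> X = {}" using J(1) by auto
    fix F c' p
    assume F: "F \<subseteq> (\<lambda>p. {w, fst p}) ` J \<union> (\<lambda>p. {w, snd p}) ` J"
      and p: "p \<in> J" "{w, fst p} \<in> F" "{w, snd p} \<in> F"
      and c': "c' {w, fst p} \<notin> c ` cycle_edges vs" "c' {w, snd p} \<notin> c ` cycle_edges vs"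
        "c' {w, fst p} \<noteq> c' {w, snd p}" "\<And>e. e \<in> X \<Longrightarrow> c' e = c e" "\<And>e. c' e < q"
    obtain a b where ab: "p = (a, b)" by fastforce
    obtain ys zs where vs: "vs = ys @ [a, b] @ zs"
      using p(1) ab J(1) Suc.prems(10) by (auto elim!: set_pairs_split)
    let ?vs = "ys @ [a, w, b] @ zs"
    have ends: "hd ?vs = hd vs" "last ?vs = last vs" using vs by (cases ys; simp)+
    have old: "set (pairs vs) = set (pairs (ys @ [a])) \<union> {(a, b)} \<union> set (pairs (b # zs))"
      using vs pairs_append[of ys a "b # zs"] by simp
    have new: "cycle_edges ?vs \<subseteq> cycle_edges vs \<union> {{w, a}, {w, b}}"
    proof -
      have 1: "cycle_edges ?vs = insert {last ?vs, hd ?vs} (pair_edge ` set (pairs ?vs))"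
        by (rule cycle_edges_pairs) simp
      show ?thesis
        unfolding 1 cycle_edges_pairs[OF vs_ne] ends old pairs_insert using insert_commute[of a w] by auto
    qed
    have "prob (X \<union> F) c' \<le> real (card (W - {w})) * s ^ B"
    proof (rule Suc.hyps(1)[where vs = ?vs and M = "M - {p}"])
      show "m = card (W - {w})" using Suc.hyps(2) w by simp
      show "(W - {w}) \<inter> set ?vs = {}" "distinct ?vs" "set ?vs \<union> (W - {w}) = {..<n}" "3 \<le> length ?vs"
        using Suc.prems(2-5) w wn(2) vs by auto
      have same: "c' e = c e" if "e \<in> cycle_edges vs" for e using c'(4) that Suc.prems(7) by blast
      then have "inj_on c' (cycle_edges vs)" using Suc.prems(6) by (subst inj_on_cong[of _ _ c]) auto
      moreover have "c' ` cycle_edges vs = c ` cycle_edges vs" using same by (rule image_cong[OF refl])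
      ultimately have "inj_on c' (insert {w, a} (insert {w, b} (cycle_edges vs)))"
        using c'(1-3) ab by (auto simp: inj_on_insert)
      then show "inj_on c' (cycle_edges ?vs)" by (rule inj_on_subset) (use new in auto)
      show "cycle_edges ?vs \<subseteq> X \<union> F" using new Suc.prems(7) p ab by auto
      show "M - {p} \<subseteq> set (pairs ?vs)" unfolding pairs_insert using Suc.prems(10) old ab by auto
      show "pair_edge p1 \<inter> pair_edge p2 = {}" if "p1 \<in> M - {p}" "p2 \<in> M - {p}" "p1 \<noteq> p2" for p1 p2
        using that Suc.prems(11) by blast
      show "B + card (W - {w}) \<le> card {p' \<in> M - {p}. {w', fst p'} \<notin> X \<union> F \<and> {w', snd p'} \<notin> X \<union> F}"
        if w': "w' \<in> W - {w}" for w'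
      proof -
        \<comment> \<open>Only the place \<open>p\<close> can be lost: every edge of
          \<open>F\<close> contains \<open>w\<close>, which is neither \<open>w'\<close> nor a
          vertex of the old tour.\<close>
        have "{p' \<in> M. {w', fst p'} \<notin> X \<and> {w', snd p'} \<notin> X} - {p}
            \<subseteq> {p' \<in> M - {p}. {w', fst p'} \<notin> X \<union> F \<and> {w', snd p'} \<notin> X \<union> F}"
        proof
          fix p' assume p': "p' \<in> {p' \<in> M. {w', fst p'} \<notin> X \<and> {w', snd p'} \<notin> X} - {p}"
          then have "fst p' \<in> set vs" "snd p' \<in> set vs"
            using Suc.prems(10) set_pairsD[of "fst p'" "snd p'" vs] by auto
          then have "w \<notin> {w', fst p'}" "w \<notin> {w', snd p'}" using w' wn(2) by auto
          then have "{w', fst p'} \<notin> F" "{w', snd p'} \<notin> F" using F by auto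
          then show "p' \<in> {p' \<in> M - {p}. {w', fst p'} \<notin> X \<union> F \<and> {w', snd p'} \<notin> X \<union> F}"
            using p' by auto
        qed
        then have "card ({p' \<in> M. {w', fst p'} \<notin> X \<and> {w', snd p'} \<notin> X} - {p})
            \<le> card {p' \<in> M - {p}. {w', fst p'} \<notin> X \<union> F \<and> {w', snd p'} \<notin> X \<union> F}"
          using Suc.prems(9) by (intro card_mono) auto
        moreover have "card {p' \<in> M. {w', fst p'} \<notin> X \<and> {w', snd p'} \<notin> X} - 1
            \<le> card ({p' \<in> M. {w', fst p'} \<notin> X \<and> {w', snd p'} \<notin> X} - {p})"
          by (metis (no_types, lifting) card_Diff_singleton_if diff_le_self order_refl)
        moreover have "B + card W \<le> card {p' \<in> M. {w', fst p'} \<notin> X \<and> {w', snd p'} \<notin> X}"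
          using w' by (intro Suc.prems(12)) simp
        moreover have "card (W - {w}) = card W - 1" "card W > 0" using w Suc.hyps(2) by simp_all
        ultimately show ?thesis by linarith
      qed
      have "cycle_length x ?vs \<le> cycle_length x vs + 4"
      proof -
        have "path_length x ?vs = path_length x (ys @ [a]) + dist (x a) (x w) + dist (x w) (x b) + path_length x (b # zs)"
          using path_length_append[of x ys a "w # b # zs"] by (simp add: path_length_def)
        moreover have "path_length x vs = path_length x (ys @ [a]) + dist (x a) (x b) + path_length x (b # zs)"
          using vs path_length_append[of x ys a "b # zs"] by (simp add: path_length_def)
        moreover have "dist (x a) (x w) \<le> 2" "dist (x w) (x b) \<le> 2"
          using wn vn vs by (auto intro!: dist_le_2)
        moreover have "cycle_length x ?vs = path_length x ?vs + dist (x (last vs)) (x (hd vs))"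
          unfolding ends[symmetric] by (rule cycle_length_path) simp
        moreover have "cycle_length x vs = path_length x vs + dist (x (last vs)) (x (hd vs))"
          using vs_ne by (rule cycle_length_path)
        moreover have "0 \<le> dist (x a) (x b)" by simp
        ultimately show ?thesis by linarith
      qed
      moreover have "real (card W) = real (card (W - {w})) + 1"
        using w Suc.prems(1) Suc.hyps(2) by simp
      ultimately show "cycle_length x ?vs + 4 * real (card (W - {w})) \<le> \<Lambda>" using Suc.prems(13) by linarith
    qed (use Suc.prems c' in auto)
    moreover have "card (W - {w}) = m" using Suc.hyps(2) w by simp
    ultimately show "prob (X \<union> F) c' \<le> real m * s ^ B" by (simp only:)
  qed (use finite_edges q_pos finU U r_ge_0 r_le_1 J s_ge_0 Suc.prems(8) in auto)
  then show ?case using Suc.hyps(2)[symmetric] J(2) by (simp add: algebra_simps)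
qed

lemma card_colors_path: "card (c ` pair_edge ` set (pairs P)) \<le> length P - 1"
proof -
  have "card (c ` pair_edge ` set (pairs P)) \<le> card (pair_edge ` set (pairs P))"
    by (rule card_image_le) simp
  also have "\<dots> \<le> card (set (pairs P))" by (rule card_image_le) simp
  also have "\<dots> \<le> length P - 1" using card_length[of "pairs P"] by simp
  finally show ?thesis .
qed

text \<open>Joining both ends of \<open>P\<close> to a left-over vertex \<open>k\<close> is again a
  trial with two edges, after which \<open>prob_insert\<close> takes over. The trial may expose any
  edge from \<open>K\<close> to the two ends, so \<open>avail\<close> counts only places that avoid
  them all. The cost of closing, at most 4, is charged to \<open>k\<close>, which leaves
  \<open>W\<close>.\<close>

lemma prob_close:
  assumes "finite W" "W \<inter> set P = {}" "distinct P" "set P \<union> W = {..<n}" "2 \<le> length P"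
    "inj_on c (pair_edge ` set (pairs P))" "pair_edge ` set (pairs P) \<subseteq> X" "\<And>e. c e < q"
    "finite M" "M \<subseteq> set (pairs P)"
    "\<And>p p'. p \<in> M \<Longrightarrow> p' \<in> M \<Longrightarrow> p \<noteq> p' \<Longrightarrow> pair_edge p \<inter> pair_edge p' = {}"
    and K: "K \<subseteq> W" "card K = B" "\<And>k. k \<in> K \<Longrightarrow> {last P, k} \<notin> X \<and> {k, hd P} \<notin> X"
    and avail: "\<And>w. w \<in> W \<Longrightarrow> B + card W \<le> card {p \<in> M. \<forall>u\<in>{fst p, snd p}.
        {w, u} \<notin> X \<and> (\<forall>k\<in>K. {w, u} \<noteq> {last P, k} \<and> {w, u} \<noteq> {k, hd P})}"
    and len: "path_length x P + 4 * real (card W) \<le> \<Lambda>"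
  shows "prob X c \<le> (real (card W) + 1) * s ^ B"
proof -
  let ?s = "hd P" and ?t = "last P"
  let ?T = "(\<lambda>k. {?t, k}) ` K \<union> (\<lambda>k. {k, ?s}) ` K"
  have P_ne: "P \<noteq> []" using assms(5) by auto
  have st: "?s \<in> set P" "?t \<in> set P" using P_ne by auto
  have neq: "?s \<noteq> ?t"
  proof -
    obtain a b P' where "P = a # b # P'" using assms(5) by (cases P; cases "tl P") auto
    then show ?thesis using assms(3) by auto
  qed
  have finK: "finite K" using K(1) assms(1) by (rule finite_subset)
  have KP: "k \<notin> set P" "k < n" if "k \<in> K" for k using that K(1) assms(2,4) by auto
  have vn: "v < n" if "v \<in> set P" for v using that assms(4) by auto
  have lenn: "length P + card W = n"
    using assms(1-4) by (metis card_Un_disjoint card_lessThan distinct_card finite_set inf_commute)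
  let ?U = "c ` pair_edge ` set (pairs P)"
  have "card ?U + 1 \<le> n" using card_colors_path[of c P] lenn assms(5) by linarith
  then have U: "real (card ?U) + 1 \<le> r * real q" using n_le by linarith
  have "prob X c \<le> real (card W) * s ^ B + s ^ card K"
  proof (rule cond_prob_pair_trials[where U = ?U and f = "\<lambda>k. {?t, k}" and g = "\<lambda>k. {k, ?s}" and r = r])
    show "inj_on (\<lambda>k. {?t, k}) K" "inj_on (\<lambda>k. {k, ?s}) K"
      by (auto simp: inj_on_def doubleton_eq_iff)
    show "(\<lambda>k. {?t, k}) ` K \<inter> (\<lambda>k. {k, ?s}) ` K = {}"
      using neq KP(1) st by (auto simp: doubleton_eq_iff)
    show "?T \<subseteq> edges n" using KP st vn by (auto intro!: pair_in_edges)
    show "?T \<inter> X = {}" using K(3) by auto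
    fix F c' k
    assume F: "F \<subseteq> ?T" and k: "k \<in> K" "{?t, k} \<in> F" "{k, ?s} \<in> F"
      and c': "c' {?t, k} \<notin> ?U" "c' {k, ?s} \<notin> ?U"
        "c' {?t, k} \<noteq> c' {k, ?s}" "\<And>e. e \<in> X \<Longrightarrow> c' e = c e" "\<And>e. c' e < q"
    have kW: "k \<in> W" using k(1) K(1) by auto
    have new: "cycle_edges (P @ [k]) = insert {k, ?s} (insert {?t, k} (pair_edge ` set (pairs P)))"
      using P_ne by (subst cycle_edges_pairs) (auto simp: pairs_snoc)
    have cardW: "card (W - {k}) = card W - 1" using kW assms(1) by simp
    have cardW0: "card W > 0" using kW assms(1) by (auto simp: card_gt_0_iff)
    have "prob (X \<union> F) c' \<le> real (card (W - {k})) * s ^ B"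
    proof (rule prob_insert[where vs = "P @ [k]" and M = M])
      show "(W - {k}) \<inter> set (P @ [k]) = {}" "distinct (P @ [k])"
          "set (P @ [k]) \<union> (W - {k}) = {..<n}" "3 \<le> length (P @ [k])"
        using assms(2-5) KP(1)[OF k(1)] kW by auto
      have same: "c' e = c e" if "e \<in> pair_edge ` set (pairs P)" for e using c'(4) that assms(7) by blast
      then have "inj_on c' (pair_edge ` set (pairs P))" using assms(6) by (subst inj_on_cong[of _ _ c]) auto
      moreover have "c' ` pair_edge ` set (pairs P) = ?U" using same by (rule image_cong[OF refl])
      ultimately show "inj_on c' (cycle_edges (P @ [k]))"
        using c'(1-3) unfolding new by (simp only: inj_on_insert) auto
      show "cycle_edges (P @ [k]) \<subseteq> X \<union> F" unfolding new using assms(7) k by auto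
      show "M \<subseteq> set (pairs (P @ [k]))" using assms(10) P_ne by (auto simp: pairs_snoc)
      show "B + card (W - {k}) \<le> card {p \<in> M. {w, fst p} \<notin> X \<union> F \<and> {w, snd p} \<notin> X \<union> F}"
        if w: "w \<in> W - {k}" for w
      proof -
        have "B + card (W - {k}) \<le> B + card W" using cardW by simp
        also have "\<dots> \<le> card {p \<in> M. \<forall>u\<in>{fst p, snd p}.
            {w, u} \<notin> X \<and> (\<forall>k\<in>K. {w, u} \<noteq> {last P, k} \<and> {w, u} \<noteq> {k, hd P})}"
          using w by (intro avail) auto
        also have "\<dots> \<le> card {p \<in> M. {w, fst p} \<notin> X \<union> F \<and> {w, snd p} \<notin> X \<union> F}"
          using F assms(9) by (intro card_mono) auto
        finally show ?thesis .
      qed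
      have "cycle_length x (P @ [k]) = path_length x P + dist (x ?t) (x k) + dist (x k) (x ?s)"
        using P_ne by (simp add: cycle_length_path path_length_snoc)
      moreover have "dist (x ?t) (x k) \<le> 2" "dist (x k) (x ?s) \<le> 2"
        using KP[OF k(1)] st vn by (auto intro!: dist_le_2)
      moreover have "real (card W) = real (card (W - {k})) + 1" using cardW cardW0 by simp
      ultimately show "cycle_length x (P @ [k]) + 4 * real (card (W - {k})) \<le> \<Lambda>"
        using len by linarith
    qed (use assms c' in auto)
    also have "\<dots> \<le> real (card W) * s ^ B" using s_ge_0 cardW by (intro mult_right_mono) auto
    finally show "prob (X \<union> F) c' \<le> real (card W) * s ^ B" .
  qed (use finite_edges q_pos U r_ge_0 r_le_1 finK s_ge_0 assms(8) in auto)
  then show ?thesis using K(2) by (simp add: algebra_simps)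
qed

text \<open>\<open>P\<close> is a fixed initial path, \<open>G\<close> its extension inside \<open>S\<close>. Only edges from vertices that have been
  left have been exposed, so those at the current end are still free.\<close>

definition grown :: "nat list \<Rightarrow> nat set \<Rightarrow> nat set set \<Rightarrow> nat list \<Rightarrow> nat set set \<Rightarrow> (nat set \<Rightarrow> nat) \<Rightarrow> bool" where
  "grown P S X\<^sub>0 G X c \<longleftrightarrow> distinct (P @ G) \<and> set G \<subseteq> S \<and> near_path x S B (last P # G) \<and>
     inj_on c (pair_edge ` set (pairs (P @ G))) \<and> pair_edge ` set (pairs (P @ G)) \<subseteq> X \<and>
     X \<subseteq> X\<^sub>0 \<union> {{p, u} | p u. p \<in> set (butlast (last P # G)) \<and> u \<in> S} \<and> (\<forall>e. c e < q)"

text \<open>The hypothesis \<open>final\<close> bounds whatever follows once only \<open>B\<close>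
  vertices of \<open>S\<close> are left, so two uses of this lemma can be nested, one for each half.
  \<open>X\<^sub>0\<close> holds the edges exposed before this phase. Every step offers
  \<open>B\<close> unexposed edges and fails with probability at most \<open>r ^ B\<close>.\<close>

lemma prob_grow:
  assumes P: "P \<noteq> []" "set P \<subseteq> {..<n}" and S: "S \<subseteq> {..<n}" "S \<inter> set P = {}"
    and X0: "\<And>p u. p \<in> insert (last P) S \<Longrightarrow> u \<in> S \<Longrightarrow> p \<noteq> u \<Longrightarrow> {p, u} \<notin> X\<^sub>0"
    and final: "\<And>G X c. grown P S X\<^sub>0 G X c \<Longrightarrow> card (S - set G) = B \<Longrightarrow> prob X c \<le> a"
    and a: "0 \<le> a"
    and G: "grown P S X\<^sub>0 G X c" "B \<le> card (S - set G)"
  shows "prob X c \<le> a + real (card (S - set G) - B) * r ^ B"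
  using G
proof (induction "card (S - set G) - B" arbitrary: G X c)
  case 0
  then show ?case using final by simp
next
  case (Suc m)
  have finS: "finite S" using S(1) by (rule finite_subset) simp
  let ?v = "last (P @ G)"
  have v: "?v = last (last P # G)" "?v \<in> insert (last P) S" "?v < n" "?v \<in> set (P @ G)"
  proof -
    show 1: "?v = last (last P # G)" by simp
    show "?v \<in> insert (last P) S" using Suc.prems(1) subsetD[of "set G" S "last G"] by (cases "G = []") (auto simp: grown_def)
    show "?v \<in> set (P @ G)" using P(1) by (intro last_in_set) simp
    then show "?v < n" using Suc.prems(1) P(2) S(1) by (auto simp: grown_def)
  qed
  obtain K where K: "K \<subseteq> S - set G" "card K = B"
      "\<forall>k\<in>K. card {u \<in> S - set G. dist (x ?v) (x u) < dist (x ?v) (x k)} < B"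
    using nearest_subset[of "S - set G" B "\<lambda>u. dist (x ?v) (x u)"] finS Suc.prems(2) by auto
  have finK: "finite K" using K(1) finS by (meson finite_Diff finite_subset)
  have KG: "k \<notin> set (P @ G)" "k < n" "k \<in> S" if "k \<in> K" for k
    using that K(1) S by auto
  have vbut: "?v \<notin> set (butlast (last P # G))"
  proof -
    have "distinct (last P # G)" using Suc.prems(1) last_in_set[OF P(1)] by (auto simp: grown_def)
    then have "distinct (butlast (last P # G) @ [last (last P # G)])"
      by (subst append_butlast_last_id) auto
    then show ?thesis unfolding v(1) by simp
  qed
  have cardP: "card (c ` pair_edge ` set (pairs (P @ G))) \<le> n"
  proof -
    have "card (c ` pair_edge ` set (pairs (P @ G))) \<le> length (P @ G) - 1" by (rule card_colors_path)
    also have "\<dots> \<le> card (set (P @ G))" using Suc.prems(1) unfolding grown_def by (simp only: distinct_card)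
    also have "\<dots> \<le> card {..<n}"
      using Suc.prems(1) P(2) S(1) by (intro card_mono) (auto simp: grown_def)
    finally show ?thesis by simp
  qed
  let ?T = "(\<lambda>k. {?v, k}) ` K"
  have "prob X c \<le> (a + real m * r ^ B) + r ^ card ?T"
  proof (rule cond_prob_trials[where U = "c ` pair_edge ` set (pairs (P @ G))"])
    show "?T \<subseteq> edges n" using v KG by (auto intro!: pair_in_edges)
    show "?T \<inter> X = {}"
    proof -
      \<comment> \<open>An edge exposed in this phase contains a vertex that has been left, whereas
        \<open>?v\<close> is the current end and \<open>k\<close> is unvisited.\<close>
      have "{?v, k} \<notin> X" if "k \<in> K" for k
      proof
        assume "{?v, k} \<in> X"
        moreover have "{?v, k} \<notin> X\<^sub>0" using v KG[OF that] by (intro X0) auto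
        ultimately obtain p u where pu: "{?v, k} = {p, u}" "p \<in> set (butlast (last P # G))"
          using Suc.prems(1) unfolding grown_def by blast
        then have "p = k" using vbut by (metis insertE singletonD insertI1)
        then show False using pu(2) KG(1)[OF that] P(1) in_set_butlastD[of k "last P # G"] by auto
      qed
      then show ?thesis by auto
    qed
    show "real (card (c ` pair_edge ` set (pairs (P @ G)))) \<le> r * real q"
      using cardP n_le by linarith
    fix F c' e
    assume F: "F \<subseteq> ?T" "e \<in> F" "c' e \<notin> c ` pair_edge ` set (pairs (P @ G))"
      "\<And>e. e \<in> X \<Longrightarrow> c' e = c e" "\<And>e. c' e < q"
    then obtain k where k: "k \<in> K" "e = {?v, k}" by auto
    have new: "pair_edge ` set (pairs (P @ G @ [k])) = insert {?v, k} (pair_edge ` set (pairs (P @ G)))"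
      using pairs_snoc[of "P @ G" k] P(1) by simp
    have "grown P S X\<^sub>0 (G @ [k]) (X \<union> F) c'"
      unfolding grown_def
    proof (intro conjI)
      show "distinct (P @ G @ [k])" using Suc.prems(1) KG(1)[OF k(1)] by (auto simp: grown_def)
      show "set (G @ [k]) \<subseteq> S" using Suc.prems(1) KG(3)[OF k(1)] by (auto simp: grown_def)
      have "near_path x S B ((last P # G) @ [k])"
      proof (rule near_path_snoc)
        have "S - set (last P # G) = S - set G" using S(2) P(1) by auto
        then show "card {u \<in> S - set (last P # G). dist (x (last (last P # G))) (x u)
            < dist (x (last (last P # G))) (x k)} < B"
          using K(3) k(1) unfolding v(1) by simp
      qed (use Suc.prems(1) in \<open>auto simp: grown_def\<close>)
      then show "near_path x S B (last P # G @ [k])" by simp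
      have same: "c' e = c e" if "e \<in> pair_edge ` set (pairs (P @ G))" for e
        using F(4) that Suc.prems(1) unfolding grown_def by blast
      then have "inj_on c' (pair_edge ` set (pairs (P @ G)))"
        using Suc.prems(1) unfolding grown_def by (subst inj_on_cong[of _ _ c]) auto
      moreover have "c' ` pair_edge ` set (pairs (P @ G)) = c ` pair_edge ` set (pairs (P @ G))"
        using same by (rule image_cong[OF refl])
      ultimately show "inj_on c' (pair_edge ` set (pairs (P @ G @ [k])))"
        using F(3) k(2) unfolding new by (simp only: inj_on_insert) auto
      show "pair_edge ` set (pairs (P @ G @ [k])) \<subseteq> X \<union> F"
        unfolding new using Suc.prems(1) F(2) k(2) unfolding grown_def by blast
      have but: "butlast (last P # G @ [k]) = last P # G" by (metis append_Cons butlast_snoc)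
      have "set (butlast (last P # G)) \<subseteq> set (last P # G)" by (auto dest: in_set_butlastD)
      moreover have "?v \<in> set (last P # G)" unfolding v(1) by (rule last_in_set) simp
      moreover have "F \<subseteq> {{p, u} |p u. p \<in> {?v} \<and> u \<in> S}" using F(1) KG(3) by auto
      moreover have "X \<subseteq> X\<^sub>0 \<union> {{p, u} | p u. p \<in> set (butlast (last P # G)) \<and> u \<in> S}"
        using Suc.prems(1) unfolding grown_def by blast
      ultimately show "X \<union> F \<subseteq> X\<^sub>0 \<union> {{p, u} |p u. p \<in> set (butlast (last P # G @ [k])) \<and> u \<in> S}"
        unfolding but by blast
    qed (use F(5) in simp)
    moreover have "card (S - set (G @ [k])) = card (S - set G) - 1"
    proof -
      have "S - set (G @ [k]) = (S - set G) - {k}" by auto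
      then show ?thesis using k(1) K(1) finS by (auto simp: card_Diff_singleton_if)
    qed
    ultimately have "prob (X \<union> F) c' \<le> a + real (card (S - set (G @ [k])) - B) * r ^ B"
      "card (S - set (G @ [k])) - B = m"
      using Suc.hyps(1)[of "G @ [k]" "X \<union> F" c'] Suc.hyps(2) by auto
    then show "prob (X \<union> F) c' \<le> a + real m * r ^ B" by simp
  qed (use finite_edges q_pos r_ge_0 a finK Suc.prems(1) in \<open>auto simp: grown_def\<close>)
  moreover have "card ?T = B"
    using K(2) by (subst card_image) (auto simp: inj_on_def doubleton_eq_iff)
  ultimately show ?case using Suc.hyps(2)[symmetric] by (simp add: algebra_simps)
qed

end

context points_and_colors begin

text \<open>Lets failures of single and of paired trials be measured by the same power of
  \<open>s\<close>.\<close>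

lemma r_le_s: "r \<le> s"
  using r_ge_0 r_le_1 mult_left_mono[of r 1 r] by (simp add: power2_eq_square algebra_simps)

lemma card_disjoint_pairs:
  assumes "distinct xs" shows "card (set (disjoint_pairs xs)) = length xs div 2"
  using assms distinct_card[OF distinct_disjoint_pairs] by (simp add: length_disjoint_pairs)

text \<open>The two growth phases contribute at most \<open>n\<close> failures of probability
  \<open>s ^ B\<close> each, and closing and insertion \<open>2 * B + 1\<close> more. The condition
  on \<open>n\<close> gives each path a matching of at least \<open>3 * B\<close> edges, as
  \<open>prob_close\<close> demands for \<open>card W = 2 * B\<close>. In the bound on
  \<open>\<Lambda>\<close>, each path accounts for half of the first two summands and each left-over
  vertex for 4.\<close>

lemma prob_bad:
  assumes n: "n \<ge> 14 * B + 8" and B: "B \<ge> 1" and c: "\<And>e. c e < q"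
    and \<Lambda>: "4 * real n / 2 ^ J + 64 * real B * 2 ^ J + 8 * real B \<le> \<Lambda>"
  shows "prob {} c \<le> 3 * real n * s ^ B"
proof -
  define A where "A = {..<n div 2}"
  define D where "D = {n div 2..<n}"
  define S where "S = A - {0}"
  have AD: "A \<inter> D = {}" "A \<union> D = {..<n}" "0 \<in> A" using n by (auto simp: A_def D_def)
  have fin: "finite A" "finite D" "finite S" by (auto simp: A_def D_def S_def)
  have cardS: "card S = n div 2 - 1" and cardD: "card D = n - n div 2"
    using AD(3) by (auto simp: S_def A_def D_def)
  have S_sub: "S \<subseteq> {..<n}" "D \<subseteq> {..<n}" using AD by (auto simp: S_def)
  have sB: "0 \<le> s ^ B" "0 \<le> r ^ B" "r ^ B \<le> s ^ B"
    using s_ge_0 r_ge_0 r_le_s by (auto intro: power_mono)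
  have final: "prob X c \<le> (2 * real B + 1) * s ^ B"
    if G1: "grown [0] S {} G1 X1 c1" "card (S - set G1) = B"
      and G2: "grown (0 # G1) D X1 G2 X c" "card (D - set G2) = B" for G1 G2 X1 X c1 c
  proof -
    define P where "P = 0 # G1 @ G2"
    let ?v = "last (0 # G1)" and ?t = "last P"
    have G1': "distinct (0 # G1)" "set G1 \<subseteq> S" "near_path x S B (0 # G1)"
        "X1 \<subseteq> {{p, u} | p u. p \<in> set (butlast (0 # G1)) \<and> u \<in> S}"
      using G1(1) by (auto simp: grown_def)
    have G2': "distinct P" "set G2 \<subseteq> D" "near_path x D B (?v # G2)"
        "inj_on c (pair_edge ` set (pairs P))" "pair_edge ` set (pairs P) \<subseteq> X"
        "X \<subseteq> X1 \<union> {{p, u} | p u. p \<in> set (butlast (?v # G2)) \<and> u \<in> D}" "\<And>e. c e < q"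
      using G2(1) by (auto simp: grown_def P_def)
    have X1A: "e \<subseteq> A" if "e \<in> X1" for e
    proof -
      obtain p u where pu: "e = {p, u}" "p \<in> set (butlast (0 # G1))" "u \<in> S" using subsetD[OF G1'(4) \<open>e \<in> X1\<close>] by blast
      have "p \<in> A" using in_set_butlastD[OF pu(2)] G1'(2) AD(3) by (auto simp: S_def)
      then show ?thesis using pu by (auto simp: S_def)
    qed
    have lenG1: "length G1 = n div 2 - 1 - B"
    proof -
      have "card (S - set G1) = card S - card (set G1)" using G1'(2) by (intro card_Diff_subset) auto
      moreover have "card (set G1) = length G1" using G1'(1) by (intro distinct_card) simp
      moreover have "card (set G1) \<le> card S" using G1'(2) fin by (intro card_mono) auto
      ultimately show ?thesis using G1(2) cardS by linarith
    qed
    have lenG2: "length G2 = n - n div 2 - B"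
    proof -
      have "card (D - set G2) = card D - card (set G2)" using G2'(2) by (intro card_Diff_subset) auto
      moreover have "card (set G2) = length G2" using G2'(1) by (intro distinct_card) (simp add: P_def)
      moreover have "card (set G2) \<le> card D" using G2'(2) fin by (intro card_mono) auto
      ultimately show ?thesis using G2(2) cardD by linarith
    qed
    have ne: "G1 \<noteq> []" "G2 \<noteq> []" using lenG1 lenG2 n by auto
    have v: "?v \<in> S" "?v \<in> set G1" using ne G1'(2) last_in_set[OF ne(1)] by auto
    have t: "?t = last G2" "?t \<in> set G2" "?t \<in> D" using ne(2) G2'(2) last_in_set[OF ne(2)] by (auto simp: P_def)
    have tbut: "?t \<notin> set (butlast (?v # G2))"
    proof -
      have "distinct G2" using G2'(1) by (simp add: P_def)
      then have "distinct (butlast G2 @ [last G2])" using ne(2) by simp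
      then have "last G2 \<notin> set (butlast G2)" by simp
      moreover have "?t \<noteq> ?v" using t(3) v(1) AD(1) by (auto simp: S_def)
      ultimately show ?thesis using t(1) ne(2) by simp
    qed
    have butD: "p = ?v \<or> p \<in> set G2" if "p \<in> set (butlast (?v # G2))" for p
      using in_set_butlastD[OF that] by simp
    define W where "W = (S - set G1) \<union> (D - set G2)"
    \<comment> \<open>The vertex that closes the tour is taken from \<open>D\<close>. Its edge to
      \<open>?t\<close> is unexposed because \<open>?t\<close> has not been left, and its edge to
      the start 0 because this runs between the halves and touches neither \<open>?v\<close> nor the
      second path.\<close>
    define K where "K = D - set G2"
    \<comment> \<open>Both ends of the first path are kept out of the matching: \<open>?v\<close>
      has exposed edges into \<open>D\<close>, and 0 may receive edges in the closing trial.\<close>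
    define mid where "mid = butlast G1"
    define M where "M = set (disjoint_pairs mid) \<union> set (disjoint_pairs G2)"
    have G1_mid: "G1 = mid @ [?v]" using ne(1) by (simp add: mid_def)
    have mid: "a \<in> A" "a \<noteq> 0" "a \<noteq> ?v" if "a \<in> set mid" for a
    proof -
      have "distinct (mid @ [?v])" using G1'(1) G1_mid by (metis distinct.simps(2))
      then show "a \<noteq> ?v" using that ne(1) by auto
      have aG: "a \<in> set G1" using that by (subst G1_mid) simp
      then show "a \<in> A" using G1'(2) by (auto simp: S_def)
      show "a \<noteq> 0" using aG G1'(2) by (auto simp: S_def)
    qed
    have dis_mid: "distinct mid" using G1'(1) by (simp add: mid_def distinct_butlast)
    have dis_G2: "distinct G2" using G2'(1) by (simp add: P_def)
    have cardW: "card W = 2 * B"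
      using G1(2) G2(2) fin AD(1) unfolding W_def by (subst card_Un_disjoint) (auto simp: S_def)
    have setP: "set P = insert 0 (set G1 \<union> set G2)" by (simp add: P_def)
    \<comment> \<open>There are two kinds of exposed edges: those within \<open>A\<close> from the
      first phase, and those from a vertex left in the second phase to a vertex of
      \<open>D\<close>.\<close>
    have Xno: "{w, u} \<notin> X" if "\<not> {w, u} \<subseteq> A" "u \<in> D \<Longrightarrow> w \<notin> set (butlast (?v # G2))"
      "w \<in> D \<Longrightarrow> u \<notin> set (butlast (?v # G2))" for w u
    proof
      assume "{w, u} \<in> X"
      moreover have "{w, u} \<notin> X1" using X1A that(1) by blast
      ultimately obtain p u' where pu: "{w, u} = {p, u'}" "p \<in> set (butlast (?v # G2))" "u' \<in> D"
        using G2'(6) by blast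
      from pu(1) have "w = p \<and> u = u' \<or> w = u' \<and> u = p" by (simp only: doubleton_eq_iff)
      then show False using pu(2,3) that(2,3) by (elim disjE conjE) (simp_all only:)
    qed
    have pairs_mid: "set (pairs mid) \<subseteq> set (pairs P)"
    proof -
      have "P = 0 # mid @ ?v # G2" using G1_mid by (simp add: P_def)
      then show ?thesis using pairs_infix[of mid "[0]" "?v # G2"] by simp
    qed
    have pairs_G2: "set (pairs G2) \<subseteq> set (pairs P)"
      using pairs_infix[of G2 "0 # G1" "[]"] by (simp add: P_def)
    have "prob X c \<le> (real (card W) + 1) * s ^ B"
    proof (rule prob_close[where P = P and M = M and K = K])
      show "finite W" using fin by (simp add: W_def)
      show "W \<inter> set P = {}"
        using setP G1'(1,2) G2'(2) AD(1,3) by (auto simp: W_def S_def)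
      show "set P \<union> W = {..<n}"
        using setP G1'(2) G2'(2) AD by (auto simp: W_def S_def)
      show "2 \<le> length P" using ne by (cases G1) (auto simp: P_def)
      show "M \<subseteq> set (pairs P)"
        using disjoint_pairs_subset[of mid] disjoint_pairs_subset[of G2] pairs_mid pairs_G2 by (auto simp: M_def)
      show "pair_edge p \<inter> pair_edge p' = {}" if "p \<in> M" "p' \<in> M" "p \<noteq> p'" for p p'
      proof -
        have 1: "pair_edge p \<subseteq> A" if "p \<in> set (disjoint_pairs mid)" for p
          using disjoint_pairs_elems[OF that] mid(1) by (auto simp: pair_edge_def)
        have 2: "pair_edge p \<subseteq> D" if "p \<in> set (disjoint_pairs G2)" for p
          using disjoint_pairs_elems[OF that] G2'(2) by (auto simp: pair_edge_def)
        show ?thesis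
          using that disjoint_pairs_disjoint[OF dis_mid, of p p'] disjoint_pairs_disjoint[OF dis_G2, of p p']
            1[of p] 1[of p'] 2[of p] 2[of p'] AD(1)
          unfolding M_def by blast
      qed
      show "K \<subseteq> W" "card K = B" using G2(2) by (auto simp: K_def W_def)
      show "{?t, k} \<notin> X \<and> {k, hd P} \<notin> X" if "k \<in> K" for k
      proof
        have k: "k \<in> D" "k \<notin> set G2" "k \<noteq> ?v" "k \<notin> A"
          using that v(1) AD(1) by (auto simp: K_def S_def)
        show "{?t, k} \<notin> X"
        proof (rule Xno)
          show "\<not> {?t, k} \<subseteq> A" using k(4) by simp
          show "?t \<notin> set (butlast (?v # G2))" by (rule tbut)
          show "k \<notin> set (butlast (?v # G2))" using butD[of k] k(2,3) by blast
        qed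
        have 0: "hd P = 0" "0 \<noteq> ?v" "0 \<notin> D"
          subgoal by (simp add: P_def)
          subgoal using v(1) unfolding S_def by (metis DiffE insertI1)
          subgoal using AD(1,3) by blast
          done
        show "{k, hd P} \<notin> X"
          unfolding 0(1)
        proof (rule Xno)
          show "\<not> {k, 0} \<subseteq> A" using k(4) by simp
          show "k \<notin> set (butlast (?v # G2))" using butD[of k] k(2,3) by blast
          show "0 \<notin> set (butlast (?v # G2))" using butD[of 0] 0 G2'(2) by blast
        qed
      qed
      show "B + card W \<le> card {p \<in> M. \<forall>u\<in>{fst p, snd p}.
          {w, u} \<notin> X \<and> (\<forall>k\<in>K. {w, u} \<noteq> {?t, k} \<and> {w, u} \<noteq> {k, hd P})}" (is "_ \<le> card ?M")
        if w: "w \<in> W" for w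
      proof (cases "w \<in> D")
        case True
        then have wG: "w \<notin> set G2" "w \<notin> A" using w AD(1) by (auto simp: W_def S_def)
        have "{w, u} \<notin> X \<and> (\<forall>k\<in>K. {w, u} \<noteq> {?t, k} \<and> {w, u} \<noteq> {k, hd P})" if u: "u \<in> set mid" for u
        proof (intro conjI ballI)
          have uD: "u \<notin> D" using mid(1)[OF u] AD(1) by auto
          show "{w, u} \<notin> X"
          proof (rule Xno)
            show "\<not> {w, u} \<subseteq> A" using wG by simp
            show "u \<notin> set (butlast (?v # G2))" using butD[of u] uD mid(3)[OF u] G2'(2) by blast
          qed (use uD in blast)
          fix k assume "k \<in> K"
          then have "k \<in> D" by (simp add: K_def)
          then show "{w, u} \<noteq> {?t, k}" using uD t(3) unfolding doubleton_eq_iff by blast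
          show "{w, u} \<noteq> {k, hd P}" using uD mid(2)[OF u] \<open>k \<in> D\<close> by (auto simp: P_def doubleton_eq_iff)
        qed
        then have "set (disjoint_pairs mid) \<subseteq> ?M" by (auto simp: M_def dest: disjoint_pairs_elems)
        then have "card (set (disjoint_pairs mid)) \<le> card ?M" by (intro card_mono) (auto simp: M_def)
        moreover have "card (set (disjoint_pairs mid)) = (n div 2 - 2 - B) div 2"
          using card_disjoint_pairs[OF dis_mid] lenG1 by (simp add: mid_def numeral_2_eq_2)
        moreover have "3 * B \<le> (n div 2 - 2 - B) div 2" using n by linarith
        ultimately show ?thesis using cardW by linarith
      next
        case False
        then have wS: "w \<in> S" "w \<notin> set G1" "w \<in> A" "w \<noteq> 0" using w by (auto simp: W_def S_def)
        have "{w, u} \<notin> X \<and> (\<forall>k\<in>K. {w, u} \<noteq> {?t, k} \<and> {w, u} \<noteq> {k, hd P})" if u: "u \<in> set G2" for u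
        proof (intro conjI ballI)
          have uD: "u \<in> D" "u \<notin> A" using u G2'(2) AD(1) by auto
          show "{w, u} \<notin> X"
          proof (rule Xno)
            show "\<not> {w, u} \<subseteq> A" using uD by simp
            show "w \<notin> set (butlast (?v # G2))" using butD[of w] False v(2) wS(2) G2'(2) by blast
          qed (use False in blast)
          fix k assume "k \<in> K"
          then have "k \<in> D" by (simp add: K_def)
          then show "{w, u} \<noteq> {?t, k}" using False t(3) unfolding doubleton_eq_iff by blast
          show "{w, u} \<noteq> {k, hd P}" using False wS \<open>k \<in> D\<close> by (auto simp: P_def doubleton_eq_iff)
        qed
        then have "set (disjoint_pairs G2) \<subseteq> ?M" by (auto simp: M_def dest: disjoint_pairs_elems)
        then have "card (set (disjoint_pairs G2)) \<le> card ?M" by (intro card_mono) (auto simp: M_def)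
        moreover have "card (set (disjoint_pairs G2)) = (n - n div 2 - B) div 2"
          using card_disjoint_pairs[OF dis_G2] lenG2 by simp
        moreover have "3 * B \<le> (n - n div 2 - B) div 2" using n by linarith
        ultimately show ?thesis using cardW by linarith
      qed
      show "path_length x P + 4 * real (card W) \<le> \<Lambda>"
      proof -
        have "path_length x (0 # G1) \<le> 2 * real (length (0 # G1)) / 2 ^ J + 32 * real B * 2 ^ J"
          by (rule near_path_length[OF G1'(3,1)])
            (use G1'(2) fin S_sub n unit_square in auto)
        also have "\<dots> \<le> 2 * real n / 2 ^ J + 32 * real B * 2 ^ J"
          using lenG1 n by (intro add_mono divide_right_mono) auto
        finally have 1: "path_length x (0 # G1) \<le> 2 * real n / 2 ^ J + 32 * real B * 2 ^ J" .
        have "path_length x (?v # G2) \<le> 2 * real (length (?v # G2)) / 2 ^ J + 32 * real B * 2 ^ J"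
        proof (rule near_path_length[OF G2'(3)])
          show "distinct (?v # G2)" using dis_G2 v(1) G2'(2) AD(1) by (auto simp: S_def)
          show "x u \<in> unit_square" if "u \<in> set (?v # G2)" for u
            using that v(1) G2'(2) S_sub by (intro unit_square) auto
        qed (use G2'(2) fin in auto)
        also have "\<dots> \<le> 2 * real n / 2 ^ J + 32 * real B * 2 ^ J"
          using lenG2 n B by (intro add_mono divide_right_mono) auto
        finally have 2: "path_length x (?v # G2) \<le> 2 * real n / 2 ^ J + 32 * real B * 2 ^ J" .
        have "P = (0 # mid) @ ?v # G2" "0 # G1 = (0 # mid) @ [?v]" using G1_mid by (simp_all add: P_def)
        then have "path_length x P = path_length x (0 # G1) + path_length x (?v # G2)"
          using path_length_append[of x "0 # mid" ?v G2] by simp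
        then show ?thesis using 1 2 \<Lambda> cardW by simp
      qed
    qed (use G2' in \<open>auto simp: M_def\<close>)
    then show ?thesis using cardW by simp
  qed
  have phase2: "prob X c \<le> (2 * real B + 1) * s ^ B + real n * r ^ B"
    if G1: "grown [0] S {} G1 X c" "card (S - set G1) = B" for G1 X c
  proof -
    let ?v = "last (0 # G1)"
    have G1': "set (0 # G1) \<subseteq> A" using G1(1) AD(3) by (auto simp: grown_def S_def)
    then have v: "?v \<in> A" by (rule subsetD[OF _ last_in_set]) simp
    have "prob X c \<le> (2 * real B + 1) * s ^ B + real (card (D - set []) - B) * r ^ B"
    proof (rule prob_grow[where P = "0 # G1" and S = D and X\<^sub>0 = X])
      show "{p, u} \<notin> X" if "p \<in> insert ?v D" "u \<in> D" "p \<noteq> u" for p u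
      proof
        assume "{p, u} \<in> X"
        then obtain p' u' where "{p, u} = {p', u'}" "p' \<in> set (butlast (0 # G1))" "u' \<in> S"
          using G1(1) by (auto simp: grown_def)
        then have "{p, u} \<subseteq> A" using in_set_butlastD[of p' "0 # G1"] G1' by (auto simp: S_def)
        then show False using that(2) AD(1) by auto
      qed
      show "grown (0 # G1) D X [] X c" using G1(1) by (auto simp: grown_def near_path_def)
      show "B \<le> card (D - set [])" using cardD n by simp
      show "prob X' c' \<le> (2 * real B + 1) * s ^ B"
        if "grown (0 # G1) D X G X' c'" "card (D - set G) = B" for G X' c'
        using final[OF G1 that] .
    qed (use S_sub AD G1' sB in auto)
    also have "\<dots> \<le> (2 * real B + 1) * s ^ B + real n * r ^ B"
      using cardD sB by (intro add_left_mono mult_right_mono) auto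
    finally show ?thesis .
  qed
  have "prob {} c \<le> ((2 * real B + 1) * s ^ B + real n * r ^ B) + real (card (S - set []) - B) * r ^ B"
  proof (rule prob_grow[where P = "[0]" and S = S and X\<^sub>0 = "{}"])
    show "grown [0] S {} [] {} c" using c by (auto simp: grown_def near_path_def)
    show "B \<le> card (S - set [])" using cardS n by simp
  qed (use S_sub AD sB phase2 n in \<open>auto simp: S_def\<close>)
  also have "\<dots> \<le> (2 * real B + 1) * s ^ B + real n * s ^ B + real (n div 2 - 1 - B) * s ^ B"
  proof -
    have "card (S - set []) - B = n div 2 - 1 - B" using cardS by simp
    then show ?thesis using sB by (simp only:) (intro add_mono mult_left_mono; simp)
  qed
  also have "\<dots> = (2 * real B + 1 + real n + real (n div 2 - 1 - B)) * s ^ B" by (simp add: algebra_simps)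
  also have "\<dots> \<le> 3 * real n * s ^ B"
  proof (rule mult_right_mono)
    have "2 * B + 1 + n + (n div 2 - 1 - B) \<le> 3 * n" using n by linarith
    then show "2 * real B + 1 + real n + real (n div 2 - 1 - B) \<le> 3 * real n" by linarith
  qed (use sB in auto)
  finally show ?thesis .
qed

end

section \<open>Local moves on tours\<close>

definition tour_pairs :: "'a list \<Rightarrow> ('a \<times> 'a) list" where
  "tour_pairs vs = zip vs (rotate1 vs)"

lemma tour_pairs_eq: "vs \<noteq> [] \<Longrightarrow> tour_pairs vs = pairs vs @ [(last vs, hd vs)]"
  by (simp add: tour_pairs_def cycle_pairs)

text \<open>Length and edge set of a tour depend only on the multiset of its pairs, so a tour may be
  rotated to start at any vertex.\<close>

lemma mset_tour_pairs_rotate: "mset (tour_pairs (rotate k vs)) = mset (tour_pairs vs)"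
proof -
  have "tour_pairs (rotate1 vs) = rotate1 (tour_pairs vs)" for vs :: "'a list"
  proof (cases vs)
    case (Cons a as)
    then show ?thesis
    proof (cases as)
      case (Cons b bs)
      then show ?thesis using pairs_snoc[of as a] \<open>vs = a # as\<close> by (simp add: tour_pairs_eq)
    qed (simp add: tour_pairs_def)
  qed (simp add: tour_pairs_def)
  moreover have "mset (rotate1 ps) = mset ps" for ps :: "('a \<times> 'a) list" by (cases ps) auto
  ultimately show ?thesis by (induction k) auto
qed

lemma cycle_length_tour_pairs:
  "cycle_length x vs = sum_mset (image_mset (\<lambda>(u, v). dist (x u) (x v)) (mset (tour_pairs vs)))"
  by (simp add: cycle_length_zip tour_pairs_def sum_mset_sum_list flip: mset_map)

lemma cycle_edges_tour_pairs: "cycle_edges vs = pair_edge ` set_mset (mset (tour_pairs vs))"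
  by (simp add: cycle_edges_zip tour_pairs_def)

lemma tour_rotate:
  assumes "hamilton_cycle n vs" "v < n"
  obtains ws where "hamilton_cycle n (v # ws)" "mset (tour_pairs (v # ws)) = mset (tour_pairs vs)"
proof -
  have "v \<in> set vs" using assms by (auto simp: hamilton_cycle_def)
  then obtain ys zs where vs: "vs = ys @ v # zs" by (meson split_list)
  have "rotate (length ys) vs = v # zs @ ys" by (simp add: vs rotate_append)
  moreover have "hamilton_cycle n (v # zs @ ys)" using assms vs by (auto simp: hamilton_cycle_def)
  ultimately show ?thesis using that[of "zs @ ys"] mset_tour_pairs_rotate[of "length ys" vs] by simp
qed

lemma pairs_rev: "pairs (rev xs) = rev (map prod.swap (pairs xs))"
proof (induction xs)
  case (Cons a xs)
  then show ?case
  proof (cases xs)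
    case (Cons b ys)
    have "pairs (rev xs @ [a]) = pairs (rev xs) @ [(last (rev xs), a)]"
      using Cons by (intro pairs_snoc) simp
    then show ?thesis using Cons.IH Cons by simp
  qed simp
qed simp

lemma mset_swap_sum:
  "sum_list (map ((\<lambda>(u, v). dist (x u) (x v)) \<circ> prod.swap) ps) = sum_list (map (\<lambda>(u, v). dist (x u) (x v)) ps)"
  by (induction ps) (auto simp: dist_commute)

lemma path_length_rev: "path_length x (rev xs) = path_length x xs"
  by (simp add: path_length_def pairs_rev mset_swap_sum sum_list_rev flip: rev_map)

lemma pair_edges_rev: "pair_edge ` set (pairs (rev xs)) = pair_edge ` set (pairs xs)"
  by (force simp: pairs_rev pair_edge_def image_iff)

lemma successor_unique:
  assumes "distinct vs" "(a, b) \<in> set (tour_pairs vs)" "(a, b') \<in> set (tour_pairs vs)"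
  shows "b = b'"
proof -
  have "map fst (tour_pairs vs) = vs" by (simp add: tour_pairs_def)
  then have "distinct (map fst (tour_pairs vs))" using assms(1) by simp
  then show ?thesis using assms(2,3) by (metis eq_key_imp_eq_value)
qed

lemma predecessor_unique:
  assumes "distinct vs" "(a, b) \<in> set (tour_pairs vs)" "(a', b) \<in> set (tour_pairs vs)"
  shows "a = a'"
proof -
  have "map snd (tour_pairs vs) = rotate1 vs" by (simp add: tour_pairs_def)
  then have "distinct (map snd (tour_pairs vs))" using assms(1) by (simp only: distinct1_rotate)
  then have "inj_on snd (set (tour_pairs vs))" by (simp add: distinct_map)
  then show ?thesis using inj_onD[of snd _ "(a, b)" "(a', b)"] assms(2,3) by fastforce
qed

lemma path_append_length:
  assumes "xs \<noteq> []" "ys \<noteq> []"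
  shows "path_length x (xs @ ys) = path_length x xs + dist (x (last xs)) (x (hd ys)) + path_length x ys"
proof -
  obtain y ys' where "ys = y # ys'" using assms(2) by (cases ys) auto
  then show ?thesis using path_length_append[of x xs y ys'] path_length_snoc[OF assms(1)] by simp
qed

lemma path_append_edges:
  assumes "xs \<noteq> []" "ys \<noteq> []"
  shows "set (pairs (xs @ ys)) = insert (last xs, hd ys) (set (pairs xs) \<union> set (pairs ys))"
proof -
  obtain y ys' where "ys = y # ys'" using assms(2) by (cases ys) auto
  then show ?thesis using pairs_append[of xs y ys'] pairs_snoc[OF assms(1)] by auto
qed

text \<open>Rotated to start at \<open>a'\<close>, the tour ends in \<open>a\<close> and splits at
  \<open>(b, b')\<close> into \<open>P\<close>, from \<open>a'\<close> to \<open>b\<close>, and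
  \<open>Q\<close>, from \<open>b'\<close> to \<open>a\<close>. Reversing \<open>P\<close> replaces
  just the two junctions.\<close>

lemma two_opt:
  assumes "hamilton_cycle n vs" "(a, a') \<in> set (tour_pairs vs)" "(b, b') \<in> set (tour_pairs vs)" "a \<noteq> b"
  obtains ws where "hamilton_cycle n ws"
    "cycle_length x ws = cycle_length x vs - dist (x a) (x a') - dist (x b) (x b') + dist (x a) (x b) + dist (x a') (x b')"
    "cycle_edges ws \<subseteq> cycle_edges vs \<union> {{a, b}, {a', b'}}"
proof -
  have "a' < n" using assms(1,2) unfolding tour_pairs_def hamilton_cycle_def
    by (metis in_set_zipE lessThan_iff set_rotate1)
  then obtain ws where ws: "hamilton_cycle n (a' # ws)" "mset (tour_pairs (a' # ws)) = mset (tour_pairs vs)"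
    using tour_rotate[OF assms(1)] by blast
  let ?vs = "a' # ws"
  have dis: "distinct ?vs" and sets: "set ?vs = {..<n}" using ws(1) by (auto simp: hamilton_cycle_def)
  have set_eq: "set (tour_pairs ?vs) = set (tour_pairs vs)" using ws(2) by (metis set_mset_mset)
  have tp: "tour_pairs ?vs = pairs ?vs @ [(last ?vs, a')]" using tour_pairs_eq[of ?vs] by simp
  have a: "a = last ?vs"
  proof (rule predecessor_unique[OF dis])
    show "(a, a') \<in> set (tour_pairs ?vs)" using assms(2) set_eq by simp
    show "(last ?vs, a') \<in> set (tour_pairs ?vs)" unfolding tp by simp
  qed
  have "(b, b') \<in> set (tour_pairs ?vs)" using assms(3) set_eq by simp
  then have "(b, b') \<in> insert (last ?vs, a') (set (pairs ?vs))" unfolding tp by simp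
  then have "(b, b') \<in> set (pairs ?vs)" using assms(4) a by blast
  then obtain ys zs where yz: "?vs = ys @ [b, b'] @ zs" by (rule set_pairs_split)
  define P where "P = ys @ [b]"
  define Q where "Q = b' # zs"
  have PQ: "?vs = P @ Q" "P \<noteq> []" "Q \<noteq> []" "last P = b" "hd Q = b'" "hd P = a'" "last Q = a"
    using yz a by (auto simp: P_def Q_def) (metis append_Cons append_Nil hd_append2 list.sel(1) neq_Nil_conv)+
  let ?ws = "rev P @ Q"
  have "hamilton_cycle n ?ws" using ws(1) PQ(1) by (simp add: hamilton_cycle_def)
  moreover have "cycle_length x ?ws = path_length x P + dist (x a') (x b') + path_length x Q + dist (x a) (x b)"
    using PQ by (simp add: cycle_length_path path_append_length path_length_rev last_rev hd_rev)
  moreover have "cycle_length x vs = path_length x P + dist (x b) (x b') + path_length x Q + dist (x a) (x a')"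
  proof -
    have "cycle_length x vs = cycle_length x (P @ Q)"
      unfolding cycle_length_tour_pairs using ws(2) PQ(1) by simp
    then show ?thesis using PQ by (simp add: cycle_length_path path_append_length)
  qed
  moreover have "cycle_edges ?ws \<subseteq> cycle_edges vs \<union> {{a, b}, {a', b'}}"
  proof -
    have "cycle_edges vs = cycle_edges (P @ Q)"
      unfolding cycle_edges_tour_pairs using ws(2) PQ(1) by simp
    moreover have "cycle_edges ?ws = insert {a, b} (insert {a', b'} (pair_edge ` set (pairs P) \<union> pair_edge ` set (pairs Q)))"
      using PQ by (subst cycle_edges_pairs)
        (simp_all add: path_append_edges last_rev hd_rev image_Un pair_edges_rev)
    moreover have "pair_edge ` set (pairs P) \<union> pair_edge ` set (pairs Q) \<subseteq> cycle_edges (P @ Q)"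
      using PQ by (subst cycle_edges_pairs) (auto simp: path_append_edges)
    ultimately show ?thesis by blast
  qed
  ultimately show ?thesis using that[of ?ws] by simp
qed

text \<open>Rotated to start at \<open>v\<close>, the rest of the tour is a path from
  \<open>w\<close> to \<open>u\<close>. The conditions on \<open>y\<close> make
  \<open>(y, y')\<close> one of its edges, and \<open>v\<close> is put in between.\<close>

lemma or_opt:
  assumes "hamilton_cycle n vs" "(u, v) \<in> set (tour_pairs vs)" "(v, w) \<in> set (tour_pairs vs)"
    "(y, y') \<in> set (tour_pairs vs)" "y \<noteq> v" "y \<noteq> u"
  obtains ws where "hamilton_cycle n ws"
    "cycle_length x ws = cycle_length x vs - dist (x u) (x v) - dist (x v) (x w) - dist (x y) (x y')
       + dist (x u) (x w) + dist (x y) (x v) + dist (x v) (x y')"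
    "cycle_edges ws \<subseteq> cycle_edges vs \<union> {{u, w}, {y, v}, {v, y'}}"
proof -
  have "v < n" using assms(1,2) unfolding tour_pairs_def hamilton_cycle_def
    by (metis in_set_zipE lessThan_iff set_rotate1)
  then obtain ws where ws: "hamilton_cycle n (v # ws)" "mset (tour_pairs (v # ws)) = mset (tour_pairs vs)"
    using tour_rotate[OF assms(1)] by blast
  let ?vs = "v # ws"
  have dis: "distinct ?vs" and sets: "set ?vs = {..<n}" "3 \<le> n" using ws(1) by (auto simp: hamilton_cycle_def)
  have set_eq: "set (tour_pairs ?vs) = set (tour_pairs vs)" using ws(2) by (metis set_mset_mset)
  have tp: "tour_pairs ?vs = pairs ?vs @ [(last ?vs, v)]" using tour_pairs_eq[of ?vs] by simp
  have u: "u = last ?vs"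
  proof (rule predecessor_unique[OF dis])
    show "(u, v) \<in> set (tour_pairs ?vs)" using assms(2) set_eq by simp
    show "(last ?vs, v) \<in> set (tour_pairs ?vs)" unfolding tp by simp
  qed
  have "(y, y') \<in> set (tour_pairs ?vs)" using assms(4) set_eq by simp
  then have "(y, y') \<in> insert (last ?vs, v) (set (pairs ?vs))" unfolding tp by simp
  then have "(y, y') \<in> set (pairs ?vs)" using assms(6) u by blast
  moreover have "ws \<noteq> []" using calculation by auto
  then obtain h hs where h: "ws = h # hs" by (cases ws) auto
  ultimately have "(y, y') \<in> set (pairs ws)" using assms(5) by auto
  then obtain ys zs where yz: "ws = ys @ [y, y'] @ zs" by (rule set_pairs_split)
  have "(v, h) \<in> set (tour_pairs vs)" using set_eq tp h by auto
  moreover have "distinct vs" using assms(1) by (simp add: hamilton_cycle_def)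
  ultimately have w: "w = hd ws" using successor_unique[OF _ assms(3), of h] h by simp
  define P where "P = ys @ [y]"
  define Q where "Q = y' # zs"
  have PQ: "ws = P @ Q" "P \<noteq> []" "Q \<noteq> []" "last P = y" "hd Q = y'" "hd P = w" "last Q = u"
  proof -
    show "ws = P @ Q" "P \<noteq> []" "Q \<noteq> []" "last P = y" "hd Q = y'" using yz by (auto simp: P_def Q_def)
    then show "hd P = w" "last Q = u" using w u by auto
  qed
  let ?ws = "P @ v # Q"
  have "hamilton_cycle n ?ws" using ws(1) PQ(1) by (auto simp: hamilton_cycle_def)
  moreover have "cycle_length x ?ws = path_length x P + dist (x y) (x v) + dist (x v) (x y') + path_length x Q + dist (x u) (x w)"
    using PQ path_append_length[of "[v]" Q x] by (simp add: cycle_length_path path_append_length) (simp add: path_length_def)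
  moreover have "cycle_length x vs = dist (x v) (x w) + path_length x P + dist (x y) (x y') + path_length x Q + dist (x u) (x v)"
  proof -
    have "cycle_length x vs = cycle_length x (v # P @ Q)"
      unfolding cycle_length_tour_pairs using ws(2) PQ(1) by simp
    then show ?thesis using PQ path_append_length[of "[v]" "P @ Q" x]
      by (simp add: cycle_length_path path_append_length) (simp add: path_length_def)
  qed
  moreover have "cycle_edges ?ws \<subseteq> cycle_edges vs \<union> {{u, w}, {y, v}, {v, y'}}"
  proof -
    have "cycle_edges vs = cycle_edges (v # P @ Q)"
      unfolding cycle_edges_tour_pairs using ws(2) PQ(1) by simp
    moreover have "cycle_edges ?ws = insert {u, w} (insert {y, v} (insert {v, y'} (pair_edge ` set (pairs P) \<union> pair_edge ` set (pairs Q))))"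
      using PQ path_append_edges[of "[v]" Q] by (subst cycle_edges_pairs)
        (auto simp add: path_append_edges image_Un)
    moreover have "pair_edge ` set (pairs P) \<union> pair_edge ` set (pairs Q) \<subseteq> cycle_edges (v # P @ Q)"
      using PQ path_append_edges[of "[v]" "P @ Q"] by (subst cycle_edges_pairs) (auto simp: path_append_edges)
    ultimately show ?thesis by blast
  qed
  ultimately show ?thesis using that[of ?ws] by simp
qed

section \<open>Gadgets\<close>

text \<open>Shortening both vectors from \<open>a\<close> to length \<open>\<rho>\<close> does not
  increase the excess, by the triangle inequality, so the unit directions satisfy
  \<open>\<rho> * (2 - norm (e - f)) \<le> \<eta>\<close>. By the parallelogram law the square of
  \<open>norm (e + f)\<close> is \<open>(2 - norm (e - f)) * (2 + norm (e - f))\<close>.\<close>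

lemma antipodal_directions:
  fixes a v w :: "'a::real_inner"
  assumes "\<rho> > 0" "\<rho> \<le> dist a v" "\<rho> \<le> dist a w" "dist a v + dist a w - dist v w \<le> \<eta>"
    and "4 * \<eta> \<le> \<rho> * \<kappa>\<^sup>2" "0 \<le> \<kappa>"
  shows "norm (sgn (v - a) + sgn (w - a)) \<le> \<kappa>"
proof -
  let ?V = "v - a" and ?W = "w - a"
  let ?e = "sgn ?V" and ?f = "sgn ?W"
  have nV: "norm ?V = dist a v" "norm ?W = dist a w" by (simp_all add: dist_norm norm_minus_commute)
  have pos: "?V \<noteq> 0" "?W \<noteq> 0" using assms(1-3) nV by auto
  then have unit: "norm ?e = 1" "norm ?f = 1" by (simp_all add: norm_sgn)
  have dec: "?V = norm ?V *\<^sub>R ?e" "?W = norm ?W *\<^sub>R ?f" using pos by (simp_all add: sgn_div_norm)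
  have "v - w = (norm ?V - \<rho>) *\<^sub>R ?e + (\<rho> *\<^sub>R (?e - ?f) + (\<rho> - norm ?W) *\<^sub>R ?f)"
  proof -
    have "v - w = norm ?V *\<^sub>R ?e - norm ?W *\<^sub>R ?f" using dec by (metis diff_diff_eq2 diff_add_cancel add_diff_cancel_right')
    then show ?thesis by (simp add: algebra_simps)
  qed
  then have "dist v w \<le> norm ((norm ?V - \<rho>) *\<^sub>R ?e) + (norm (\<rho> *\<^sub>R (?e - ?f)) + norm ((\<rho> - norm ?W) *\<^sub>R ?f))"
    unfolding dist_norm by (metis norm_triangle_le norm_triangle_ineq add_left_mono)
  also have "\<dots> = (dist a v - \<rho>) + \<rho> * norm (?e - ?f) + (dist a w - \<rho>)"
    using assms(1-3) unit nV by simp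
  finally have "\<rho> * (2 - norm (?e - ?f)) \<le> \<eta>" using assms(4) by (simp add: algebra_simps)
  then have "2 - norm (?e - ?f) \<le> \<eta> / \<rho>" using assms(1) by (simp add: pos_le_divide_eq mult.commute)
  also have "\<dots> \<le> \<kappa>\<^sup>2 / 4" using assms(1,5) by (simp add: divide_le_eq mult.commute)
  finally have close: "2 - norm (?e - ?f) \<le> \<kappa>\<^sup>2 / 4" .
  have le2: "norm (?e - ?f) \<le> 2" using norm_triangle_ineq4[of ?e ?f] unit by simp
  have "(norm (?e + ?f))\<^sup>2 + (norm (?e - ?f))\<^sup>2 = 2 * (norm ?e)\<^sup>2 + 2 * (norm ?f)\<^sup>2"
    unfolding power2_norm_eq_inner by (simp add: inner_add inner_diff algebra_simps)
  then have "(norm (?e + ?f))\<^sup>2 = (2 - norm (?e - ?f)) * (2 + norm (?e - ?f))"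
    using unit by (simp add: algebra_simps power2_eq_square)
  also have "\<dots> \<le> (\<kappa>\<^sup>2 / 4) * 4" using close le2 by (intro mult_mono) auto
  finally show ?thesis using assms(6) by (simp add: power2_le_iff_abs_le)
qed

text \<open>The way from \<open>v\<close> to \<open>w\<close> is split into a turn at radius
  \<open>dist a v\<close> around \<open>a\<close> and a radial move.\<close>

lemma same_direction_dist:
  fixes a v w :: "'a::real_inner"
  assumes "dist a v \<le> dist a w"
  shows "dist v w \<le> dist a w - dist a v + dist a v * norm (sgn (v - a) - sgn (w - a))"
proof -
  let ?V = "v - a" and ?W = "w - a"
  have nV: "norm ?V = dist a v" "norm ?W = dist a w" by (simp_all add: dist_norm norm_minus_commute)
  have "norm u *\<^sub>R sgn u = u" for u :: 'a by (cases "u = 0") (simp_all add: sgn_div_norm)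
  then have "v - w = norm ?V *\<^sub>R (sgn ?V - sgn ?W) + (norm ?V - norm ?W) *\<^sub>R sgn ?W"
    by (simp add: scaleR_diff_right scaleR_diff_left)
  then have "dist v w \<le> norm (norm ?V *\<^sub>R (sgn ?V - sgn ?W)) + norm ((norm ?V - norm ?W) *\<^sub>R sgn ?W)"
    unfolding dist_norm by (metis norm_triangle_ineq)
  also have "\<dots> \<le> norm ?V * norm (sgn ?V - sgn ?W) + (norm ?W - norm ?V)"
    using assms nV by (auto simp: norm_sgn)
  finally show ?thesis using nV by simp
qed

text \<open>Near-opposition cannot run around an odd cycle of directions: the alternating sum of the
  sums of neighbours is \<open>2 *\<^sub>R e\<close>, of norm 2.\<close>

lemma odd_cycle_3:
  fixes e f g :: "'a::real_inner"
  assumes "norm (e + f) \<le> 1 / 20" "norm (f + g) \<le> 1 / 20" "norm (e + g) \<le> 1 / 20" "norm e = 1"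
  shows False
proof -
  have eq: "2 *\<^sub>R e = ((e + f) - (f + g)) + (e + g)" by (simp add: scaleR_2)
  have "norm (2 *\<^sub>R e) \<le> norm ((e + f) - (f + g)) + norm (e + g)"
    unfolding eq by (rule norm_triangle_ineq)
  then show False using assms norm_triangle_ineq4[of "e + f" "f + g"] by simp
qed

lemma odd_cycle_5:
  fixes e f g h i :: "'a::real_inner"
  assumes "norm (e + f) \<le> 1 / 20" "norm (f + g) \<le> 1 / 20" "norm (g + h) \<le> 1 / 20"
    "norm (h + i) \<le> 1 / 20" "norm (i + e) \<le> 1 / 20" "norm e = 1"
  shows False
proof -
  have eq: "2 *\<^sub>R e = (((e + f) - (f + g)) + ((g + h) - (h + i))) + (i + e)" by (simp add: scaleR_2)
  have "norm (2 *\<^sub>R e) \<le> norm (((e + f) - (f + g)) + ((g + h) - (h + i))) + norm (i + e)"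
    unfolding eq by (rule norm_triangle_ineq)
  then show False using assms norm_triangle_ineq[of "(e + f) - (f + g)" "(g + h) - (h + i)"] norm_triangle_ineq4[of "e + f" "f + g"] norm_triangle_ineq4[of "g + h" "h + i"] by simp
qed

text \<open>The constants are chosen so that the triangle inequality along a detour is tight enough to
  determine directions up to an error of 1/20; only their order of magnitude matters.\<close>

definition gadget :: "('v \<Rightarrow> 'a::real_inner) \<Rightarrow> 'v set \<Rightarrow> 'v \<Rightarrow> 'v \<Rightarrow> 'v \<Rightarrow> 'v \<Rightarrow> bool" where
  "gadget X V a b q1 q2 \<longleftrightarrow> distinct [a, b, q1, q2] \<and> {a, b, q1, q2} \<subseteq> V \<and>
     dist (X a) (X b) \<le> 1 / 10000 \<and>
     (\<forall>q\<in>{q1, q2}. 9 / 10 \<le> dist (X a) (X q) \<and> dist (X a) (X q) \<le> 11 / 10) \<and>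
     1 \<le> norm (sgn (X q1 - X a) + sgn (X q2 - X a)) \<and> 1 \<le> norm (sgn (X q1 - X a) - sgn (X q2 - X a)) \<and>
     1 \<le> dist (X a) (X q1) + dist (X q1) (X q2) - dist (X a) (X q2) \<and>
     1 \<le> dist (X a) (X q2) + dist (X q1) (X q2) - dist (X a) (X q1) \<and>
     (\<forall>v\<in>V - {a, b, q1, q2}. 8000 \<le> dist (X a) (X v))"

section \<open>Local optimality excludes avoided gadgets\<close>

lemma gadget_swap: "gadget X V a b q1 q2 \<Longrightarrow> gadget X V a b q2 q1"
  unfolding gadget_def by (auto simp: add.commute norm_minus_commute dist_commute)

text \<open>Successor and predecessor maps replace the list, so that reversing the orientation is an
  exchange of \<open>s\<close> and \<open>p\<close>. The slack \<open>1 / 10000\<close> is the gain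
  that will be counted for each gadget.\<close>

locale locally_optimal_tour =
  fixes X :: "'v \<Rightarrow> 'a::real_inner" and V :: "'v set" and s p :: "'v \<Rightarrow> 'v"
  assumes s_in: "v \<in> V \<Longrightarrow> s v \<in> V" and p_in: "v \<in> V \<Longrightarrow> p v \<in> V"
    and ps: "v \<in> V \<Longrightarrow> p (s v) = v" and sp: "v \<in> V \<Longrightarrow> s (p v) = v"
    and s_neq: "v \<in> V \<Longrightarrow> s v \<noteq> v" and s_neq_p: "v \<in> V \<Longrightarrow> s v \<noteq> p v"
    and two_opt: "v \<in> V \<Longrightarrow> w \<in> V \<Longrightarrow> v \<noteq> w \<Longrightarrow> dist (X v) (X (s v)) + dist (X w) (X (s w))
      \<le> dist (X v) (X w) + dist (X (s v)) (X (s w)) + 1 / 10000"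
    and or_opt: "v \<in> V \<Longrightarrow> y \<in> V \<Longrightarrow> y \<noteq> v \<Longrightarrow> y \<noteq> p v \<Longrightarrow>
      dist (X (p v)) (X v) + dist (X v) (X (s v)) + dist (X y) (X (s y))
      \<le> dist (X (p v)) (X (s v)) + dist (X y) (X v) + dist (X v) (X (s y)) + 1 / 10000"
begin

text \<open>A reversed 2-opt move is a 2-opt move at the predecessors, and inserting between
  \<open>y\<close> and \<open>p y\<close> is inserting after \<open>p y\<close>.\<close>

lemma reverse: "locally_optimal_tour X V p s"
proof
  fix v assume v: "v \<in> V"
  show "p v \<in> V" "s v \<in> V" "s (p v) = v" "p (s v) = v" "p v \<noteq> s v"
    using v s_in p_in ps sp s_neq_p[of v] by auto
  show "p v \<noteq> v" using s_neq[OF p_in[OF v]] sp[OF v] by auto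
next
  fix v w assume *: "v \<in> V" "w \<in> V" "v \<noteq> w"
  then have "p v \<noteq> p w" using sp by metis
  then show "dist (X v) (X (p v)) + dist (X w) (X (p w))
      \<le> dist (X v) (X w) + dist (X (p v)) (X (p w)) + 1 / 10000"
    using two_opt[of "p v" "p w"] * p_in sp by (simp add: dist_commute)
next
  fix v y assume *: "v \<in> V" "y \<in> V" "y \<noteq> v" "y \<noteq> s v"
  then have "p y \<noteq> v" "p y \<noteq> p v" using sp by metis+
  then show "dist (X (s v)) (X v) + dist (X v) (X (p v)) + dist (X y) (X (p y))
      \<le> dist (X (s v)) (X (p v)) + dist (X y) (X v) + dist (X v) (X (p y)) + 1 / 10000"
    using or_opt[of v "p y"] * p_in sp by (simp add: dist_commute)
qed

end

locale gadget_tour = locally_optimal_tour +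
  fixes a b q1 q2
  assumes gadget: "gadget X V a b q1 q2" and no_edge: "s a \<noteq> b" "s b \<noteq> a"
begin

abbreviation "d v w \<equiv> dist (X v) (X w)"
abbreviation "e v \<equiv> sgn (X v - X a)"

lemma in_V: "a \<in> V" "b \<in> V" "q1 \<in> V" "q2 \<in> V"
  and neqs: "a \<noteq> b" "a \<noteq> q1" "a \<noteq> q2" "b \<noteq> q1" "b \<noteq> q2" "q1 \<noteq> q2"
  and ab: "d a b \<le> 1 / 10000"
  and q1: "9 / 10 \<le> d a q1" "d a q1 \<le> 11 / 10"
  and q2: "9 / 10 \<le> d a q2" "d a q2 \<le> 11 / 10"
  and q12: "1 \<le> norm (e q1 + e q2)" "1 \<le> norm (e q1 - e q2)" "1 \<le> d a q1 + d q1 q2 - d a q2"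
  using gadget by (auto simp: gadget_def)

lemma far: "v \<in> V \<Longrightarrow> v \<notin> {a, b, q1, q2} \<Longrightarrow> 8000 \<le> d a v"
  using gadget by (auto simp: gadget_def)

lemma not_near: "v \<in> V \<Longrightarrow> v \<notin> {a, b} \<Longrightarrow> 9 / 10 \<le> d a v"
  using far[of v] q1 q2 by (cases "v \<in> {q1, q2}") auto

lemma unit: "v \<in> V \<Longrightarrow> v \<notin> {a, b} \<Longrightarrow> norm (e v) = 1"
  using not_near[of v] by (auto simp: norm_sgn)

lemma b_dist: "d a v \<le> d b v + 1 / 10000" "d b v \<le> d a v + 1 / 10000"
  using dist_triangle[of "X a" "X v" "X b"] dist_triangle[of "X b" "X v" "X a"] ab
  by (auto simp: dist_commute)

lemma tri_a: "d v w \<le> d a v + d a w" "d a w \<le> d a v + d v w"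
  using dist_triangle[of "X v" "X w" "X a"] dist_triangle[of "X a" "X w" "X v"] by (auto simp: dist_commute)

lemma nbrs: "s a \<in> V" "s b \<in> V" "p a \<in> V" "p b \<in> V" "s a \<notin> {a, b}" "s b \<notin> {a, b}" "p a \<notin> {a, b}" "p b \<notin> {a, b}"
proof -
  show "s a \<in> V" "s b \<in> V" "p a \<in> V" "p b \<in> V" using in_V s_in p_in by auto
  show "s a \<notin> {a, b}" "s b \<notin> {a, b}" using s_neq in_V no_edge by auto
  show "p a \<notin> {a, b}" "p b \<notin> {a, b}"
    using s_neq in_V no_edge sp by (metis empty_iff insert_iff)+
qed

lemma opposite_near:
  assumes "v \<in> V" "w \<in> V" "v \<notin> {a, b}" "w \<notin> {a, b}" "d a v + d a w - d v w \<le> 5 / 10000"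
  shows "norm (e v + e w) \<le> 1 / 20"
  by (rule antipodal_directions[where \<rho> = "9 / 10" and \<eta> = "5 / 10000"])
    (use assms not_near in \<open>auto simp: power2_eq_square\<close>)

text \<open>Origin of the distance 8000: \<open>antipodal_directions\<close> needs
  \<open>4 * 5 \<le> 8000 * (1 / 20)\<^sup>2\<close>. The excess 5 leaves room for four distances of
  at most 11 / 10 between \<open>a\<close> and a nearby vertex.\<close>

lemma opposite_far:
  assumes "v \<in> V" "w \<in> V" "v \<notin> {a, b, q1, q2}" "w \<notin> {a, b, q1, q2}" "d a v + d a w - d v w \<le> 5"
  shows "norm (e v + e w) \<le> 1 / 20"
  by (rule antipodal_directions[where \<rho> = 8000 and \<eta> = 5])
    (use assms far in \<open>auto simp: power2_eq_square\<close>)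

text \<open>Each estimate excludes one move: the first two a 2-opt move that joins \<open>a\<close>
  to \<open>b\<close>, in either orientation; the last two moving \<open>a\<close> between
  \<open>b\<close> and \<open>s b\<close>, or \<open>b\<close> between \<open>a\<close> and
  \<open>s a\<close>. As \<open>a\<close> and \<open>b\<close> nearly coincide, the excess adds up
  to at most five times \<open>1 / 10000\<close>.\<close>

lemma opp: "norm (e (s a) + e (s b)) \<le> 1 / 20" "norm (e (p a) + e (p b)) \<le> 1 / 20"
  "norm (e (p a) + e (s a)) \<le> 1 / 20" "norm (e (p b) + e (s b)) \<le> 1 / 20"
proof -
  interpret rev: locally_optimal_tour X V p s by (rule reverse)
  show "norm (e (s a) + e (s b)) \<le> 1 / 20"
    using nbrs two_opt[of a b] in_V neqs ab b_dist[of "s b"] by (intro opposite_near) auto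
  show "norm (e (p a) + e (p b)) \<le> 1 / 20"
    using nbrs rev.two_opt[of a b] in_V neqs ab b_dist[of "p b"] by (intro opposite_near) auto
  have "b \<noteq> p a" using nbrs by auto
  then show "norm (e (p a) + e (s a)) \<le> 1 / 20"
    using nbrs or_opt[of a b] in_V neqs ab b_dist[of "s b"]
    by (intro opposite_near) (auto simp: dist_commute)
  have "a \<noteq> p b" using nbrs by auto
  then show "norm (e (p b) + e (s b)) \<le> 1 / 20"
    using nbrs or_opt[of b a] in_V neqs ab b_dist[of "s b"] b_dist[of "s a"] b_dist[of "p b"]
    by (intro opposite_near) (auto simp: dist_commute)
qed

text \<open>So the tour passes \<open>a\<close> and \<open>b\<close> along nearly the same line but
  in opposite senses.\<close>

lemma parallel: "norm (e (s a) - e (p b)) \<le> 1 / 10" "norm (e (s b) - e (p a)) \<le> 1 / 10"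
proof -
  have "e (s a) - e (p b) = (e (p a) + e (s a)) - (e (p a) + e (p b))" by simp
  then show "norm (e (s a) - e (p b)) \<le> 1 / 10"
    using norm_triangle_ineq4[of "e (p a) + e (s a)" "e (p a) + e (p b)"] opp by simp
  have "e (s b) - e (p a) = (e (s a) + e (s b)) - (e (p a) + e (s a))" by simp
  then show "norm (e (s b) - e (p a)) \<le> 1 / 10"
    using norm_triangle_ineq4[of "e (s a) + e (s b)" "e (p a) + e (s a)"] opp by simp
qed

text \<open>Seen from \<open>a\<close>, any two of the four neighbours are nearly parallel or nearly
  opposite, whereas \<open>q1\<close> and \<open>q2\<close> are neither.\<close>

lemma not_both_neighbours: "\<not> (q1 \<in> {s a, s b, p a, p b} \<and> q2 \<in> {s a, s b, p a, p b})"
  using opp parallel q12 neqs(6)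
  by (auto simp: add.commute norm_minus_commute)

lemma s_inj: "v \<in> V \<Longrightarrow> w \<in> V \<Longrightarrow> s v = s w \<Longrightarrow> v = w"
  using ps by metis

text \<open>The heads are successors. As \<open>v\<close> is within 11 / 10 of \<open>a\<close>, the
  2-opt inequality for the edges leaving \<open>v\<close> and \<open>a\<close> or \<open>b\<close>
  bounds the excess of the detour over \<open>a\<close> by a constant, which fixes directions at
  distance 8000.\<close>

lemma head_opposite:
  assumes "v \<in> {q1, q2}" "s v \<notin> {a, b, q1, q2}"
  shows "s a \<notin> {q1, q2} \<Longrightarrow> norm (e (s a) + e (s v)) \<le> 1 / 20"
    and "s b \<notin> {q1, q2} \<Longrightarrow> norm (e (s b) + e (s v)) \<le> 1 / 20"
proof -
  have v: "v \<in> V" "v \<noteq> a" "v \<noteq> b" "d a v \<le> 11 / 10" using assms(1) in_V neqs q1 q2 by auto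
  show "norm (e (s a) + e (s v)) \<le> 1 / 20" if "s a \<notin> {q1, q2}"
    using that two_opt[of a v] v in_V tri_a(2)[where v = v and w = "s v"] nbrs s_in assms(2)
    by (intro opposite_far) auto
  show "norm (e (s b) + e (s v)) \<le> 1 / 20" if "s b \<notin> {q1, q2}"
    using that two_opt[of b v] v in_V tri_a(2)[where v = v and w = "s v"] nbrs s_in assms(2)
      b_dist[of "s b"] b_dist[of v]
    by (intro opposite_far) auto
qed

text \<open>Otherwise the successors of \<open>a\<close>, \<open>b\<close> and \<open>v\<close>
  would be pairwise nearly opposite.\<close>

lemma not_all_heads_far:
  assumes "v \<in> {q1, q2}" "s v \<notin> {a, b, q1, q2}"
  shows "s a \<in> {q1, q2} \<or> s b \<in> {q1, q2}"
  using head_opposite[OF assms] odd_cycle_3[of "e (s a)" "e (s b)" "e (s v)"] opp unit nbrs by auto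

text \<open>Both neighbours of \<open>q2\<close> are far, and they are nearly opposite since moving
  \<open>q2\<close> between \<open>a\<close> and \<open>s a\<close> gains nothing. In either
  orientation \<open>q1\<close> must follow \<open>a\<close> or \<open>b\<close>, so the tour
  contains \<open>q1\<close> between \<open>a\<close> and \<open>b\<close>. The relations among the
  outer neighbours of \<open>a\<close> and \<open>b\<close>, the two neighbours of \<open>q2\<close>
  and \<open>q1\<close> itself then close an odd cycle of length five.\<close>

lemma contradiction_apart:
  assumes q2_nbr: "q2 \<notin> {s a, s b, p a, p b}" and apart: "s q2 \<noteq> q1" "p q2 \<noteq> q1"
  shows False
proof -
  interpret rev: gadget_tour X V p s a b q1 q2
    using reverse gadget nbrs by (auto simp: gadget_tour_def gadget_tour_axioms_def)
  have x: "s q2 \<notin> {a, b, q1, q2}" "p q2 \<notin> {a, b, q1, q2}"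
    using q2_nbr apart s_neq[OF in_V(4)] rev.s_neq[OF in_V(4)] ps[OF in_V(4)] sp[OF in_V(4)] by auto
  have xy: "norm (e (p q2) + e (s q2)) \<le> 1 / 20"
  proof (rule opposite_far)
    have "a \<noteq> p q2" using x by auto
    then show "d a (p q2) + d a (s q2) - d (p q2) (s q2) \<le> 5"
      using or_opt[of q2 a] in_V neqs tri_a(1)[of q2 "s a"] tri_a(2)[where v = q2 and w = "s q2"]
        tri_a(2)[where v = q2 and w = "p q2"] q2
      by (simp add: dist_commute)
  qed (use x s_in p_in in_V in auto)
  have "s a = q1 \<or> s b = q1" using not_all_heads_far[of q2] x q2_nbr by auto
  moreover have "p a = q1 \<or> p b = q1" using rev.not_all_heads_far[of q2] x q2_nbr by auto
  moreover have "s a \<noteq> p a" "s b \<noteq> p b" "s a \<noteq> s b" "p a \<noteq> p b"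
    using s_neq_p in_V s_inj[of a b] rev.s_inj[of a b] neqs by auto
  ultimately consider "s a = q1" "p b = q1" "s b \<noteq> q1" "p a \<noteq> q1" | "s b = q1" "p a = q1" "s a \<noteq> q1" "p b \<noteq> q1"
    by metis
  then show False
  proof cases
    case 1
    then have "norm (e (s b) + e (s q2)) \<le> 1 / 20" "norm (e (p a) + e (p q2)) \<le> 1 / 20"
      using head_opposite(2)[of q2] rev.head_opposite(1)[of q2] x q2_nbr by auto
    then show False
      using odd_cycle_5[of "e (s b)" "e (s q2)" "e (p q2)" "e (p a)" "e (s a)"] xy opp unit nbrs
      by (simp add: add.commute)
  next
    case 2
    then have "norm (e (s a) + e (s q2)) \<le> 1 / 20" "norm (e (p b) + e (p q2)) \<le> 1 / 20"
      using head_opposite(1)[of q2] rev.head_opposite(2)[of q2] x q2_nbr by auto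
    then show False
      using odd_cycle_5[of "e (s a)" "e (s q2)" "e (p q2)" "e (p b)" "e (p a)"] xy opp unit nbrs
      by (simp add: add.commute)
  qed
qed

text \<open>The successors of \<open>a\<close> and \<open>b\<close> are far, so by
  \<open>not_all_heads_far\<close> the vertex after \<open>q1\<close> is \<open>a\<close> or
  \<open>b\<close>. If it is \<open>a\<close>, then \<open>q1 = p a\<close> lies nearly in the
  direction of \<open>s b\<close>: inserting it between \<open>b\<close> and \<open>s b\<close>
  costs little more than \<open>11 / 100\<close>, while removing it saves about 1 by a condition in
  \<open>gadget\<close>. The case of \<open>b\<close> is alike.\<close>

lemma contradiction_adjacent:
  assumes q2_nbr: "q2 \<notin> {s a, s b, p a, p b}" and adj: "s q2 = q1"
  shows False
proof -
  have pq1: "p q1 = q2" using ps[OF in_V(4)] adj by simp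
  have heads: "s a \<noteq> q1" "s b \<noteq> q1" using s_inj[of a q2] s_inj[of b q2] adj in_V neqs by auto
  have heads_far: "s a \<notin> {a, b, q1, q2}" "s b \<notin> {a, b, q1, q2}" using heads q2_nbr nbrs by auto
  have z: "s q1 \<in> V" "s q1 \<notin> {q1, q2}"
    using s_in s_neq s_neq_p[of q1] in_V pq1 by auto
  have move: "d q1 v \<le> d a v - d a q1 + 11 / 100"
    if "v \<in> V" "v \<notin> {a, b, q1, q2}" "norm (e q1 - e v) \<le> 1 / 10" for v
  proof -
    have "d a q1 * norm (e q1 - e v) \<le> (11 / 10) * (1 / 10)" using that q1 by (intro mult_mono) auto
    moreover have "d a q1 \<le> d a v" using far[OF that(1,2)] q1 by linarith
    ultimately show ?thesis using same_direction_dist[of "X a" "X q1" "X v"] by simp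
  qed
  consider "s q1 = a" | "s q1 = b" | "s q1 \<notin> {a, b, q1, q2}" using z by auto
  then show False
  proof cases
    case 1
    then have "p a = q1" using ps in_V by metis
    then have "d q1 (s b) \<le> d a (s b) - d a q1 + 11 / 100"
      using parallel heads_far nbrs by (intro move) (auto simp: norm_minus_commute)
    moreover have "d q2 q1 + d q1 a + d b (s b) \<le> d q2 a + d b q1 + d q1 (s b) + 1 / 10000"
      using or_opt[of q1 b] in_V neqs pq1 1 by simp
    ultimately show False using q12 b_dist[of "s b"] b_dist[of q1] by (simp add: dist_commute)
  next
    case 2
    then have "p b = q1" using ps in_V by metis
    then have "d q1 (s a) \<le> d a (s a) - d a q1 + 11 / 100"
      using parallel heads_far nbrs by (intro move) (auto simp: norm_minus_commute)
    moreover have "d q2 q1 + d q1 b + d a (s a) \<le> d q2 b + d a q1 + d q1 (s a) + 1 / 10000"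
      using or_opt[of q1 a] in_V neqs pq1 2 by simp
    ultimately show False using q12 b_dist[of q2] b_dist[of q1] by (simp add: dist_commute)
  next
    case 3
    then show False using not_all_heads_far[of q1] heads_far by auto
  qed
qed

lemma contradiction_q2:
  assumes "q2 \<notin> {s a, s b, p a, p b}"
  shows False
proof -
  interpret rev: gadget_tour X V p s a b q1 q2
    using reverse gadget nbrs by (auto simp: gadget_tour_def gadget_tour_axioms_def)
  show False
    using contradiction_apart[OF assms] contradiction_adjacent[OF assms] rev.contradiction_adjacent assms by blast
qed

theorem impossible: False
proof -
  interpret swap: gadget_tour X V s p a b q2 q1
    using gadget_swap[OF gadget] no_edge locally_optimal_tour_axioms
    by (auto simp: gadget_tour_def gadget_tour_axioms_def)
  show False using not_both_neighbours contradiction_q2 swap.contradiction_q2 by blast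
qed

end

section \<open>From avoided gadgets to shorter tours\<close>

lemma tour_neighbours:
  assumes "hamilton_cycle n vs" "v < n"
  obtains u w where "(u, v) \<in> set (tour_pairs vs)" "(v, w) \<in> set (tour_pairs vs)"
    "u \<noteq> v" "w \<noteq> v" "u \<noteq> w" "u < n" "w < n"
proof -
  obtain ws where ws: "hamilton_cycle n (v # ws)" "mset (tour_pairs (v # ws)) = mset (tour_pairs vs)"
    using tour_rotate[OF assms] by blast
  have len: "length (v # ws) = n" "3 \<le> n" and dis: "distinct (v # ws)" and sets: "set (v # ws) = {..<n}"
    using ws(1) distinct_card[of "v # ws"] by (auto simp: hamilton_cycle_def)
  obtain h h' hs where h: "ws = h # h' # hs" using len by (cases ws; cases "tl ws") auto
  have set_eq: "set (tour_pairs vs) = set (tour_pairs (v # ws))" using ws(2) by (metis set_mset_mset)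
  have tp: "tour_pairs (v # ws) = pairs (v # h # h' # hs) @ [(last (h' # hs), v)]"
    using tour_pairs_eq[of "v # ws"] h by simp
  have "(last (h' # hs), v) \<in> set (tour_pairs vs)" "(v, h) \<in> set (tour_pairs vs)"
    unfolding set_eq tp by (simp_all del: last.simps)
  moreover have l: "last (h' # hs) \<in> set (h' # hs)" by (rule last_in_set) simp
  have "v \<notin> set (h # h' # hs)" "h \<notin> set (h' # hs)" using dis unfolding h by simp_all
  then have "last (h' # hs) \<noteq> v" "h \<noteq> v" "last (h' # hs) \<noteq> h"
    using l by (metis list.set_intros(1,2))+
  moreover have "set (h # h' # hs) \<subseteq> {..<n}" using sets h by (metis set_subset_Cons)
  then have "last (h' # hs) < n" "h < n" using l by (meson lessThan_iff list.set_intros(1,2) subsetD)+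
  ultimately show ?thesis using that by blast
qed

text \<open>If no move gained \<open>1 / 10000\<close>, the successor and predecessor maps of the
  tour would form a \<open>gadget_tour\<close>, which is impossible.\<close>

lemma gadget_improvement:
  assumes tour: "hamilton_cycle n vs" and gadget: "gadget x {..<n} a b q1 q2"
    and no_edge: "{a, b} \<notin> cycle_edges vs"
  shows "\<exists>ws. hamilton_cycle n ws \<and> cycle_length x ws \<le> cycle_length x vs - 1 / 10000 \<and>
    card (cycle_edges ws - cycle_edges vs) \<le> 3"
proof (rule ccontr)
  assume no: "\<not> ?thesis"
  have dis: "distinct vs" using tour by (simp add: hamilton_cycle_def)
  define s where "s v = (SOME w. (v, w) \<in> set (tour_pairs vs))" for v
  define p where "p v = (SOME u. (u, v) \<in> set (tour_pairs vs))" for v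
  have s: "(v, s v) \<in> set (tour_pairs vs)" if v: "v < n" for v
    unfolding s_def by (rule tour_neighbours[OF tour v]) (rule someI)
  have p: "(p v, v) \<in> set (tour_pairs vs)" if v: "v < n" for v
    unfolding p_def by (rule tour_neighbours[OF tour v]) (rule someI)
  have in_V: "u < n" "v < n" if "(u, v) \<in> set (tour_pairs vs)" for u v
    using that tour unfolding tour_pairs_def hamilton_cycle_def
    by (metis in_set_zipE lessThan_iff set_rotate1)+
  have s_eq: "s v = w" if "(v, w) \<in> set (tour_pairs vs)" for v w
    using successor_unique[OF dis that s] in_V[OF that] by blast
  have p_eq: "p w = v" if "(v, w) \<in> set (tour_pairs vs)" for v w
    using predecessor_unique[OF dis that p] in_V[OF that] by blast
  have neq: "s v \<noteq> v" "s v \<noteq> p v" if v: "v < n" for v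
    by (rule tour_neighbours[OF tour v]; metis s_eq p_eq)+
  interpret gadget_tour x "{..<n}" s p a b q1 q2
  proof
    fix v w :: nat assume vw: "v \<in> {..<n}" "w \<in> {..<n}" "v \<noteq> w"
    have "(v, s v) \<in> set (tour_pairs vs)" "(w, s w) \<in> set (tour_pairs vs)" using s vw by auto
    from two_opt[OF tour this vw(3)] obtain ws where ws: "hamilton_cycle n ws"
      "cycle_length x ws = cycle_length x vs - dist (x v) (x (s v)) - dist (x w) (x (s w))
        + dist (x v) (x w) + dist (x (s v)) (x (s w))"
      "cycle_edges ws \<subseteq> cycle_edges vs \<union> {{v, w}, {s v, s w}}" by blast
    have "card (cycle_edges ws - cycle_edges vs) \<le> card {{v, w}, {s v, s w}}"
      using ws(3) by (intro card_mono) auto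
    also have "\<dots> \<le> 3" by (simp add: card_insert_if)
    finally show "dist (x v) (x (s v)) + dist (x w) (x (s w))
      \<le> dist (x v) (x w) + dist (x (s v)) (x (s w)) + 1 / 10000"
      using no ws(1,2) by force
  next
    fix v y :: nat assume vy: "v \<in> {..<n}" "y \<in> {..<n}" "y \<noteq> v" "y \<noteq> p v"
    have "(p v, v) \<in> set (tour_pairs vs)" "(v, s v) \<in> set (tour_pairs vs)" "(y, s y) \<in> set (tour_pairs vs)"
      using s p vy by auto
    from or_opt[OF tour this vy(3,4)] obtain ws where ws: "hamilton_cycle n ws"
      "cycle_length x ws = cycle_length x vs - dist (x (p v)) (x v) - dist (x v) (x (s v)) - dist (x y) (x (s y))
       + dist (x (p v)) (x (s v)) + dist (x y) (x v) + dist (x v) (x (s y))"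
      "cycle_edges ws \<subseteq> cycle_edges vs \<union> {{p v, s v}, {y, v}, {v, s y}}" by blast
    have "card (cycle_edges ws - cycle_edges vs) \<le> card {{p v, s v}, {y, v}, {v, s y}}"
      using ws(3) by (intro card_mono) auto
    also have "\<dots> \<le> 3" by (simp add: card_insert_if)
    finally show "dist (x (p v)) (x v) + dist (x v) (x (s v)) + dist (x y) (x (s y))
      \<le> dist (x (p v)) (x (s v)) + dist (x y) (x v) + dist (x v) (x (s y)) + 1 / 10000"
      using no ws(1,2) by force
  next
    have ab: "a < n" "b < n" using gadget by (auto simp: gadget_def)
    have "{u, v} \<in> cycle_edges vs" if "(u, v) \<in> set (tour_pairs vs)" for u v
      using that unfolding cycle_edges_tour_pairs by force
    then show "s a \<noteq> b" "s b \<noteq> a" using s[OF ab(1)] s[OF ab(2)] no_edge by (auto simp: insert_commute)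
  next
    fix v :: nat assume "v \<in> {..<n}"
    then show "s v \<in> {..<n}" "p v \<in> {..<n}" "p (s v) = v" "s (p v) = v" "s v \<noteq> v" "s v \<noteq> p v"
      using in_V[OF s[of v]] in_V[OF p[of v]] s_eq[OF p[of v]] p_eq[OF s[of v]] neq[of v] by auto
  qed (rule gadget)
  show False by (rule impossible)
qed

text \<open>A move may bring back up to three avoided edges of \<open>\<E>\<close>, so
  \<open>3 * k\<close> of them allow \<open>k\<close> moves in succession.\<close>

lemma gadgets_improvement:
  assumes gadgets: "\<And>e. e \<in> \<E> \<Longrightarrow> \<exists>a b q1 q2. e = {a, b} \<and> gadget x {..<n} a b q1 q2" and fin: "finite \<E>"
    and tour: "hamilton_cycle n vs" "3 * k \<le> card (\<E> - cycle_edges vs)"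
  shows "\<exists>ws. hamilton_cycle n ws \<and> cycle_length x ws \<le> cycle_length x vs - real k / 10000"
  using tour
proof (induction k arbitrary: vs)
  case (Suc k)
  have "0 < card (\<E> - cycle_edges vs)" by (rule less_le_trans[OF _ Suc.prems(2)]) simp
  then have "\<E> - cycle_edges vs \<noteq> {}" by (metis card.empty less_irrefl)
  then obtain e where e: "e \<in> \<E>" "e \<notin> cycle_edges vs" by blast
  then obtain ws where ws: "hamilton_cycle n ws" "cycle_length x ws \<le> cycle_length x vs - 1 / 10000"
      "card (cycle_edges ws - cycle_edges vs) \<le> 3"
    using gadgets[OF e(1)] gadget_improvement[OF Suc.prems(1)] by blast
  have "finite (cycle_edges ws)" by (simp add: cycle_edges_tour_pairs)
  have "card (\<E> - cycle_edges vs) - card (cycle_edges ws - cycle_edges vs)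
      \<le> card ((\<E> - cycle_edges vs) - (cycle_edges ws - cycle_edges vs))"
    using \<open>finite (cycle_edges ws)\<close> by (intro diff_card_le_card_Diff) auto
  also have "\<dots> \<le> card (\<E> - cycle_edges ws)" using fin by (intro card_mono) auto
  finally have "3 * k \<le> card (\<E> - cycle_edges ws)" using ws(3) Suc.prems(2) unfolding mult_Suc_right by linarith
  then obtain us where "hamilton_cycle n us" "cycle_length x us \<le> cycle_length x ws - real k / 10000"
    using Suc.IH[OF ws(1)] by blast
  then show ?case using ws(2) by (intro exI[of _ us]) (auto simp: field_simps)
qed auto

section \<open>Repeated colours among the gadget edges\<close>

lemma rainbow_misses:
  assumes "rainbow col vs" "finite \<E>" "card (col ` \<E>) + t \<le> card \<E>"
  shows "t \<le> card (\<E> - cycle_edges vs)"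
proof -
  have "card (\<E> \<inter> cycle_edges vs) = card (col ` (\<E> \<inter> cycle_edges vs))"
    using assms(1) unfolding rainbow_def by (intro card_image[symmetric]) (auto intro: inj_on_subset)
  also have "\<dots> \<le> card (col ` \<E>)" using assms(2) by (intro card_mono) auto
  finally have "card (\<E> \<inter> cycle_edges vs) \<le> card (col ` \<E>)" .
  moreover have "card \<E> = card (\<E> \<inter> cycle_edges vs) + card (\<E> - cycle_edges vs)"
    using assms(2) by (metis card_Int_Diff)
  ultimately show ?thesis using assms(3) by linarith
qed

text \<open>Once \<open>k\<close> edges have been exposed, each further edge repeats a colour with probability at
  least \<open>(k - t) / q\<close> as long as fewer than \<open>t\<close> repetitions have occurred; every repetition
  halves the bound.\<close>

lemma prob_few_repeats:
  assumes "finite E" "q > 0" "\<E> \<subseteq> E" "t \<le> k" "k \<le> card \<E>" and p: "p = real (k - t) / real q" "p \<le> 1"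
    and F: "F \<subseteq> \<E>" "\<And>e. c e < q"
  shows "cond_prob E q (\<lambda>col. card \<E> < card (col ` \<E>) + t) F c
    \<le> 2 ^ t / 2 ^ (card F - card (c ` F)) * (1 - p / 2) ^ min (card (\<E> - F)) (card \<E> - k)"
  using F
proof (induction "card (\<E> - F)" arbitrary: F c)
  case 0
  have fin: "finite \<E>" using assms(1,3) by (rule finite_subset[rotated])
  then have F: "F = \<E>" using 0 by auto
  show ?case
  proof (cases "card F - card (c ` F) < t")
    case True
    then have "(1::real) \<le> 2 ^ t / 2 ^ (card F - card (c ` F))" by (simp add: le_divide_eq)
    then have "cond_prob E q (\<lambda>col. card \<E> < card (col ` \<E>) + t) F c \<le> 2 ^ t / 2 ^ (card F - card (c ` F))"
      using cond_prob_le_1[OF assms(1,2)] by (rule order_trans[rotated])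
    then show ?thesis using F by simp
  next
    case False
    have "cond_prob E q (\<lambda>col. card \<E> < card (col ` \<E>) + t) F c = 0"
    proof (rule cond_prob_eq_0)
      fix col assume "col \<in> extensions E q F c"
      then have "col ` \<E> = c ` \<E>" using F by (intro image_cong) (auto simp: extensions_def)
      then show "\<not> card \<E> < card (col ` \<E>) + t" using False F card_image_le[OF fin, of c] by auto
    qed
    then show ?thesis using p by (auto intro!: mult_nonneg_nonneg)
  qed
next
  case (Suc m)
  have fin: "finite \<E>" "finite F" using assms(1,3) Suc.prems(1) by (auto intro: finite_subset)
  obtain e where e: "e \<in> \<E>" "e \<notin> F" using Suc.hyps(2) by (metis DiffE card.empty equals0I nat.distinct(1))
  let ?B = "\<lambda>col. card \<E> < card (col ` \<E>) + t"
  let ?\<rho> = "card F - card (c ` F)" and ?H = "2 ^ t / (2::real) ^ (card F - card (c ` F))"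
  let ?x = "(1 - p / 2) ^ min m (card \<E> - k)"
  have m: "m = card (\<E> - insert e F)" using card_Diff_insert_Suc[OF fin(1) e] Suc.hyps(2) by simp
  have x0: "0 \<le> ?x" using p by auto
  have half: "a / 2 \<le> a" if "0 \<le> a" for a :: real using that by simp
  have cF: "card (c ` F) \<le> card F" by (rule card_image_le[OF fin(2)])
  have p0: "0 \<le> p" using p by simp
  have img: "(c(e := j)) ` insert e F = insert j (c ` F)" for j using e(2) by (auto simp: image_iff)
  have IH: "cond_prob E q ?B (insert e F) (c(e := j))
      \<le> 2 ^ t / 2 ^ (card (insert e F) - card (insert j (c ` F))) * ?x" if "j < q" for j
    using Suc.hyps(1)[OF m, of "c(e := j)"] Suc.prems e that unfolding img by (simp flip: m)
  have cI: "card (insert e F) = Suc (card F)" using e fin by simp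
  have rep: "cond_prob E q ?B (insert e F) (c(e := j)) \<le> ?H / 2 * ?x" if "j < q" "j \<in> c ` F" for j
    using IH[OF that(1)] that(2) cF by (simp add: cI insert_absorb Suc_diff_le)
  have all: "cond_prob E q ?B (insert e F) (c(e := j)) \<le> ?H * ?x" if j: "j < q" for j
  proof (cases "j \<in> c ` F")
    case True
    have "?H / 2 * ?x \<le> ?H * ?x" using x0 by (intro mult_right_mono half) auto
    then show ?thesis using rep[OF j True] by linarith
  next
    case False
    then show ?thesis using IH[OF j] fin by (simp add: cI)
  qed
  show ?case
  proof (cases "card F < k")
    case True
    \<comment> \<open>Before \<open>k\<close> edges are exposed nothing is gained, and
      \<open>r = 1\<close> gives plain averaging. The exponent stays the same, as at least
      \<open>card \<E> - k\<close> edges remain afterwards.\<close>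
    have "cond_prob E q ?B F c \<le> (1 - 1) * (?H * ?x) + 1 * (?H * ?x)"
      by (rule cond_prob_expose[OF assms(1,2) _ e(2), where U = "{..<q}"]) (use e assms(3) all in auto)
    moreover have "card (\<E> - F) = card \<E> - card F" using fin Suc.prems by (intro card_Diff_subset) auto
    then have "min (Suc m) (card \<E> - k) = min m (card \<E> - k)" using True Suc.hyps(2) assms(5) by auto
    ultimately show ?thesis using Suc.hyps(2) by simp
  next
    case False
    show ?thesis
    proof (cases "?\<rho> < t")
      case True
      have "c ` F \<subseteq> {..<q}" using Suc.prems(2) by auto
      then have cq: "card ({..<q} - c ` F) = q - card (c ` F)" "card (c ` F) \<le> q"
        using fin card_mono[of "{..<q}" "c ` F"] by (auto simp: card_Diff_subset)
      \<comment> \<open>Here a new colour is the failure, which keeps the bound, and a repetition is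
        the success, which halves it.\<close>
      let ?r = "1 - real (card (c ` F)) / real q"
      have "cond_prob E q ?B F c \<le> (1 - ?r) * (?H / 2 * ?x) + ?r * (?H * ?x)"
      proof (rule cond_prob_expose[OF assms(1,2) _ e(2), where U = "{..<q} - c ` F"])
        show "real (card ({..<q} - c ` F)) \<le> ?r * real q"
          using cq assms(2) by (simp add: left_diff_distrib of_nat_diff)
        show "?H / 2 * ?x \<le> ?H * ?x" using x0 by (intro mult_right_mono half) auto
      qed (use e assms(3) all rep in auto)
      also have "\<dots> = ?H * ?x * (1 - real (card (c ` F)) / real q / 2)"
      proof -
        have "(1 - (1 - d)) * (h / 2 * y) + (1 - d) * (h * y) = h * y * (1 - d / 2)" for d h y :: real
          by (simp add: field_simps)
        then show ?thesis .
      qed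
      also have "\<dots> \<le> ?H * ?x * (1 - p / 2)"
      proof (rule mult_left_mono)
        \<comment> \<open>At least \<open>k\<close> edges with fewer than \<open>t\<close>
          repetitions show at least \<open>k - t\<close> colours.\<close>
        have "k - t \<le> card (c ` F)" using True False by linarith
        then have "p \<le> real (card (c ` F)) / real q" unfolding p(1) by (intro divide_right_mono) auto
        then show "1 - real (card (c ` F)) / real q / 2 \<le> 1 - p / 2" by simp
      qed (use x0 in auto)
      also have "\<dots> = ?H * (1 - p / 2) ^ Suc (min m (card \<E> - k))" by simp
      also have "Suc (min m (card \<E> - k)) = min (card (\<E> - F)) (card \<E> - k)"
      proof -
        have "card (\<E> - F) = card \<E> - card F" using fin Suc.prems by (intro card_Diff_subset) auto
        then show ?thesis using Suc.hyps(2) False by auto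
      qed
      finally show ?thesis .
    next
      case ge: False
      \<comment> \<open>With \<open>t\<close> repetitions already present the event is excluded,
        since each remaining edge adds at most one colour.\<close>
      have "cond_prob E q ?B F c = 0"
      proof (rule cond_prob_eq_0)
        fix col assume "col \<in> extensions E q F c"
        then have same: "col ` F = c ` F" by (intro image_cong) (auto simp: extensions_def)
        have "col ` \<E> = col ` F \<union> col ` (\<E> - F)" using Suc.prems(1) by auto
        then have "card (col ` \<E>) \<le> card (col ` F) + card (col ` (\<E> - F))" by (metis card_Un_le)
        also have "\<dots> \<le> card (c ` F) + card (\<E> - F)"
          unfolding same using fin by (intro add_left_mono card_image_le) auto
        finally have "card (col ` \<E>) \<le> card (c ` F) + card (\<E> - F)" .
        moreover have "card \<E> = card F + card (\<E> - F)" using fin Suc.prems(1)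
          by (metis card_Diff_subset card_mono le_add_diff_inverse)
        ultimately show "\<not> card \<E> < card (col ` \<E>) + t" using ge cF by linarith
      qed
      then show ?thesis using p by (auto intro!: mult_nonneg_nonneg)
    qed
  qed
qed

lemma prob_few_repeats_exp:
  assumes "finite E" "q > 0" "\<E> \<subseteq> E" "t \<le> k" "k \<le> card \<E>" "k \<le> q" "\<And>e. c e < q"
  shows "cond_prob E q (\<lambda>col. card \<E> < card (col ` \<E>) + t) {} c
    \<le> exp (real t - real (k - t) * real (card \<E> - k) / (2 * real q))"
proof -
  define p where "p = real (k - t) / real q"
  have p: "0 \<le> p" "p \<le> 1" using assms(2,6) by (auto simp: p_def divide_le_eq)
  have "cond_prob E q (\<lambda>col. card \<E> < card (col ` \<E>) + t) {} c
      \<le> 2 ^ t * (1 - p / 2) ^ (card \<E> - k)"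
    using prob_few_repeats[OF assms(1-5) p_def p(2), of "{}" c] assms(7) by simp
  also have "\<dots> \<le> exp 1 ^ t * exp (- p / 2) ^ (card \<E> - k)"
  proof (intro mult_mono power_mono)
    show "(2::real) \<le> exp 1" using exp_ge_add_one_self[of 1] by simp
    show "1 - p / 2 \<le> exp (- p / 2)" using exp_ge_add_one_self[of "- p / 2"] by simp
  qed (use p in auto)
  also have "\<dots> = exp (real t - real (k - t) * real (card \<E> - k) / (2 * real q))"
  proof -
    have "exp (1::real) ^ t * exp (- p / 2) ^ (card \<E> - k) = exp (real t * 1 + real (card \<E> - k) * (- p / 2))"
      by (simp only: exp_of_nat_mult exp_add)
    also have "real t * 1 + real (card \<E> - k) * (- p / 2) = real t - real (k - t) * real (card \<E> - k) / (2 * real q)"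
      by (simp add: p_def mult.commute)
    finally show ?thesis .
  qed
  finally show ?thesis .
qed

section \<open>Many gadgets in a random point set\<close>

text \<open>Chebyshev's inequality at half the mean. The factor \<open>\<rho>\<close> measures the
  deviation from pairwise independence; the bound tends to 0 when the mean tends to infinity and
  \<open>\<rho>\<close> to 1.\<close>

lemma (in prob_space) count_second_moment:
  assumes I: "finite I" "I \<noteq> {}" and F: "\<And>i. i \<in> I \<Longrightarrow> F i \<in> events"
    and eq: "\<And>i. i \<in> I \<Longrightarrow> prob (F i) = \<pi>" and \<pi>: "\<pi> > 0"
    and le: "\<And>i j. i \<in> I \<Longrightarrow> j \<in> I \<Longrightarrow> i \<noteq> j \<Longrightarrow> prob (F i \<inter> F j) \<le> \<pi>\<^sup>2 * \<rho>" and \<rho>: "\<rho> \<ge> 0"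
  shows "prob {\<omega> \<in> space M. real (card {i \<in> I. \<omega> \<in> F i}) \<le> real (card I) * \<pi> / 2}
    \<le> 4 / (real (card I) * \<pi>) + 4 * (\<rho> - 1)"
proof -
  define N where "N = real (card I)"
  have N: "N > 0" using I by (simp add: N_def card_gt_0_iff)
  define X where "X \<omega> = (\<Sum>i\<in>I. indicator (F i) \<omega> :: real)" for \<omega>
  have Xm [measurable]: "random_variable borel X" unfolding X_def using F by measurable
  have X2: "(X \<omega>)\<^sup>2 = (\<Sum>i\<in>I. \<Sum>j\<in>I. indicator (F i \<inter> F j) \<omega>)" for \<omega>
    by (simp add: X_def power2_eq_square sum_product indicator_inter_arith)
  have intF: "integrable M (indicator (F i \<inter> F j) :: _ \<Rightarrow> real)" if "i \<in> I" "j \<in> I" for i j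
    using F that by (intro integrable_real_indicator) (auto simp: emeasure_eq_measure)
  have int2: "integrable M (\<lambda>\<omega>. (X \<omega>)\<^sup>2)" unfolding X2 by (intro Bochner_Integration.integrable_sum intF)
  have EX: "expectation X = N * \<pi>"
  proof -
    have "expectation X = (\<Sum>i\<in>I. expectation (indicator (F i)))"
      unfolding X_def using F by (intro Bochner_Integration.integral_sum integrable_real_indicator) (auto simp: emeasure_eq_measure)
    also have "\<dots> = (\<Sum>i\<in>I. \<pi>)" using F eq by (intro sum.cong) auto
    finally show ?thesis by (simp add: N_def)
  qed
  have "expectation (\<lambda>\<omega>. (X \<omega>)\<^sup>2) = (\<Sum>i\<in>I. \<Sum>j\<in>I. prob (F i \<inter> F j))"
    unfolding X2 using F by (simp add: intF Bochner_Integration.integral_sum Bochner_Integration.integrable_sum)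
  also have "\<dots> \<le> (\<Sum>i\<in>I. \<Sum>j\<in>I. (if j = i then \<pi> else 0) + \<pi>\<^sup>2 * \<rho>)"
    using le eq \<rho> by (intro sum_mono) auto
  also have "\<dots> = N * \<pi> + N\<^sup>2 * \<pi>\<^sup>2 * \<rho>"
    using I by (simp add: sum.distrib N_def power2_eq_square algebra_simps)
  finally have E2: "expectation (\<lambda>\<omega>. (X \<omega>)\<^sup>2) \<le> N * \<pi> + N\<^sup>2 * \<pi>\<^sup>2 * \<rho>" .
  have intX: "integrable M X" unfolding X_def
    using F by (intro Bochner_Integration.integrable_sum integrable_real_indicator) (auto simp: emeasure_eq_measure)
  have var: "variance X \<le> N * \<pi> + N\<^sup>2 * \<pi>\<^sup>2 * (\<rho> - 1)"
    using variance_eq[OF intX int2] E2 EX by (simp add: algebra_simps power_mult_distrib)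
  have pos: "N * \<pi> / 2 > 0" using N \<pi> by simp
  have "prob {\<omega> \<in> space M. real (card {i \<in> I. \<omega> \<in> F i}) \<le> real (card I) * \<pi> / 2}
      \<le> prob {\<omega> \<in> space M. N * \<pi> / 2 \<le> \<bar>X \<omega> - expectation X\<bar>}"
  proof (rule finite_measure_mono)
    have "X \<omega> = real (card {i \<in> I. \<omega> \<in> F i})" for \<omega>
      using I by (simp add: X_def indicator_def sum.If_cases Int_def)
    then show "{\<omega> \<in> space M. real (card {i \<in> I. \<omega> \<in> F i}) \<le> real (card I) * \<pi> / 2}
        \<subseteq> {\<omega> \<in> space M. N * \<pi> / 2 \<le> \<bar>X \<omega> - expectation X\<bar>}"
      using EX by (auto simp: N_def mult.commute)
  qed measurable
  also have "\<dots> \<le> variance X / (N * \<pi> / 2)\<^sup>2"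
    using Chebyshev_inequality[OF Xm int2 pos] .
  also have "\<dots> \<le> (N * \<pi> + N\<^sup>2 * \<pi>\<^sup>2 * (\<rho> - 1)) / (N * \<pi> / 2)\<^sup>2"
    using var by (intro divide_right_mono) auto
  also have "\<dots> = 4 / (N * \<pi>) + 4 * (\<rho> - 1)"
    using N \<pi> by (simp add: power2_eq_square field_simps)
  finally show ?thesis by (simp add: N_def)
qed

text \<open>Occupancy of cells without geometry: \<open>P\<close> is the measure of a cell,
  \<open>p\<close> that of each of its four boxes, one box for each vertex of a gadget. A cell will
  count as occupied if each box receives one point and all other points avoid the cell.\<close>

locale occupancy = prob_space \<mu> for \<mu> :: "'a measure" +
  fixes I :: "'i set" and C :: "'i \<Rightarrow> 'a set" and S :: "'i \<Rightarrow> nat \<Rightarrow> 'a set" and P p :: real and n m :: nat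
  assumes I: "finite I" "I \<noteq> {}"
    and C: "i \<in> I \<Longrightarrow> C i \<in> sets \<mu>" and S: "i \<in> I \<Longrightarrow> r < 4 \<Longrightarrow> S i r \<in> sets \<mu>" "i \<in> I \<Longrightarrow> r < 4 \<Longrightarrow> S i r \<subseteq> C i"
    and dis: "i \<in> I \<Longrightarrow> j \<in> I \<Longrightarrow> i \<noteq> j \<Longrightarrow> C i \<inter> C j = {}"
    and meas_C: "i \<in> I \<Longrightarrow> measure \<mu> (C i) = P" and meas_S: "i \<in> I \<Longrightarrow> r < 4 \<Longrightarrow> measure \<mu> (S i r) = p"
    and m: "m > 0" "4 * m \<le> n" "8 \<le> n" and p: "p > 0" and P: "2 * P \<le> 1" "P > 0"
begin

definition "roles = {..<4::nat} \<rightarrow>\<^sub>E {..<m}"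
text \<open>The vertex in role \<open>r\<close> has its index in the \<open>r\<close>-th block of length \<open>m\<close>. This costs only a constant
  factor and makes the patterns of a cell disjoint.\<close>

definition "chosen f = (\<lambda>r. r * m + f r) ` {..<4::nat}"
text \<open>For a chosen vertex \<open>v\<close> of an admissible \<open>f\<close> the quotient
  \<open>v div m\<close> is its role, which determines its box.\<close>

definition "region i f v = (if v \<in> chosen f then S i (v div m) else space \<mu> - C i)"
definition "pattern i f = PiE {..<n} (region i f)"
definition "occupied i = (\<Union>f\<in>roles. pattern i f)"

sublocale points: finite_product_prob_space "\<lambda>_. \<mu>" "{..<n}"
  by unfold_locales auto

abbreviation "\<Omega> \<equiv> PiM {..<n} (\<lambda>_. \<mu>)"

lemma finite_roles: "finite roles" and card_roles: "card roles = m ^ 4"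
  by (simp_all add: roles_def finite_PiE card_PiE)

lemma chosen_role: "f \<in> roles \<Longrightarrow> r < 4 \<Longrightarrow> (r * m + f r) div m = r"
  unfolding roles_def by (intro div_nat_eqI) (auto simp: PiE_iff)

lemma chosen: "f \<in> roles \<Longrightarrow> card (chosen f) = 4" "f \<in> roles \<Longrightarrow> chosen f \<subseteq> {..<n}" "finite (chosen f)"
  "f \<in> roles \<Longrightarrow> v \<in> chosen f \<Longrightarrow> v div m < 4"
proof -
  show "card (chosen f) = 4" if f: "f \<in> roles"
  proof -
    have "inj_on (\<lambda>r. r * m + f r) {..<4}" by (rule inj_onI) (metis chosen_role[OF f] lessThan_iff)
    then show ?thesis unfolding chosen_def by (simp add: card_image)
  qed
  show "chosen f \<subseteq> {..<n}" if f: "f \<in> roles"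
  proof
    fix v assume "v \<in> chosen f"
    then obtain r where r: "r < 4" "v = r * m + f r" by (auto simp: chosen_def)
    have "f r < m" using f r by (auto simp: roles_def PiE_iff)
    moreover have "Suc r * m \<le> 4 * m" using r(1) by (intro mult_right_mono) auto
    ultimately have "r * m + f r < n" using m(2) unfolding mult_Suc by linarith
    then show "v \<in> {..<n}" using r(2) by simp
  qed
  show "finite (chosen f)" by (simp add: chosen_def)
  show "v div m < 4" if "f \<in> roles" "v \<in> chosen f"
    using that chosen_role by (auto simp: chosen_def)
qed

lemma region_sets: "i \<in> I \<Longrightarrow> f \<in> roles \<Longrightarrow> region i f v \<in> sets \<mu>"
  using S C chosen(4) by (auto simp: region_def)

lemma measure_region: "i \<in> I \<Longrightarrow> f \<in> roles \<Longrightarrow> measure \<mu> (region i f v) = (if v \<in> chosen f then p else 1 - P)"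
  using meas_S meas_C C chosen(4) by (auto simp: region_def prob_compl)

lemma pattern_sets: "i \<in> I \<Longrightarrow> f \<in> roles \<Longrightarrow> pattern i f \<in> sets \<Omega>"
  unfolding pattern_def using region_sets by (intro sets_PiM_I_finite) auto

lemma prob_pattern:
  assumes "i \<in> I" "f \<in> roles"
  shows "measure \<Omega> (pattern i f) = p ^ 4 * (1 - P) ^ (n - 4)"
proof -
  have "measure \<Omega> (pattern i f) = (\<Prod>v<n. if v \<in> chosen f then p else 1 - P)"
    unfolding pattern_def using assms region_sets measure_region by (subst points.finite_measure_PiM_emb) auto
  also have "\<dots> = p ^ card (chosen f) * (1 - P) ^ card ({..<n} - chosen f)"
    using chosen(2)[OF assms(2)] by (simp add: prod.If_cases Int_absorb1 Diff_eq)
  also have "card ({..<n} - chosen f) = n - 4" using chosen(1,2)[OF assms(2)] chosen(3)[of f] by (simp add: card_Diff_subset)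
  finally show ?thesis using chosen(1)[OF assms(2)] by simp
qed

text \<open>A vertex chosen by both patterns would have to lie in two disjoint cells. Otherwise
  eight vertices are confined to a box, and each of the others avoids both cells; for the eight only
  the box is taken into account.\<close>

lemma prob_pattern_pair:
  assumes ij: "i \<in> I" "j \<in> I" "i \<noteq> j" and f: "f \<in> roles" "g \<in> roles"
  shows "measure \<Omega> (pattern i f \<inter> pattern j g) \<le> p ^ 8 * (1 - 2 * P) ^ (n - 8)"
proof (cases "chosen f \<inter> chosen g = {}")
  case False
  then obtain v where v: "v \<in> chosen f" "v \<in> chosen g" by auto
  then have "v < n" using chosen(2)[OF f(1)] by auto
  have "region i f v \<inter> region j g v = {}"
    using v S(2)[OF ij(1) chosen(4)[OF f(1) v(1)]] S(2)[OF ij(2) chosen(4)[OF f(2) v(2)]] dis[OF ij]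
    by (auto simp: region_def)
  then have "pattern i f \<inter> pattern j g = {}" using \<open>v < n\<close> by (auto simp: pattern_def PiE_iff)
  then show ?thesis using p P by simp
next
  case True
  have reg: "measure \<mu> (region i f v \<inter> region j g v) \<le> (if v \<in> chosen f \<union> chosen g then p else 1 - 2 * P)" for v
  proof -
    consider "v \<in> chosen f" | "v \<in> chosen g" | "v \<notin> chosen f" "v \<notin> chosen g" by blast
    then show ?thesis
    proof cases
      case 1
      have "measure \<mu> (region i f v \<inter> region j g v) \<le> measure \<mu> (region i f v)"
        using region_sets ij f by (intro finite_measure_mono) auto
      then show ?thesis using 1 measure_region[OF ij(1) f(1)] by simp
    next
      case 2
      have "measure \<mu> (region i f v \<inter> region j g v) \<le> measure \<mu> (region j g v)"
        using region_sets ij f by (intro finite_measure_mono) auto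
      then show ?thesis using 2 measure_region[OF ij(2) f(2)] by simp
    next
      case 3
      then have "region i f v \<inter> region j g v = space \<mu> - (C i \<union> C j)" by (auto simp: region_def)
      moreover have "measure \<mu> (space \<mu> - (C i \<union> C j)) = 1 - 2 * P"
        using C ij dis meas_C by (simp add: prob_compl finite_measure_Union)
      ultimately show ?thesis using 3 by simp
    qed
  qed
  have "pattern i f \<inter> pattern j g = PiE {..<n} (\<lambda>v. region i f v \<inter> region j g v)"
    unfolding pattern_def by (auto simp: PiE_iff)
  then have "measure \<Omega> (pattern i f \<inter> pattern j g) = (\<Prod>v<n. measure \<mu> (region i f v \<inter> region j g v))"
    using region_sets ij f by (simp add: points.finite_measure_PiM_emb)
  also have "\<dots> \<le> (\<Prod>v<n. if v \<in> chosen f \<union> chosen g then p else 1 - 2 * P)"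
    using reg by (intro prod_mono) auto
  also have "\<dots> = p ^ card (chosen f \<union> chosen g) * (1 - 2 * P) ^ card ({..<n} - (chosen f \<union> chosen g))"
    using chosen(2)[OF f(1)] chosen(2)[OF f(2)] by (simp add: prod.If_cases Int_absorb1 Diff_eq del: Un_iff)
  also have "card (chosen f \<union> chosen g) = 8"
    using True chosen(1)[OF f(1)] chosen(1)[OF f(2)] chosen(3) by (simp add: card_Un_disjoint)
  also have "card ({..<n} - (chosen f \<union> chosen g)) = n - 8"
    using calculation chosen(2)[OF f(1)] chosen(2)[OF f(2)] chosen(3) \<open>card (chosen f \<union> chosen g) = 8\<close>
    by (simp add: card_Diff_subset)
  finally show ?thesis .
qed

lemma occupied_sets: "i \<in> I \<Longrightarrow> occupied i \<in> sets \<Omega>"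
  unfolding occupied_def using finite_roles pattern_sets by auto

text \<open>The patterns of one cell are disjoint, because a vertex chosen by \<open>f\<close> but
  not by \<open>g\<close> lies inside the cell for the former and outside for the latter. So their
  probabilities add up exactly.\<close>

lemma prob_occupied:
  assumes "i \<in> I"
  shows "measure \<Omega> (occupied i) = real m ^ 4 * p ^ 4 * (1 - P) ^ (n - 4)"
proof -
  have "disjoint_family_on (pattern i) roles"
    unfolding disjoint_family_on_def
  proof (intro ballI impI)
    fix f g assume fg: "f \<in> roles" "g \<in> roles" "f \<noteq> g"
    then obtain r where r: "r < 4" "f r \<noteq> g r"
      unfolding roles_def by (metis PiE_ext lessThan_iff)
    let ?v = "r * m + f r"
    have v: "?v \<in> chosen f" using r by (auto simp: chosen_def)
    have "?v \<notin> chosen g"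
    proof
      assume "?v \<in> chosen g"
      then obtain r' where r': "r' < 4" "?v = r' * m + g r'" by (auto simp: chosen_def)
      then have "r = r'" using chosen_role[OF fg(1) r(1)] chosen_role[OF fg(2) r'(1)] by simp
      then show False using r' r by simp
    qed
    then have "region i f ?v \<inter> region i g ?v = {}"
      using v S(2)[OF assms chosen(4)[OF fg(1) v]] by (auto simp: region_def)
    moreover have "?v < n" using v chosen(2)[OF fg(1)] by auto
    ultimately show "pattern i f \<inter> pattern i g = {}" by (auto simp: pattern_def PiE_iff)
  qed
  then have "measure \<Omega> (occupied i) = (\<Sum>f\<in>roles. measure \<Omega> (pattern i f))"
    unfolding occupied_def using finite_roles pattern_sets[OF assms]
    by (intro points.finite_measure_finite_Union) auto
  then show ?thesis using prob_pattern[OF assms] by (simp add: card_roles)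
qed

lemma prob_occupied_pair:
  assumes "i \<in> I" "j \<in> I" "i \<noteq> j"
  shows "measure \<Omega> (occupied i \<inter> occupied j) \<le> real m ^ 8 * (p ^ 8 * (1 - 2 * P) ^ (n - 8))"
proof -
  have eq: "occupied i \<inter> occupied j = (\<Union>fg\<in>roles \<times> roles. pattern i (fst fg) \<inter> pattern j (snd fg))"
    unfolding occupied_def by auto
  have "measure \<Omega> (occupied i \<inter> occupied j) \<le> (\<Sum>fg\<in>roles \<times> roles. measure \<Omega> (pattern i (fst fg) \<inter> pattern j (snd fg)))"
    unfolding eq using finite_roles pattern_sets assms by (intro points.finite_measure_subadditive_finite) auto
  also have "\<dots> \<le> (\<Sum>fg\<in>roles \<times> roles. p ^ 8 * (1 - 2 * P) ^ (n - 8))"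
    using prob_pattern_pair[OF assms] by (intro sum_mono) auto
  also have "\<dots> = real m ^ 8 * (p ^ 8 * (1 - 2 * P) ^ (n - 8))"
    by (simp add: card_cartesian_product card_roles flip: power_add)
  finally show ?thesis .
qed

text \<open>Up to a factor, \<open>1 - 2 * P \<le> (1 - P)\<^sup>2\<close> gives independence of two
  cells. The factor \<open>1 / (1 - P) ^ 8\<close> arises because the exponent is
  \<open>2 * (n - 8)\<close> instead of \<open>2 * (n - 4)\<close>.\<close>

lemma many_occupied:
  defines "\<pi> \<equiv> real m ^ 4 * p ^ 4 * (1 - P) ^ (n - 4)"
  shows "measure \<Omega> {x \<in> space \<Omega>. real (card {i \<in> I. x \<in> occupied i}) \<le> real (card I) * \<pi> / 2}
    \<le> 4 / (real (card I) * \<pi>) + 4 * (1 / (1 - P) ^ 8 - 1)"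
proof (rule points.count_second_moment[OF I occupied_sets])
  have P1: "0 < 1 - P" using P by linarith
  show "\<pi> > 0" using m p P1 by (simp add: \<pi>_def)
  show "measure \<Omega> (occupied i) = \<pi>" if "i \<in> I" for i using prob_occupied[OF that] by (simp add: \<pi>_def)
  show "measure \<Omega> (occupied i \<inter> occupied j) \<le> \<pi>\<^sup>2 * (1 / (1 - P) ^ 8)" if "i \<in> I" "j \<in> I" "i \<noteq> j" for i j
  proof -
    have "measure \<Omega> (occupied i \<inter> occupied j) \<le> real m ^ 8 * (p ^ 8 * (1 - 2 * P) ^ (n - 8))"
      by (rule prob_occupied_pair[OF that])
    also have "\<dots> \<le> real m ^ 8 * (p ^ 8 * ((1 - P)\<^sup>2) ^ (n - 8))"
      using P p by (intro mult_left_mono power_mono) (auto simp: power2_eq_square algebra_simps)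
    also have "((1 - P)\<^sup>2) ^ (n - 8) = (1 - P) ^ (2 * (n - 4)) / (1 - P) ^ 8"
    proof -
      have "2 * (n - 4) = 2 * (n - 8) + 8" using m(3) by simp
      then have "(1 - P) ^ (2 * (n - 4)) = ((1 - P)\<^sup>2) ^ (n - 8) * (1 - P) ^ 8"
        by (simp only: power_add power_mult)
      then show ?thesis using P1 by simp
    qed
    also have "real m ^ 8 * (p ^ 8 * ((1 - P) ^ (2 * (n - 4)) / (1 - P) ^ 8)) = \<pi>\<^sup>2 * (1 / (1 - P) ^ 8)"
      unfolding \<pi>_def by (simp add: power_mult_distrib flip: power_mult) (simp add: mult.commute)
    finally show ?thesis .
  qed
  show "0 \<le> 1 / (1 - P) ^ 8" using P1 by simp
qed auto

end

section \<open>Gadgets in a grid of cells\<close>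

lemma norm_sgn_add_sub_ge_1:
  fixes v w :: "'a::real_inner"
  assumes "v \<noteq> 0" "w \<noteq> 0" "2 * \<bar>v \<bullet> w\<bar> \<le> norm v * norm w"
  shows "1 \<le> norm (sgn v + sgn w)" "1 \<le> norm (sgn v - sgn w)"
proof -
  have pos: "0 < norm v * norm w" using assms(1,2) by simp
  have "sgn v \<bullet> sgn w = (v \<bullet> w) / (norm v * norm w)"
    by (simp add: sgn_div_norm divide_inverse mult.commute mult.left_commute)
  then have "\<bar>sgn v \<bullet> sgn w\<bar> \<le> 1 / 2"
    using assms(3) pos by (simp add: abs_mult divide_le_eq)
  moreover have "norm (sgn v) = 1" "norm (sgn w) = 1" using assms(1,2) by (simp_all add: norm_sgn)
  then have "sgn v \<bullet> sgn v = 1" "sgn w \<bullet> sgn w = 1" by (simp_all flip: power2_norm_eq_inner)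
  ultimately have "1 \<le> (norm (sgn v + sgn w))\<^sup>2" "1 \<le> (norm (sgn v - sgn w))\<^sup>2"
    unfolding power2_norm_eq_inner by (auto simp: inner_add inner_diff inner_commute abs_if split: if_splits)
  then show "1 \<le> norm (sgn v + sgn w)" "1 \<le> norm (sgn v - sgn w)"
    by (metis norm_ge_zero one_power2 power2_le_imp_le)+
qed

text \<open>The four vertices lie in tiny squares near (0, 0), (0, 0), (1, 0) and (0, 1) relative to
  \<open>(ox, oy)\<close>. As \<open>a\<close> is only close to this origin, the other vertices keep
  8001 away from it to be 8000 away from \<open>a\<close>.\<close>

lemma gadget_coordinates:
  fixes X :: "nat \<Rightarrow> real \<times> real"
  assumes "distinct [a, b, q1, q2]" "{a, b, q1, q2} \<subseteq> V"
    and a: "ox < fst (X a)" "fst (X a) < ox + 1 / 100000" "oy < snd (X a)" "snd (X a) < oy + 1 / 100000"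
    and b: "ox + 1 / 100000 < fst (X b)" "fst (X b) < ox + 2 / 100000" "oy < snd (X b)" "snd (X b) < oy + 1 / 100000"
    and q1: "ox + 1 < fst (X q1)" "fst (X q1) < ox + 1 + 1 / 100000" "oy < snd (X q1)" "snd (X q1) < oy + 1 / 100000"
    and q2: "ox < fst (X q2)" "fst (X q2) < ox + 1 / 100000" "oy + 1 < snd (X q2)" "snd (X q2) < oy + 1 + 1 / 100000"
    and far: "\<And>v. v \<in> V - {a, b, q1, q2} \<Longrightarrow> 8001 \<le> \<bar>fst (X v) - ox\<bar> \<or> 8001 \<le> \<bar>snd (X v) - oy\<bar>"
  shows "gadget X V a b q1 q2"
proof -
  let ?t = "1 / 100000 :: real"
  have le: "dist (X v) (X w) \<le> \<bar>fst (X v) - fst (X w)\<bar> + \<bar>snd (X v) - snd (X w)\<bar>" for v w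
    by (rule dist_le_abs_sum)
  have ge: "\<bar>fst (X v) - fst (X w)\<bar> \<le> dist (X v) (X w)" "\<bar>snd (X v) - snd (X w)\<bar> \<le> dist (X v) (X w)" for v w
    using dist_fst_le[of "X v" "X w"] dist_snd_le[of "X v" "X w"] by (simp_all add: dist_real_def)
  have ab: "dist (X a) (X b) \<le> 1 / 10000" using le[of a b] a b by linarith
  have aq1: "1 - ?t \<le> dist (X a) (X q1)" "dist (X a) (X q1) \<le> 1 + 2 * ?t"
    using le[of a "q1"] ge(1)[of a "q1"] a q1 by linarith+
  have aq2: "1 - ?t \<le> dist (X a) (X q2)" "dist (X a) (X q2) \<le> 1 + 2 * ?t"
    using le[of a "q2"] ge(2)[of a "q2"] a q2 by linarith+
  have q12: "13 / 10 \<le> dist (X q1) (X q2)"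
  proof -
    have "(9 / 10)\<^sup>2 \<le> \<bar>fst (X q1) - fst (X q2)\<bar>\<^sup>2" "(95 / 100)\<^sup>2 \<le> \<bar>snd (X q1) - snd (X q2)\<bar>\<^sup>2"
      using q1 q2 by (intro power_mono; linarith)+
    then have "(13 / 10)\<^sup>2 \<le> (fst (X q1) - fst (X q2))\<^sup>2 + (snd (X q1) - snd (X q2))\<^sup>2"
      by (simp add: power2_eq_square)
    then show ?thesis unfolding dist_prod_def dist_real_def power2_abs by (rule real_le_rsqrt)
  qed
  have dirs: "1 \<le> norm (sgn (X q1 - X a) + sgn (X q2 - X a))" "1 \<le> norm (sgn (X q1 - X a) - sgn (X q2 - X a))"
  proof -
    let ?v = "X q1 - X a" and ?w = "X q2 - X a"
    have n: "norm ?v = dist (X a) (X q1)" "norm ?w = dist (X a) (X q2)"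
      by (simp_all add: dist_norm norm_minus_commute)
    have big: "9 / 10 * (9 / 10) \<le> norm ?v * norm ?w" using aq1 aq2 unfolding n by (intro mult_mono) auto
    have "\<bar>fst ?v\<bar> \<le> 2" "\<bar>fst ?w\<bar> \<le> ?t" "\<bar>snd ?v\<bar> \<le> ?t" "\<bar>snd ?w\<bar> \<le> 2"
      unfolding fst_diff snd_diff using a q1 q2 by linarith+
    then have "\<bar>fst ?v\<bar> * \<bar>fst ?w\<bar> \<le> 2 * ?t" "\<bar>snd ?v\<bar> * \<bar>snd ?w\<bar> \<le> ?t * 2"
      by (intro mult_mono; simp)+
    moreover have "\<bar>?v \<bullet> ?w\<bar> \<le> \<bar>fst ?v\<bar> * \<bar>fst ?w\<bar> + \<bar>snd ?v\<bar> * \<bar>snd ?w\<bar>"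
      unfolding inner_prod_def inner_real_def abs_mult[symmetric] by (rule abs_triangle_ineq)
    ultimately have "\<bar>?v \<bullet> ?w\<bar> \<le> 4 * ?t" by linarith
    then have "2 * \<bar>?v \<bullet> ?w\<bar> \<le> norm ?v * norm ?w" using big by simp
    moreover have "?v \<noteq> 0" "?w \<noteq> 0" using n aq1 aq2 by auto
    ultimately show "1 \<le> norm (sgn ?v + sgn ?w)" "1 \<le> norm (sgn ?v - sgn ?w)"
      using norm_sgn_add_sub_ge_1 by blast+
  qed
  have "8000 \<le> dist (X a) (X v)" if "v \<in> V - {a, b, q1, q2}" for v
    using far[OF that] ge[of a v] a by linarith
  then show ?thesis using assms(1,2) ab aq1 aq2 q12 dirs unfolding gadget_def by auto
qed

text \<open>The origin is the centre of the grid cell \<open>c\<close> and the unit is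
  \<open>1 / (16002 * k)\<close>, so that a cell of side \<open>1 / k\<close> extends 8001 units to
  each side.\<close>

definition rectangle :: "nat \<Rightarrow> nat \<times> nat \<Rightarrow> real \<times> real \<Rightarrow> real \<times> real \<Rightarrow> (real \<times> real) set" where
  "rectangle k c I J =
     (let h = 1 / (16002 * real k); ox = (real (fst c) + 1 / 2) / real k; oy = (real (snd c) + 1 / 2) / real k
      in {ox + h * fst I <..< ox + h * snd I} \<times> {oy + h * fst J <..< oy + h * snd J})"

definition cell :: "nat \<Rightarrow> nat \<times> nat \<Rightarrow> (real \<times> real) set" where
  "cell k c = rectangle k c (-8001, 8001) (-8001, 8001)"

text \<open>The roles 0, 1, 2, 3 are those of \<open>a\<close>, \<open>b\<close>, \<open>q1\<close>,
  \<open>q2\<close>. The boxes have equal area, as \<open>occupancy\<close> requires.\<close>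

definition gadget_box :: "nat \<Rightarrow> nat \<times> nat \<Rightarrow> nat \<Rightarrow> (real \<times> real) set" where
  "gadget_box k c r = rectangle k c
     (if r = 1 then (1 / 100000, 2 / 100000) else if r = 2 then (1, 1 + 1 / 100000) else (0, 1 / 100000))
     (if r = 3 then (1, 1 + 1 / 100000) else (0, 1 / 100000))"

lemma mem_rectangle:
  assumes "k > 0"
  shows "y \<in> rectangle k c I J \<longleftrightarrow>
    8001 * (2 * real (fst c) + 1) + fst I < 16002 * real k * fst y \<and> 16002 * real k * fst y < 8001 * (2 * real (fst c) + 1) + snd I \<and>
    8001 * (2 * real (snd c) + 1) + fst J < 16002 * real k * snd y \<and> 16002 * real k * snd y < 8001 * (2 * real (snd c) + 1) + snd J"
  using assms by (cases y) (auto simp: rectangle_def field_simps)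

lemma cell_disjoint:
  assumes "k > 0" "c \<noteq> c'"
  shows "cell k c \<inter> cell k c' = {}"
proof -
  have less: "fst c = fst c'" "snd c = snd c'" if "y \<in> cell k c" "y \<in> cell k c'" for y
  proof -
    have "real (fst c) < real (fst c') + 1" "real (fst c') < real (fst c) + 1"
      "real (snd c) < real (snd c') + 1" "real (snd c') < real (snd c) + 1"
      using that unfolding cell_def mem_rectangle[OF assms(1)] fst_conv snd_conv by argo+
    then show "fst c = fst c'" "snd c = snd c'" by linarith+
  qed
  then show ?thesis using assms(2) by (auto simp: prod_eq_iff)
qed

lemma gadget_box_subset: "k > 0 \<Longrightarrow> gadget_box k c r \<subseteq> cell k c"
  by (auto simp: gadget_box_def cell_def mem_rectangle split: if_splits)

lemma cell_subset:
  assumes "k > 0" "c \<in> {..<k} \<times> {..<k}"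
  shows "cell k c \<subseteq> unit_square"
proof
  fix y assume y: "y \<in> cell k c"
  note Y = y[unfolded cell_def mem_rectangle[OF assms(1)] fst_conv snd_conv mult.assoc]
  have inside: "0 < z \<and> z < K" if "0 \<le> i" "i + 1 \<le> K" "8001 * (2 * i + 1) + - 8001 < 16002 * z"
    "16002 * z < 8001 * (2 * i + 1) + 8001" for i K z :: real
    using that by (simp add: algebra_simps)
  have "real (fst c) + 1 \<le> real k" "real (snd c) + 1 \<le> real k" using assms(2) by (auto simp: Suc_le_eq)
  then have "0 < real k * fst y \<and> real k * fst y < real k" "0 < real k * snd y \<and> real k * snd y < real k"
    using Y by (intro inside; auto)+
  then show "y \<in> unit_square"
    using assms(1) by (cases y) (auto simp: unit_square_def zero_less_mult_iff)
qed

section \<open>The uniform distribution on the square\<close>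

abbreviation "uniform_square \<equiv> uniform_measure lborel unit_square"

lemma emeasure_lborel_Times:
  fixes A B :: "real set"
  assumes "A \<in> sets borel" "B \<in> sets borel"
  shows "emeasure lborel (A \<times> B) = emeasure lborel A * emeasure lborel B"
  using assms by (simp flip: lborel_prod add: lborel.emeasure_pair_measure_Times)

lemma unit_square_measurable [measurable]: "unit_square \<in> sets borel"
  unfolding unit_square_def by (intro borel_closed closed_Times) auto

lemma emeasure_unit_square: "emeasure lborel unit_square = 1"
  unfolding unit_square_def by (subst emeasure_lborel_Times) auto

lemma prob_space_uniform_square: "prob_space uniform_square"
  by (rule prob_space_uniform_measure) (simp_all add: emeasure_unit_square)

lemma rectangle_measurable: "rectangle k c I J \<in> sets borel"
  unfolding rectangle_def Let_def by (intro borel_open open_Times) auto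

lemma measure_rectangle:
  assumes "k > 0" "rectangle k c I J \<subseteq> unit_square" "fst I \<le> snd I" "fst J \<le> snd J"
  shows "measure uniform_square (rectangle k c I J) = (snd I - fst I) * (snd J - fst J) / (16002 * real k)\<^sup>2"
proof -
  have h: "1 / (16002 * real k) \<ge> 0" by simp
  have le: "1 / (16002 * real k) * fst I \<le> 1 / (16002 * real k) * snd I"
    "1 / (16002 * real k) * fst J \<le> 1 / (16002 * real k) * snd J"
    using assms(3,4) h by (intro mult_left_mono; simp)+
  have "emeasure uniform_square (rectangle k c I J) = emeasure lborel (rectangle k c I J)"
    using assms(2) rectangle_measurable
    by (subst emeasure_uniform_measure) (simp_all add: emeasure_unit_square Int_absorb1 divide_ennreal_def)
  also have "\<dots> = ennreal (1 / (16002 * real k) * (snd I - fst I)) * ennreal (1 / (16002 * real k) * (snd J - fst J))"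
    unfolding rectangle_def Let_def using le
    by (subst emeasure_lborel_Times) (simp_all add: diff_divide_distrib)
  also have "\<dots> = ennreal ((snd I - fst I) * (snd J - fst J) / (16002 * real k)\<^sup>2)"
    using assms(3,4) by (subst ennreal_mult[symmetric]) (simp_all add: power2_eq_square mult.commute)
  finally show ?thesis using assms(3,4) by (simp add: measure_def)
qed

lemma occupancy_cells:
  assumes k: "k \<ge> 2" and n: "n \<ge> 8"
  shows "occupancy uniform_square ({..<k} \<times> {..<k}) (cell k) (gadget_box k) (1 / (real k)\<^sup>2)
    ((1 / 100000)\<^sup>2 / (16002 * real k)\<^sup>2) n (n div 4)"
proof -
  interpret prob_space uniform_square by (rule prob_space_uniform_square)
  have k0: "k > 0" using k by simp
  show ?thesis
  proof
    show "{..<k} \<times> {..<k} \<noteq> {}" using k0 by auto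
    show "cell k c \<in> sets uniform_square" "gadget_box k c r \<in> sets uniform_square" for c r
      by (simp_all add: cell_def gadget_box_def rectangle_measurable)
    show "gadget_box k c r \<subseteq> cell k c" for c r by (rule gadget_box_subset[OF k0])
    show "cell k c \<inter> cell k c' = {}" if "c \<noteq> c'" for c c' using cell_disjoint[OF k0 that] .
    show "measure uniform_square (cell k c) = 1 / (real k)\<^sup>2" if "c \<in> {..<k} \<times> {..<k}" for c
      using measure_rectangle[OF k0, of c "(-8001, 8001)" "(-8001, 8001)"] cell_subset[OF k0 that]
      by (simp add: cell_def power_mult_distrib)
    show "measure uniform_square (gadget_box k c r) = (1 / 100000)\<^sup>2 / (16002 * real k)\<^sup>2"
      if "c \<in> {..<k} \<times> {..<k}" for c r
    proof -
      have sub: "gadget_box k c r \<subseteq> unit_square"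
        using gadget_box_subset[OF k0] cell_subset[OF k0 that] by blast
      show ?thesis
        using sub unfolding gadget_box_def
        by (subst measure_rectangle[OF k0]) (auto simp: power2_eq_square)
    qed
    show "0 < n div 4" "4 * (n div 4) \<le> n" "8 \<le> n" using n by auto
    have "(2::real)\<^sup>2 \<le> (real k)\<^sup>2" using k by (intro power_mono) auto
    then show "2 * (1 / (real k)\<^sup>2) \<le> 1" using k0 by (simp add: field_simps)
  qed (use k0 in auto)
qed

lemma occupied_gadget:
  assumes k: "k \<ge> 2" and n: "n \<ge> 8" and c: "c \<in> {..<k} \<times> {..<k}"
    and x: "x \<in> occupancy.occupied uniform_square (cell k) (gadget_box k) n (n div 4) c"
  shows "\<exists>a b q1 q2. gadget (\<lambda>i. (16002 * real k) *\<^sub>R x i) {..<n} a b q1 q2 \<and> x a \<in> cell k c \<and> x b \<in> cell k c"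
proof -
  interpret occupancy uniform_square "{..<k} \<times> {..<k}" "cell k" "gadget_box k" "1 / (real k)\<^sup>2"
    "(1 / 100000)\<^sup>2 / (16002 * real k)\<^sup>2" n "n div 4"
    using occupancy_cells[OF k n] .
  have k0: "k > 0" using k by simp
  obtain f where f: "f \<in> roles" "x \<in> pattern c f" using x by (auto simp: occupied_def)
  define v where "v r = r * (n div 4) + f r" for r
  have ch: "chosen f = v ` {..<4}" by (simp add: chosen_def v_def)
  have vdiv: "v r div (n div 4) = r" if "r < 4" for r using chosen_role[OF f(1) that] by (simp add: v_def)
  have vneq: "v r \<noteq> v r'" if "r < 4" "r' < 4" "r \<noteq> r'" for r r' using vdiv that by metis
  have vch: "v r \<in> chosen f" if "r < 4" for r using that ch by auto
  have vn: "v r < n" if "r < 4" for r using vch[OF that] chosen(2)[OF f(1)] by auto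
  have vbox: "x (v r) \<in> gadget_box k c r" if "r < 4" for r
  proof -
    have "x (v r) \<in> region c f (v r)" using f(2) vn[OF that] by (auto simp: pattern_def PiE_iff)
    then show ?thesis using vch[OF that] vdiv[OF that] by (simp add: region_def)
  qed
  have "{..<4} = {0, 1, 2, 3::nat}" by auto
  then have ch4: "chosen f = {v 0, v 1, v 2, v 3}" using ch by auto
  have out: "x w \<notin> cell k c" if "w < n" "w \<notin> chosen f" for w
  proof -
    have "x w \<in> region c f w" using f(2) that(1) by (auto simp: pattern_def PiE_iff)
    then show ?thesis using that(2) by (simp add: region_def)
  qed
  have "gadget (\<lambda>i. (16002 * real k) *\<^sub>R x i) {..<n} (v 0) (v 1) (v 2) (v 3)"
  proof (rule gadget_coordinates[where ox = "8001 * (2 * real (fst c) + 1)" and oy = "8001 * (2 * real (snd c) + 1)"])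
    show "distinct [v 0, v 1, v 2, v 3]" using vneq by simp
    show "{v 0, v 1, v 2, v 3} \<subseteq> {..<n}" using vn by simp
    fix w assume "w \<in> {..<n} - {v 0, v 1, v 2, v 3}"
    then have "x w \<notin> cell k c" using out ch4 by auto
    then show "8001 \<le> \<bar>fst ((16002 * real k) *\<^sub>R x w) - 8001 * (2 * real (fst c) + 1)\<bar> \<or>
        8001 \<le> \<bar>snd ((16002 * real k) *\<^sub>R x w) - 8001 * (2 * real (snd c) + 1)\<bar>"
      unfolding cell_def mem_rectangle[OF k0] by auto
  qed (use vbox[of 0] vbox[of 1] vbox[of 2] vbox[of 3] in \<open>simp_all add: gadget_box_def mem_rectangle[OF k0]\<close>)
  moreover have "x (v 0) \<in> cell k c" "x (v 1) \<in> cell k c" 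
    using subsetD[OF gadget_box_subset[OF k0] vbox] by auto
  ultimately show ?thesis by blast
qed

text \<open>The reciprocal of the base is \<open>1 + 1 / (N - 1)\<close>, at most
  \<open>exp (1 / (N - 1))\<close>, and \<open>N / (N - 1)\<close> is at most 2.\<close>

lemma one_minus_inverse_power_ge:
  assumes "2 \<le> N"
  shows "exp (-2) \<le> (1 - 1 / real N) ^ N"
proof -
  have "1 / (1 - 1 / real N) = 1 + 1 / (real N - 1)" using assms by (simp add: field_simps)
  also have "\<dots> \<le> exp (1 / (real N - 1))" by (rule exp_ge_add_one_self)
  finally have "1 \<le> exp (1 / (real N - 1)) * (1 - 1 / real N)" using assms by (simp add: field_simps)
  then have "1 \<le> (exp (1 / (real N - 1)) * (1 - 1 / real N)) ^ N" by (rule one_le_power)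
  also have "\<dots> = exp (real N * (1 / (real N - 1))) * (1 - 1 / real N) ^ N"
    by (simp only: power_mult_distrib exp_of_nat_mult)
  also have "\<dots> \<le> exp 2 * (1 - 1 / real N) ^ N"
    using assms by (intro mult_right_mono) (auto simp: divide_simps)
  finally show ?thesis by (simp add: exp_minus field_simps)
qed

lemma disjoint_cells_edges:
  assumes k: "k > 0" and e: "\<And>c. c \<in> I \<Longrightarrow> x (a c) \<in> cell k c \<and> x (b c) \<in> cell k c"
  shows "inj_on (\<lambda>c. {a c, b c}) I"
proof (rule inj_onI)
  fix c c' assume *: "c \<in> I" "c' \<in> I" "{a c, b c} = {a c', b c'}"
  then have "x (a c) \<in> cell k c \<inter> cell k c'" using e[OF *(1)] e[OF *(2)] by (auto simp: doubleton_eq_iff)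
  then show "c = c'" using cell_disjoint[OF k] by blast
qed

text \<open>With between \<open>n\<close> and \<open>4 * n\<close> cells, a cell is occupied with
  probability at least a constant \<open>\<pi>0\<close>. Each occupied cell contributes its edge
  \<open>{a, b}\<close>, and different cells give different edges; \<open>\<beta>\<close> is
  \<open>\<pi>0 / 2\<close>, since half of the mean is guaranteed.\<close>

lemma many_gadgets:
  "\<exists>\<beta>>0. \<beta> \<le> (1::real) \<and> (\<exists>\<delta>. \<delta> \<longlonglongrightarrow> (0::real) \<and> (\<forall>n\<ge>8. \<exists>k>0. real k \<le> 2 * sqrt (real n) \<and> (\<exists>A\<in>sets (random_points n).
       measure (random_points n) A \<le> \<delta> n \<and> (\<forall>x\<in>space (random_points n) - A.
         \<exists>\<E>\<subseteq>edges n. \<beta> * real n \<le> real (card \<E>) \<and>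
           (\<forall>e\<in>\<E>. \<exists>a b q1 q2. e = {a, b} \<and> gadget (\<lambda>i. (16002 * real k) *\<^sub>R x i) {..<n} a b q1 q2)))))"
proof -
  \<comment> \<open>\<open>\<theta>\<close> is \<open>p * k\<^sup>2\<close>. As
    \<open>n div 4\<close> is at least \<open>n / 8\<close> and \<open>k\<^sup>2\<close> at most
    \<open>4 * n\<close>, the product \<open>(n div 4) * p\<close> is at least
    \<open>\<theta> / 32\<close>; the factor \<open>exp (- 2)\<close> in \<open>\<pi>0\<close>
    bounds the probability that the other points avoid the cell.\<close>
  define \<theta> :: real where "\<theta> = (1 / 100000)\<^sup>2 / 16002\<^sup>2"
  define \<pi>0 where "\<pi>0 = (\<theta> / 32) ^ 4 * exp (- 2)"
  define \<delta> where "\<delta> n = 4 / (real n * \<pi>0) + 4 * (1 / (1 - 1 / real n) ^ 8 - 1)" for n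
  have \<pi>0: "\<pi>0 > 0" by (simp add: \<pi>0_def \<theta>_def)
  have \<pi>0_le: "\<pi>0 / 2 \<le> 1"
  proof -
    have "\<pi>0 \<le> 1 * 1" unfolding \<pi>0_def by (intro mult_mono power_le_one) (simp_all add: \<theta>_def power2_eq_square)
    then show ?thesis by simp
  qed
  have lim: "\<delta> \<longlonglongrightarrow> 0"
  proof -
    have "(\<lambda>n. (4 / \<pi>0) * (1 / real n) + 4 * (1 / (1 - 1 / real n) ^ 8 - 1))
        \<longlonglongrightarrow> (4 / \<pi>0) * 0 + 4 * (1 / (1 - 0) ^ 8 - 1)"
      by (intro tendsto_intros lim_1_over_n) auto
    then show ?thesis unfolding \<delta>_def by (simp add: mult.commute)
  qed
  have main: "\<exists>k>0. real k \<le> 2 * sqrt (real n) \<and> (\<exists>A\<in>sets (random_points n).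
       measure (random_points n) A \<le> \<delta> n \<and> (\<forall>x\<in>space (random_points n) - A.
         \<exists>\<E>\<subseteq>edges n. \<pi>0 / 2 * real n \<le> real (card \<E>) \<and>
           (\<forall>e\<in>\<E>. \<exists>a b q1 q2. e = {a, b} \<and> gadget (\<lambda>i. (16002 * real k) *\<^sub>R x i) {..<n} a b q1 q2)))"
    if n: "n \<ge> 8" for n
  proof -
    define k where "k = nat \<lceil>sqrt (real n)\<rceil>"
    have sq2: "2 \<le> sqrt (real n)" using n by (intro real_le_rsqrt) simp
    have k: "sqrt (real n) \<le> real k" "real k \<le> sqrt (real n) + 1"
      unfolding k_def using sq2 by linarith+
    have k2: "k \<ge> 2" using k(1) sq2 by linarith
    have k_le: "real k \<le> 2 * sqrt (real n)" using k(2) sq2 by linarith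
    have N1: "real n \<le> (real k)\<^sup>2" using power_mono[OF k(1), of 2] by simp
    have N2: "(real k)\<^sup>2 \<le> 4 * real n" using power_mono[OF k_le, of 2] by (simp add: power_mult_distrib)
    have Nn: "n \<le> k\<^sup>2" using N1 by (simp flip: of_nat_power add: of_nat_le_iff)
    interpret occupancy uniform_square "{..<k} \<times> {..<k}" "cell k" "gadget_box k" "1 / (real k)\<^sup>2"
      "(1 / 100000)\<^sup>2 / (16002 * real k)\<^sup>2" n "n div 4"
      using occupancy_cells[OF k2 n] .
    define p where "p = (1 / 100000)\<^sup>2 / (16002 * real k)\<^sup>2"
    define \<pi> where "\<pi> = real (n div 4) ^ 4 * p ^ 4 * (1 - 1 / (real k)\<^sup>2) ^ (n - 4)"
    have p: "p = \<theta> / (real k)\<^sup>2" by (simp add: p_def \<theta>_def power_mult_distrib)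
    have "\<theta> / 32 \<le> real (n div 4) * p"
    proof -
      have "n \<le> 8 * (n div 4)" using n by linarith
      then have "real n / 8 \<le> real (n div 4)" by linarith
      then have "(real n / 8) * (\<theta> / (4 * real n)) \<le> real (n div 4) * (\<theta> / (real k)\<^sup>2)"
        using N1 N2 n k2 by (intro mult_mono divide_left_mono) (auto simp: \<theta>_def intro!: mult_pos_pos)
      then show ?thesis using n by (simp add: p)
    qed
    then have "(\<theta> / 32) ^ 4 \<le> (real (n div 4) * p) ^ 4" by (intro power_mono) (simp_all add: \<theta>_def)
    moreover have "exp (- 2) \<le> (1 - 1 / (real k)\<^sup>2) ^ (n - 4)"
    proof -
      have "2 \<le> k\<^sup>2" using Nn n by linarith
      then have "exp (- 2) \<le> (1 - 1 / real (k\<^sup>2)) ^ (k\<^sup>2)" by (rule one_minus_inverse_power_ge)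
      also have "\<dots> \<le> (1 - 1 / real (k\<^sup>2)) ^ (n - 4)"
        using \<open>2 \<le> k\<^sup>2\<close> Nn by (intro power_decreasing) (auto simp: divide_simps)
      finally show ?thesis by simp
    qed
    ultimately have \<pi>: "\<pi>0 \<le> \<pi>"
      unfolding \<pi>0_def \<pi>_def power_mult_distrib[symmetric] by (intro mult_mono) (auto simp: p_def)
    have cardI: "real (card ({..<k} \<times> {..<k})) = (real k)\<^sup>2" by (simp add: card_cartesian_product power2_eq_square)
    have prod_ge: "real n * \<pi>0 \<le> (real k)\<^sup>2 * \<pi>" using N1 \<pi> \<pi>0 by (intro mult_mono) auto
    let ?M = "random_points n"
    have \<Omega>: "\<Omega> = ?M" by (simp add: random_points_def)
    define A where "A = {x \<in> space ?M. real (card {c \<in> {..<k} \<times> {..<k}. x \<in> occupied c}) \<le> (real k)\<^sup>2 * \<pi> / 2}"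
    have "measure ?M A \<le> 4 / ((real k)\<^sup>2 * \<pi>) + 4 * (1 / (1 - 1 / (real k)\<^sup>2) ^ 8 - 1)"
      using many_occupied unfolding A_def cardI \<Omega> \<pi>_def p_def by simp
    also have "\<dots> \<le> \<delta> n"
    proof -
      have "\<pi> > 0" using \<pi> \<pi>0 by linarith
      then have 1: "4 / ((real k)\<^sup>2 * \<pi>) \<le> 4 / (real n * \<pi>0)"
        using prod_ge n \<pi>0 k2 by (intro divide_left_mono) (auto intro!: mult_pos_pos)
      have "1 / (real k)\<^sup>2 \<le> 1 / real n" using N1 n by (intro frac_le) auto
      moreover have pos: "0 < 1 - 1 / real n" using n by simp
      ultimately have "(1 - 1 / real n) ^ 8 \<le> (1 - 1 / (real k)\<^sup>2) ^ 8" "0 < (1 - 1 / (real k)\<^sup>2) ^ 8"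
        by (auto intro!: power_mono zero_less_power)
      then have "1 / (1 - 1 / (real k)\<^sup>2) ^ 8 \<le> 1 / (1 - 1 / real n) ^ 8"
        using pos by (intro divide_left_mono) (auto intro!: mult_pos_pos)
      with 1 show ?thesis unfolding \<delta>_def
        by - (rule add_mono, assumption, rule mult_left_mono, rule diff_right_mono, assumption, simp)
    qed
    finally have meas: "measure ?M A \<le> \<delta> n" .
    have A_sets: "A \<in> sets ?M"
    proof -
      have [measurable]: "occupied c \<in> sets ?M" if "c \<in> {..<k} \<times> {..<k}" for c
        using occupied_sets[OF that] unfolding \<Omega> .
      have "real (card {c \<in> {..<k} \<times> {..<k}. x \<in> occupied c}) = (\<Sum>c\<in>{..<k} \<times> {..<k}. indicator (occupied c) x)" for x
        by (simp add: indicator_def sum.If_cases Int_def)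
      then show ?thesis unfolding A_def by simp
    qed
    have good: "\<exists>\<E>\<subseteq>edges n. \<pi>0 / 2 * real n \<le> real (card \<E>) \<and>
           (\<forall>e\<in>\<E>. \<exists>a b q1 q2. e = {a, b} \<and> gadget (\<lambda>i. (16002 * real k) *\<^sub>R x i) {..<n} a b q1 q2)"
      if x: "x \<in> space ?M - A" for x
    proof -
      define J where "J = {c \<in> {..<k} \<times> {..<k}. x \<in> occupied c}"
      have "\<forall>c\<in>J. \<exists>a b q1 q2. gadget (\<lambda>i. (16002 * real k) *\<^sub>R x i) {..<n} a b q1 q2 \<and> x a \<in> cell k c \<and> x b \<in> cell k c"
        using occupied_gadget[OF k2 n] by (auto simp: J_def)
      then obtain a b where ab: "\<And>c. c \<in> J \<Longrightarrow> \<exists>q1 q2. gadget (\<lambda>i. (16002 * real k) *\<^sub>R x i) {..<n} (a c) (b c) q1 q2"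
        "\<And>c. c \<in> J \<Longrightarrow> x (a c) \<in> cell k c \<and> x (b c) \<in> cell k c"
        by metis
      let ?E = "(\<lambda>c. {a c, b c}) ` J"
      have "inj_on (\<lambda>c. {a c, b c}) J" 
        by (rule disjoint_cells_edges[where k = k and x = x, OF _ ab(2)]) (use k2 in auto)
      then have "real (card ?E) = real (card J)" by (simp add: card_image)
      also have "\<dots> \<ge> (real k)\<^sup>2 * \<pi> / 2" using x by (auto simp: A_def J_def)
      finally have "\<pi>0 / 2 * real n \<le> real (card ?E)" using prod_ge by (simp add: mult.commute)
      moreover have "?E \<subseteq> edges n"
      proof
        fix e assume "e \<in> ?E"
        then obtain c where c: "c \<in> J" "e = {a c, b c}" by auto
        then show "e \<in> edges n" using ab(1)[OF c(1)] by (auto simp: gadget_def intro!: pair_in_edges)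
      qed
      moreover have "\<forall>e\<in>?E. \<exists>a b q1 q2. e = {a, b} \<and> gadget (\<lambda>i. (16002 * real k) *\<^sub>R x i) {..<n} a b q1 q2"
        using ab(1) by blast
      ultimately show ?thesis by blast
    qed
    show ?thesis
      using k2 k_le A_sets meas good by (intro exI[of _ k] conjI bexI[of _ A]) auto
  qed
  show ?thesis
    by (intro exI[of _ "\<pi>0 / 2"] exI[of _ \<delta>] conjI allI impI main lim \<pi>0_le) (use \<pi>0 in simp)
qed

section \<open>Random colourings as a finite product\<close>

lemma random_coloring_space: "space (random_coloring n q) = edges n \<rightarrow>\<^sub>E {..<q}"
  by (simp add: random_coloring_def space_PiM space_uniform_count_measure)

lemma finite_coloring_space: "finite (space (random_coloring n q))"
  unfolding random_coloring_space by (intro finite_PiE finite_edges) simp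

lemma coloring_singleton:
  assumes "f \<in> space (random_coloring n q)"
  shows "{f} = PiE (edges n) (\<lambda>e. {f e})"
  using assms unfolding random_coloring_space by (intro PiE_singleton[symmetric]) (auto simp: PiE_iff)

lemma random_coloring_sets: "sets (random_coloring n q) = Pow (space (random_coloring n q))"
proof
  show "Pow (space (random_coloring n q)) \<subseteq> sets (random_coloring n q)"
  proof
    fix A assume A: "A \<in> Pow (space (random_coloring n q))"
    have "{f} \<in> sets (random_coloring n q)" if f: "f \<in> A" for f
    proof -
      have f': "f \<in> space (random_coloring n q)" using A f by auto
      then have "\<And>e. e \<in> edges n \<Longrightarrow> f e < q" unfolding random_coloring_space by (auto simp: PiE_iff)
      then show ?thesis unfolding coloring_singleton[OF f'] random_coloring_def
        by (intro sets_PiM_I_finite finite_edges) (auto simp: sets_uniform_count_measure)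
    qed
    moreover have "finite A" using A finite_coloring_space by (auto intro: finite_subset)
    ultimately have "(\<Union>f\<in>A. {f}) \<in> sets (random_coloring n q)" by (intro sets.finite_UN) auto
    then show "A \<in> sets (random_coloring n q)" by simp
  qed
qed (rule sets.space_closed)

lemma prob_space_random_coloring:
  assumes "q > 0"
  shows "prob_space (random_coloring n q)"
  unfolding random_coloring_def using assms
  by (intro prob_space_PiM prob_space_uniform_count_measure) auto

text \<open>The bridge from measure to counting: all colourings have the same mass, so probabilities
  are values of \<open>cond_prob\<close> with no edge exposed.\<close>

lemma measure_random_coloring:
  assumes q: "q > 0"
  shows "measure (random_coloring n q) {col \<in> space (random_coloring n q). Bad col} = cond_prob (edges n) q Bad {} c"
proof -
  interpret prob_space "random_coloring n q" using prob_space_random_coloring[OF q] .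
  interpret U: prob_space "uniform_count_measure {..<q}"
    using q by (intro prob_space_uniform_count_measure) auto
  interpret P: finite_product_prob_space "\<lambda>_. uniform_count_measure {..<q}" "edges n"
    by unfold_locales (rule finite_edges)
  let ?A = "{col \<in> space (random_coloring n q). Bad col}"
  have single: "prob {f} = 1 / real q ^ card (edges n)" if f: "f \<in> space (random_coloring n q)" for f
  proof -
    have fq: "\<And>e. e \<in> edges n \<Longrightarrow> f e < q" using f unfolding random_coloring_space by (auto simp: PiE_iff)
    have "prob {f} = (\<Prod>e\<in>edges n. measure (uniform_count_measure {..<q}) {f e})"
      unfolding coloring_singleton[OF f] unfolding random_coloring_def
      using fq by (intro P.finite_measure_PiM_emb) (auto simp: sets_uniform_count_measure)
    also have "\<dots> = (\<Prod>e\<in>edges n. 1 / real q)"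
      using fq by (intro prod.cong) (auto simp: measure_uniform_count_measure)
    finally show ?thesis by (simp add: power_one_over)
  qed
  have "prob ?A = (\<Sum>f\<in>?A. prob {f})"
    using finite_coloring_space by (intro finite_measure_eq_sum_singleton) (auto simp: random_coloring_sets)
  also have "\<dots> = (\<Sum>f\<in>?A. 1 / real q ^ card (edges n))" using single by (intro sum.cong) auto
  also have "\<dots> = cond_prob (edges n) q Bad {} c"
    by (simp add: cond_prob_def extensions_def random_coloring_space)
  finally show ?thesis .
qed

lemma cond_prob_mono:
  assumes "finite E" "\<And>col. Bad col \<Longrightarrow> Bad' col"
  shows "cond_prob E q Bad X c \<le> cond_prob E q Bad' X c"
  unfolding cond_prob_def using assms finite_extensions[OF assms(1), of q X c]
  by (intro divide_right_mono of_nat_mono card_mono) auto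

section \<open>Measurability and conclusion\<close>

lemma finite_tours: "finite {vs. hamilton_cycle n vs}"
proof (rule finite_subset)
  show "{vs. hamilton_cycle n vs} \<subseteq> {vs. set vs \<subseteq> {..<n} \<and> length vs = n}"
    using distinct_card by (fastforce simp: hamilton_cycle_def)
  show "finite {vs. set vs \<subseteq> {..<n} \<and> length vs = n}" by (rule finite_lists_length_eq) simp
qed

text \<open>With an index set independent of the colouring this is an infimum of finitely many
  measurable functions.\<close>

lemma Z_rainbow_alt:
  "Z_rainbow n x col = (INF vs\<in>{vs. hamilton_cycle n vs}. if rainbow col vs then ereal (cycle_length x vs) else \<infinity>)"
proof (rule antisym)
  show "Z_rainbow n x col \<le> (INF vs\<in>{vs. hamilton_cycle n vs}. if rainbow col vs then ereal (cycle_length x vs) else \<infinity>)"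
    unfolding Z_rainbow_def by (rule INF_greatest) (auto intro: INF_lower)
  show "(INF vs\<in>{vs. hamilton_cycle n vs}. if rainbow col vs then ereal (cycle_length x vs) else \<infinity>) \<le> Z_rainbow n x col"
    unfolding Z_rainbow_def
  proof (rule INF_greatest)
    fix vs assume "vs \<in> {vs. hamilton_cycle n vs \<and> rainbow col vs}"
    then show "(INF vs\<in>{vs. hamilton_cycle n vs}. if rainbow col vs then ereal (cycle_length x vs) else \<infinity>)
        \<le> ereal (cycle_length x vs)"
      by (intro INF_lower2[of vs]) auto
  qed
qed

lemma coordinate_measurable:
  assumes "i < n" shows "(\<lambda>x. x i) \<in> random_points n \<rightarrow>\<^sub>M borel"
proof -
  have "(\<lambda>x. x i) \<in> random_points n \<rightarrow>\<^sub>M uniform_square"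
    unfolding random_points_def using assms by (intro measurable_component_singleton) simp
  then show ?thesis by (simp cong: measurable_cong_sets)
qed

lemma cycle_length_measurable:
  assumes "hamilton_cycle n vs"
  shows "(\<lambda>x. cycle_length x vs) \<in> borel_measurable (random_points n)"
proof -
  have n: "vs ! i < n" if "i < length vs" for i using assms nth_mem[OF that] by (auto simp: hamilton_cycle_def)
  show ?thesis
    unfolding cycle_length_def
  proof (intro borel_measurable_sum borel_measurable_dist coordinate_measurable n)
    fix i assume "i \<in> {..<length vs}"
    then show "i < length vs" "Suc i mod length vs < length vs" by (auto intro!: mod_less_divisor)
  qed
qed

lemma Z_opt_measurable: "Z_opt n \<in> borel_measurable (random_points n)"
proof -
  have "(\<lambda>x. INF vs\<in>{vs. hamilton_cycle n vs}. ereal (cycle_length x vs)) \<in> borel_measurable (random_points n)"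
    using finite_tours cycle_length_measurable by (intro borel_measurable_INF) (auto intro: countable_finite)
  then show ?thesis by (simp add: Z_opt_def[abs_def])
qed

lemma Z_rainbow_measurable:
  "(\<lambda>w. Z_rainbow n (fst w) (snd w)) \<in> borel_measurable (random_points n \<Otimes>\<^sub>M random_coloring n q)"
  unfolding Z_rainbow_alt
proof (intro borel_measurable_INF)
  show "countable {vs. hamilton_cycle n vs}" using finite_tours by (rule countable_finite)
  fix vs assume "vs \<in> {vs. hamilton_cycle n vs}"
  then have [measurable]: "(\<lambda>x. cycle_length x vs) \<in> borel_measurable (random_points n)"
    using cycle_length_measurable by simp
  have [measurable]: "Measurable.pred (random_coloring n q) (\<lambda>col. rainbow col vs)"
    by (simp add: pred_def random_coloring_sets)
  show "(\<lambda>w. if rainbow (snd w) vs then ereal (cycle_length (fst w) vs) else \<infinity>)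
      \<in> borel_measurable (random_points n \<Otimes>\<^sub>M random_coloring n q)"
    by measurable
qed

lemma prob_space_random_points: "prob_space (random_points n)"
  unfolding random_points_def by (intro prob_space_PiM prob_space_uniform_square)

lemma prob_space_pair:
  assumes "prob_space M" "prob_space N"
  shows "prob_space (M \<Otimes>\<^sub>M N)"
proof -
  interpret M: prob_space M by fact
  interpret N: prob_space N by fact
  interpret pair_prob_space M N by unfold_locales
  show ?thesis by unfold_locales
qed

text \<open>Fubini's theorem with an exceptional set: on \<open>A\<close> the inner probability is
  bounded by 1.\<close>

lemma pair_measure_le:
  assumes "prob_space M" "prob_space N" "E \<in> sets (M \<Otimes>\<^sub>M N)" "A \<in> sets M" "0 \<le> d"
    and d: "\<And>x. x \<in> space M - A \<Longrightarrow> measure N (Pair x -` E) \<le> d"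
  shows "measure (M \<Otimes>\<^sub>M N) E \<le> measure M A + d"
proof -
  interpret M: prob_space M by fact
  interpret N: prob_space N by fact
  interpret P: prob_space "M \<Otimes>\<^sub>M N" using assms(1,2) by (rule prob_space_pair)
  have "emeasure (M \<Otimes>\<^sub>M N) E = (\<integral>\<^sup>+x. emeasure N (Pair x -` E) \<partial>M)"
    by (rule N.emeasure_pair_measure_alt[OF assms(3)])
  also have "\<dots> \<le> (\<integral>\<^sup>+x. indicator A x + ennreal d \<partial>M)"
  proof (rule nn_integral_mono)
    fix x assume x: "x \<in> space M"
    show "emeasure N (Pair x -` E) \<le> indicator A x + ennreal d"
    proof (cases "x \<in> A")
      case True
      then show ?thesis using N.measure_le_1[of "Pair x -` E"] by (simp add: add_increasing2)
    next
      case False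
      then show ?thesis using d[of x] x by (simp add: N.emeasure_eq_measure ennreal_leI)
    qed
  qed
  also have "\<dots> = emeasure M A + ennreal d"
    using assms(4) by (subst nn_integral_add) (simp_all add: M.emeasure_space_1)
  also have "\<dots> = ennreal (measure M A + d)" using assms(5) by (simp add: M.emeasure_eq_measure)
  finally show ?thesis unfolding P.emeasure_eq_measure using assms(5) by (subst (asm) ennreal_le_iff) auto
qed

lemma whp_bound:
  assumes lim: "\<delta> \<longlonglongrightarrow> 0"
    and bound: "\<forall>\<^sub>F n in sequentially. prob_space (M n) \<and> {w \<in> space (M n). P n w} \<in> sets (M n) \<and>
      measure (M n) {w \<in> space (M n). \<not> P n w} \<le> \<delta> n"
  shows "whp M P"
  unfolding whp_def
proof (rule tendsto_sandwich)
  show "(\<lambda>n. 1 - \<delta> n) \<longlonglongrightarrow> 1" using tendsto_diff[OF tendsto_const lim, of 1] by simp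
  show "\<forall>\<^sub>F n in sequentially. 1 - \<delta> n \<le> measure (M n) {w \<in> space (M n). P n w}"
    using bound
  proof eventually_elim
    case (elim n)
    then interpret prob_space "M n" by simp
    have "space (M n) - {w \<in> space (M n). P n w} = {w \<in> space (M n). \<not> P n w}" by auto
    then show ?case using elim prob_compl[of "{w \<in> space (M n). P n w}"] by simp
  qed
  show "\<forall>\<^sub>F n in sequentially. measure (M n) {w \<in> space (M n). P n w} \<le> 1"
    using bound by eventually_elim (auto intro: prob_space.prob_le_1)
qed (rule tendsto_const)

section \<open>Asymptotic choice of the parameters\<close>

lemma power_two_between_sqrt:
  assumes "1 \<le> y" shows "\<exists>J. y \<le> 2 ^ J \<and> 2 ^ J \<le> 2 * (y::real)"
proof -
  define J where "J = nat \<lceil>log 2 y\<rceil>"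
  have "0 \<le> log 2 y" using assms by simp
  then have J: "log 2 y \<le> real J" "real J \<le> log 2 y + 1" unfolding J_def by linarith+
  then have "2 powr log 2 y \<le> 2 powr real J" "2 powr real J \<le> 2 powr (log 2 y + 1)" by simp_all
  then show ?thesis using assms by (intro exI[of _ J]) (simp add: powr_realpow powr_add)
qed

text \<open>Half of \<open>\<epsilon>\<close> is given up to absorb the rounding of
  \<open>(1 + \<epsilon>) * n\<close> to an integer.\<close>

lemma color_count_eventually:
  fixes q :: "nat \<Rightarrow> nat"
  assumes "\<epsilon> > 0" "\<And>n. \<bar>real (q n) - (1 + \<epsilon>) * real n\<bar> < 1"
  shows "\<forall>\<^sub>F n in sequentially. n \<le> q n \<and> real n \<le> 1 / (1 + \<epsilon> / 2) * real (q n) \<and> real (q n) \<le> (2 + \<epsilon>) * real n"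
proof -
  have "\<forall>\<^sub>F n in sequentially. 2 / \<epsilon> \<le> real n"
    using filterlim_real_sequentially by (simp add: filterlim_at_top)
  then show ?thesis using eventually_ge_at_top[of 1]
  proof eventually_elim
    case (elim n)
    define p where "p = \<epsilon> / 2 * real n"
    have "1 \<le> p" "1 \<le> real n" using elim assms(1) by (simp_all add: p_def field_simps)
    moreover have "\<bar>real (q n) - (real n + 2 * p)\<bar> < 1"
      using assms(2)[of n] by (simp add: p_def algebra_simps)
    ultimately have "real n + p \<le> real (q n)" "real n \<le> real (q n)" "real (q n) \<le> 2 * real n + 2 * p"
      by linarith+
    then have *: "(1 + \<epsilon> / 2) * real n \<le> real (q n)" "real n \<le> real (q n)" "real (q n) \<le> (2 + \<epsilon>) * real n"
      by (simp_all add: p_def algebra_simps)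
    moreover have "real n \<le> 1 / (1 + \<epsilon> / 2) * real (q n)"
      using *(1) assms(1) by (simp add: pos_le_divide_eq mult.commute)
    ultimately show ?case by simp
  qed
qed

text \<open>The constant \<open>C\<close> and the threshold for \<open>n\<close> are the same for
  all positions, so the bound serves for arbitrary as well as for random points.\<close>

lemma rainbow_tour_whp:
  fixes q :: "nat \<Rightarrow> nat"
  assumes "\<epsilon> > 0" "\<And>n. \<bar>real (q n) - (1 + \<epsilon>) * real n\<bar> < 1"
  shows "\<exists>C>0. \<forall>\<^sub>F n in sequentially. q n > 0 \<and> (\<forall>x. (\<forall>i<n. x i \<in> unit_square) \<longrightarrow>
    measure (random_coloring n (q n)) {col \<in> space (random_coloring n (q n)).
      \<not> Z_rainbow n x col \<le> ereal (C * sqrt (real n) * ln (real n))} \<le> 3 / real n)"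
proof -
  define r where "r = 1 / (1 + \<epsilon> / 2)"
  define s where "s = 1 - (1 - r)\<^sup>2"
  have r: "0 < r" "r < 1" using assms(1) by (simp_all add: r_def)
  have s: "0 < s" "s < 1"
  proof -
    have "(1 - r)\<^sup>2 < 1" using r by (simp add: abs_square_less_1)
    then show "0 < s" by (simp add: s_def)
    show "s < 1" using r by (simp add: s_def)
  qed
  \<comment> \<open>This makes \<open>s ^ B n\<close> at most \<open>1 / n\<^sup>2\<close>, so that
    \<open>prob_bad\<close> yields \<open>3 / n\<close>.\<close>
  define K where "K = - 2 / ln s"
  have K: "K > 0" using s by (simp add: K_def divide_neg_neg)
  \<comment> \<open>The 4 comes from the term with \<open>2 ^ J\<close> in the denominator; 136 is
    \<open>64 * 2\<close> for the greedy steps, as \<open>2 ^ J\<close> is at most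
    \<open>2 * sqrt n\<close>, plus 8 for the insertions.\<close>
  define C where "C = 4 + 136 * (K + 1)"
  define B where "B n = nat \<lceil>K * ln (real n)\<rceil>" for n :: nat
  \<comment> \<open>This will give \<open>14 * B n + 8 \<le> n\<close>; rounding up in
    \<open>B n\<close> costs 14 more, hence 22.\<close>
  have "(\<lambda>n. (14 * K) * (ln (real n) / real n) + 22 * (1 / real n)) \<longlonglongrightarrow> (14 * K) * 0 + 22 * 0"
    by (intro tendsto_intros lim_ln_over_n lim_1_over_n)
  then have "\<forall>\<^sub>F n in sequentially. (14 * K) * (ln (real n) / real n) + 22 * (1 / real n) < 1"
    by (rule order_tendstoD) simp
  then have "\<forall>\<^sub>F n in sequentially. q n > 0 \<and> (\<forall>x. (\<forall>i<n. x i \<in> unit_square) \<longrightarrow>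
    measure (random_coloring n (q n)) {col \<in> space (random_coloring n (q n)).
      \<not> Z_rainbow n x col \<le> ereal (C * sqrt (real n) * ln (real n))} \<le> 3 / real n)"
    using color_count_eventually[OF assms] eventually_ge_at_top[of 3]
  proof eventually_elim
    case (elim n)
    have n: "3 \<le> n" using elim by simp
    have q: "q n > 0" "real n \<le> r * real (q n)" using elim by (auto simp: r_def)
    have "exp 1 \<le> real n" using exp_le n by linarith
    then have ln1: "1 \<le> ln (real n)" using n by (simp add: ln_ge_iff)
    have Kln: "0 < K * ln (real n)" using K ln1 by simp
    have B: "K * ln (real n) \<le> real (B n)" "real (B n) \<le> K * ln (real n) + 1" "1 \<le> B n"
      unfolding B_def using Kln by linarith+
    have B_le: "real (B n) \<le> (K + 1) * ln (real n)" using B(2) ln1 by (simp add: distrib_right)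
    have "(14 * K) * ln (real n) + 22 < real n" using elim(1) n by (simp add: field_simps)
    then have "real (14 * B n + 8) \<le> real n" using B(2) by simp
    then have nB: "14 * B n + 8 \<le> n" by (simp only: of_nat_le_iff)
    have sB: "s ^ B n \<le> 1 / (real n)\<^sup>2"
    proof -
      have "s ^ B n = exp (real (B n) * ln s)" using s by (simp add: exp_of_nat_mult)
      also have "\<dots> \<le> exp (K * ln (real n) * ln s)"
        using B(1) s by (simp add: mult_right_mono_neg)
      also have "K * ln (real n) * ln s = - ln ((real n)\<^sup>2)" using s n by (simp add: K_def ln_realpow)
      also have "exp \<dots> = 1 / (real n)\<^sup>2" using n by (simp add: exp_minus divide_inverse)
      finally show ?thesis .
    qed
    obtain J where J: "sqrt (real n) \<le> 2 ^ J" "2 ^ J \<le> 2 * sqrt (real n)"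
      using power_two_between_sqrt[of "sqrt (real n)"] n by auto
    define \<Lambda> where "\<Lambda> = C * sqrt (real n) * ln (real n)"
    have len: "4 * real n / 2 ^ J + 64 * real (B n) * 2 ^ J + 8 * real (B n) \<le> \<Lambda>"
    proof -
      have sq: "1 \<le> sqrt (real n)" using n by simp
      have "4 * real n / 2 ^ J \<le> 4 * real n / sqrt (real n)" using J(1) n by (intro divide_left_mono) auto
      also have "\<dots> = 4 * sqrt (real n) * 1" using n by (simp add: real_div_sqrt field_simps)
      also have "\<dots> \<le> 4 * sqrt (real n) * ln (real n)" using ln1 by (intro mult_left_mono) auto
      finally have 1: "4 * real n / 2 ^ J \<le> 4 * (sqrt (real n) * ln (real n))" by simp
      have "64 * real (B n) * 2 ^ J \<le> 64 * ((K + 1) * ln (real n)) * (2 * sqrt (real n))"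
        using B_le J(2) K ln1 by (intro mult_mono) auto
      also have "\<dots> = 128 * (K + 1) * (sqrt (real n) * ln (real n))" by algebra
      finally have 2: "64 * real (B n) * 2 ^ J \<le> 128 * (K + 1) * (sqrt (real n) * ln (real n))" .
      have "8 * real (B n) * 1 \<le> 8 * ((K + 1) * ln (real n)) * sqrt (real n)"
        using B_le sq K ln1 by (intro mult_mono) auto
      also have "\<dots> = 8 * (K + 1) * (sqrt (real n) * ln (real n))" by algebra
      finally have 3: "8 * real (B n) \<le> 8 * (K + 1) * (sqrt (real n) * ln (real n))" by simp
      have "\<Lambda> = 4 * (sqrt (real n) * ln (real n)) + 128 * (K + 1) * (sqrt (real n) * ln (real n))
          + 8 * (K + 1) * (sqrt (real n) * ln (real n))"
        by (simp add: \<Lambda>_def C_def algebra_simps)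
      then show ?thesis using 1 2 3 by linarith
    qed
    have "measure (random_coloring n (q n)) {col \<in> space (random_coloring n (q n)). \<not> Z_rainbow n x col \<le> ereal \<Lambda>} \<le> 3 / real n"
      if x: "\<forall>i<n. x i \<in> unit_square" for x
    proof -
      interpret points_and_colors n "q n" x r "B n" \<Lambda>
        using x q r by unfold_locales auto
      have "measure (random_coloring n (q n)) {col \<in> space (random_coloring n (q n)). \<not> Z_rainbow n x col \<le> ereal \<Lambda>}
          = cond_prob (edges n) (q n) (\<lambda>col. \<not> Z_rainbow n x col \<le> ereal \<Lambda>) {} (\<lambda>_. 0)"
        by (rule measure_random_coloring[OF q(1)])
      also have "\<dots> \<le> cond_prob (edges n) (q n) bad {} (\<lambda>_. 0)"
      proof (rule cond_prob_mono[OF finite_edges])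
        fix col assume no: "\<not> Z_rainbow n x col \<le> ereal \<Lambda>"
        show "bad col"
          unfolding bad_def
        proof (intro allI impI)
          fix vs assume vs: "hamilton_cycle n vs" "rainbow col vs"
          then have "Z_rainbow n x col \<le> ereal (cycle_length x vs)"
            unfolding Z_rainbow_def by (intro INF_lower) simp
          then show "\<Lambda> < cycle_length x vs" using no by (metis ereal_less_eq(3) not_le order_trans)
        qed
      qed
      also have "\<dots> \<le> 3 * real n * s ^ B n"
        unfolding s_def using prob_bad[OF nB B(3) _ len] q(1) by simp
      also have "\<dots> \<le> 3 * real n * (1 / (real n)\<^sup>2)" using sB by (intro mult_left_mono) auto
      also have "\<dots> = 3 / real n" using n by (simp add: power2_eq_square)
      finally show ?thesis .
    qed
    then show ?case using q(1) unfolding \<Lambda>_def by blast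
  qed
  moreover have "C > 0" using K by (simp add: C_def)
  ultimately show ?thesis by blast
qed

section \<open>The gap to the unrestricted optimum\<close>

lemma cycle_length_scale: "cycle_length (\<lambda>i. c *\<^sub>R x i) vs = \<bar>c\<bar> * cycle_length x vs"
  unfolding cycle_length_def sum_distrib_left
  by (intro sum.cong) (simp_all add: dist_norm flip: scaleR_diff_right)

text \<open>A rainbow tour avoids at least \<open>t\<close> edges of \<open>\<E>\<close>, so
  \<open>t div 3\<close> moves are possible, each gaining \<open>1 / 10000\<close> in units of
  \<open>1 / (16002 * k)\<close>.\<close>

lemma rainbow_gap:
  assumes n: "3 \<le> n" and k: "k > 0" and \<E>: "\<E> \<subseteq> edges n"
    and gadgets: "\<And>e. e \<in> \<E> \<Longrightarrow> \<exists>a b q1 q2. e = {a, b} \<and> gadget (\<lambda>i. (16002 * real k) *\<^sub>R x i) {..<n} a b q1 q2"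
    and few: "card (col ` \<E>) + t \<le> card \<E>"
  shows "Z_rainbow n x col - Z_opt n x \<ge> ereal (real (t div 3) / (10000 * (16002 * real k)))"
proof -
  define g where "g = real (t div 3) / (10000 * (16002 * real k))"
  have fin: "finite \<E>" using \<E> finite_edges by (rule finite_subset)
  have "Z_opt n x + ereal g \<le> Z_rainbow n x col"
    unfolding Z_rainbow_def
  proof (rule INF_greatest)
    fix vs assume "vs \<in> {vs. hamilton_cycle n vs \<and> rainbow col vs}"
    then have vs: "hamilton_cycle n vs" "rainbow col vs" by auto
    have "t \<le> card (\<E> - cycle_edges vs)" by (rule rainbow_misses[OF vs(2) fin few])
    then have "3 * (t div 3) \<le> card (\<E> - cycle_edges vs)" by linarith
    then obtain ws where ws: "hamilton_cycle n ws"
      "cycle_length (\<lambda>i. (16002 * real k) *\<^sub>R x i) ws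
        \<le> cycle_length (\<lambda>i. (16002 * real k) *\<^sub>R x i) vs - real (t div 3) / 10000"
      using gadgets_improvement[OF gadgets fin vs(1)] by blast
    have "16002 * real k * cycle_length x ws \<le> 16002 * real k * (cycle_length x vs - g)"
      using ws(2) k by (simp add: cycle_length_scale g_def right_diff_distrib)
    then have "cycle_length x ws + g \<le> cycle_length x vs" using k by simp
    moreover have "Z_opt n x \<le> ereal (cycle_length x ws)"
      unfolding Z_opt_def using ws(1) by (intro INF_lower) simp
    ultimately show "Z_opt n x + ereal g \<le> ereal (cycle_length x vs)"
      by (metis add_right_mono ereal_less_eq(3) order_trans plus_ereal.simps(1))
  qed
  \<comment> \<open>Some tour exists, so \<open>Z_opt n x\<close> is finite and the sum may be
    turned into a difference of extended reals, even if \<open>Z_rainbow n x col\<close> is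
    infinite.\<close>
  moreover have "hamilton_cycle n [0..<n]" using n by (auto simp: hamilton_cycle_def)
  then have "Z_opt n x \<le> ereal (cycle_length x [0..<n])" unfolding Z_opt_def by (intro INF_lower) simp
  moreover have "ereal 0 \<le> Z_opt n x"
    unfolding Z_opt_def by (intro INF_greatest) (auto simp: cycle_length_def intro: sum_nonneg)
  ultimately show ?thesis
    unfolding g_def[symmetric] by (cases "Z_opt n x"; cases "Z_rainbow n x col") auto
qed

lemma rainbow_gap_whp:
  fixes q :: "nat \<Rightarrow> nat"
  assumes "\<epsilon> > 0" "\<And>n. \<bar>real (q n) - (1 + \<epsilon>) * real n\<bar> < 1"
  shows "\<exists>c>0. whp (\<lambda>n. random_points n \<Otimes>\<^sub>M random_coloring n (q n))
    (\<lambda>n (x, col). Z_rainbow n x col - Z_opt n x \<ge> ereal (c * sqrt (real n)))"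
proof -
  obtain \<beta> :: real and \<delta> :: "nat \<Rightarrow> real" where \<beta>: "0 < \<beta>" "\<beta> \<le> 1" and \<delta>: "\<delta> \<longlonglongrightarrow> 0"
    and gadgets: "\<And>n. n \<ge> 8 \<Longrightarrow> \<exists>k>0. real k \<le> 2 * sqrt (real n) \<and> (\<exists>A\<in>sets (random_points n).
       measure (random_points n) A \<le> \<delta> n \<and> (\<forall>x\<in>space (random_points n) - A.
         \<exists>\<E>\<subseteq>edges n. \<beta> * real n \<le> real (card \<E>) \<and>
           (\<forall>e\<in>\<E>. \<exists>a b q1 q2. e = {a, b} \<and> gadget (\<lambda>i. (16002 * real k) *\<^sub>R x i) {..<n} a b q1 q2)))"
    using many_gadgets by blast
  \<comment> \<open>With the halves of \<open>\<E>\<close> used below, the negative term in the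
    exponent of \<open>prob_few_repeats_exp\<close> is at least \<open>(\<beta> * n / 4) * (\<beta>
    * n / 2) / (2 * (2 + \<epsilon>) * n)\<close>, which is twice \<open>\<gamma> * n\<close>. As
    \<open>t\<close> is at most \<open>\<gamma> * n\<close>, the probability is at most
    \<open>d n\<close>.\<close>
  define \<gamma> where "\<gamma> = \<beta>\<^sup>2 / (32 * (2 + \<epsilon>))"
  have \<gamma>: "0 < \<gamma>" using \<beta> assms(1) by (simp add: \<gamma>_def)
  have \<gamma>_le: "\<gamma> \<le> \<beta> / 64"
  proof -
    have "\<beta>\<^sup>2 / (32 * (2 + \<epsilon>)) \<le> \<beta> / 64"
    proof (rule frac_le)
      show "\<beta>\<^sup>2 \<le> \<beta>" using \<beta> by (simp add: power2_eq_square mult_left_le)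
    qed (use \<beta> assms(1) in auto)
    then show ?thesis by (simp add: \<gamma>_def)
  qed
  \<comment> \<open>\<open>t div 3\<close> will be at least \<open>\<gamma> * n / 6\<close>, a move
    gains \<open>1 / 10000\<close> in units of \<open>1 / (16002 * k)\<close>, and \<open>k\<close>
    is at most \<open>2 * sqrt n\<close>.\<close>
  define c where "c = \<gamma> / (6 * 10000 * 16002 * 2)"
  have c: "c > 0" using \<gamma> by (simp add: c_def)
  define d where "d n = exp (- (\<gamma> * real n))" for n :: nat
  have d: "d \<longlonglongrightarrow> 0"
  proof -
    have "filterlim (\<lambda>n. \<gamma> * real n) at_top sequentially"
      by (rule filterlim_tendsto_pos_mult_at_top[OF tendsto_const \<gamma> filterlim_real_sequentially])
    then have "filterlim (\<lambda>n. - (\<gamma> * real n)) at_bot sequentially" by (simp add: filterlim_uminus_at_top)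
    then show ?thesis unfolding d_def by (rule filterlim_compose[OF exp_at_bot])
  qed
  \<comment> \<open>Makes \<open>\<gamma> * n\<close> at least 16, which absorbs the rounding in
    \<open>t\<close>, \<open>l\<close> and \<open>t div 3\<close>.\<close>
  have large: "\<forall>\<^sub>F n in sequentially. 16 / \<gamma> \<le> real n"
    using filterlim_real_sequentially by (simp add: filterlim_at_top)
  have "whp (\<lambda>n. random_points n \<Otimes>\<^sub>M random_coloring n (q n))
    (\<lambda>n (x, col). Z_rainbow n x col - Z_opt n x \<ge> ereal (c * sqrt (real n)))"
  proof (rule whp_bound)
    show "(\<lambda>n. \<delta> n + d n) \<longlonglongrightarrow> 0" using tendsto_add[OF \<delta> d] by simp
    show "\<forall>\<^sub>F n in sequentially. prob_space (random_points n \<Otimes>\<^sub>M random_coloring n (q n)) \<and>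
       {w \<in> space (random_points n \<Otimes>\<^sub>M random_coloring n (q n)).
         case w of (x, col) \<Rightarrow> ereal (c * sqrt (real n)) \<le> Z_rainbow n x col - Z_opt n x}
         \<in> sets (random_points n \<Otimes>\<^sub>M random_coloring n (q n)) \<and>
       measure (random_points n \<Otimes>\<^sub>M random_coloring n (q n))
         {w \<in> space (random_points n \<Otimes>\<^sub>M random_coloring n (q n)).
           \<not> (case w of (x, col) \<Rightarrow> ereal (c * sqrt (real n)) \<le> Z_rainbow n x col - Z_opt n x)} \<le> \<delta> n + d n"
      using color_count_eventually[OF assms] eventually_ge_at_top[of 8] large
    proof eventually_elim
      case (elim n)
      have n: "8 \<le> n" and qn: "n \<le> q n" "real (q n) \<le> (2 + \<epsilon>) * real n" "q n > 0"
        using elim by auto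
      have \<gamma>n: "16 \<le> \<gamma> * real n" using elim(3) \<gamma> by (simp add: field_simps)
      let ?P = "random_points n" and ?Q = "random_coloring n (q n)"
      let ?E = "{w \<in> space (?P \<Otimes>\<^sub>M ?Q). \<not> (case w of (x, col) \<Rightarrow> ereal (c * sqrt (real n)) \<le> Z_rainbow n x col - Z_opt n x)}"
      have PQ: "prob_space ?P" "prob_space ?Q"
        using prob_space_random_points prob_space_random_coloring[OF qn(3)] by auto
      have [measurable]: "(\<lambda>w. Z_rainbow n (fst w) (snd w)) \<in> borel_measurable (?P \<Otimes>\<^sub>M ?Q)"
        by (rule Z_rainbow_measurable)
      have [measurable]: "Z_opt n \<in> borel_measurable ?P" by (rule Z_opt_measurable)
      have good_sets: "{w \<in> space (?P \<Otimes>\<^sub>M ?Q). ereal (c * sqrt (real n)) \<le> Z_rainbow n (fst w) (snd w) - Z_opt n (fst w)} \<in> sets (?P \<Otimes>\<^sub>M ?Q)"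
        and E_sets: "{w \<in> space (?P \<Otimes>\<^sub>M ?Q). \<not> ereal (c * sqrt (real n)) \<le> Z_rainbow n (fst w) (snd w) - Z_opt n (fst w)} \<in> sets (?P \<Otimes>\<^sub>M ?Q)"
        by measurable
      obtain k A where k: "k > 0" "real k \<le> 2 * sqrt (real n)" and A: "A \<in> sets ?P" "measure ?P A \<le> \<delta> n"
        and G: "\<And>x. x \<in> space ?P - A \<Longrightarrow> \<exists>\<E>\<subseteq>edges n. \<beta> * real n \<le> real (card \<E>) \<and>
           (\<forall>e\<in>\<E>. \<exists>a b q1 q2. e = {a, b} \<and> gadget (\<lambda>i. (16002 * real k) *\<^sub>R x i) {..<n} a b q1 q2)"
        using gadgets[OF n] by blast
      have "measure (?P \<Otimes>\<^sub>M ?Q) ?E \<le> measure ?P A + d n"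
      proof (rule pair_measure_le[OF PQ _ A(1)])
        show "?E \<in> sets (?P \<Otimes>\<^sub>M ?Q)" using E_sets by (simp add: case_prod_unfold)
        show "0 \<le> d n" by (simp add: d_def)
        fix x assume x: "x \<in> space ?P - A"
        from G[OF x] obtain \<E> where \<E>: "\<E> \<subseteq> edges n" "\<beta> * real n \<le> real (card \<E>)"
          "\<forall>e\<in>\<E>. \<exists>a b q1 q2. e = {a, b} \<and> gadget (\<lambda>i. (16002 * real k) *\<^sub>R x i) {..<n} a b q1 q2"
          by (elim exE conjE) (rule that)
        define t where "t = nat \<lfloor>\<gamma> * real n\<rfloor>"
        \<comment> \<open>About half of \<open>\<E>\<close> supplies the colours to be repeated, the
          rest the chances to repeat them.\<close>
        define l where "l = nat \<lfloor>\<beta> * real n / 2\<rfloor>"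
        have \<beta>n: "64 * (\<gamma> * real n) \<le> \<beta> * real n" using mult_right_mono[OF \<gamma>_le, of "real n"] by simp
        have t: "real t \<le> \<gamma> * real n" "\<gamma> * real n - 1 \<le> real t" using \<gamma>n unfolding t_def by linarith+
        have l: "real l \<le> \<beta> * real n / 2" "\<beta> * real n / 2 - 1 \<le> real l" using \<beta>n \<gamma>n unfolding l_def by linarith+
        have tl: "t \<le> l" using t l \<beta>n \<gamma>n by linarith
        have lE: "l \<le> card \<E>" using l \<E>(2) \<beta>n \<gamma>n by linarith
        have lq: "l \<le> q n"
        proof -
          have "\<beta> * real n \<le> 1 * real n" using \<beta> by (intro mult_right_mono) auto
          then show ?thesis using l qn(1) by linarith
        qed
        have exponent: "real t - real (l - t) * real (card \<E> - l) / (2 * real (q n)) \<le> - (\<gamma> * real n)"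
        proof -
          have "\<beta> * real n / 4 \<le> real (l - t)" "\<beta> * real n / 2 \<le> real (card \<E> - l)"
            using t l tl lE \<E>(2) \<beta>n \<gamma>n by (simp_all add: of_nat_diff)
          then have "(\<beta> * real n / 4) * (\<beta> * real n / 2) / (2 * ((2 + \<epsilon>) * real n))
              \<le> real (l - t) * real (card \<E> - l) / (2 * real (q n))"
            using \<beta> qn n assms(1) by (intro frac_le mult_mono) auto
          moreover have "(\<beta> * real n / 4) * (\<beta> * real n / 2) / (2 * ((2 + \<epsilon>) * real n)) = 2 * (\<gamma> * real n)"
          proof -
            have "(\<beta> * m / 4) * (\<beta> * m / 2) / (2 * (u * m)) = 2 * (\<beta>\<^sup>2 / (32 * u) * m)"
              if "u > 0" "m > 0" for u m :: real
              using that by (simp add: power2_eq_square field_simps)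
            then show ?thesis using n assms(1) by (simp only: \<gamma>_def)
          qed
          ultimately show ?thesis using t by linarith
        qed
        have c_le: "c * sqrt (real n) \<le> real (t div 3) / (10000 * (16002 * real k))"
        proof -
          have "t \<le> 3 * (t div 3) + 2" by linarith
          then have "real t \<le> 3 * real (t div 3) + 2" by linarith
          then have "\<gamma> * real n / 6 \<le> real (t div 3)" using t \<gamma>n by linarith
          then have "(\<gamma> * real n / 6) / (10000 * (16002 * (2 * sqrt (real n)))) \<le> real (t div 3) / (10000 * (16002 * real k))"
            using k \<gamma> by (intro frac_le) auto
          moreover have "(\<gamma> * real n / 6) / (10000 * (16002 * (2 * sqrt (real n)))) = c * (real n / sqrt (real n))"
            by (simp add: c_def)
          ultimately show ?thesis by (simp add: real_div_sqrt)
        qed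
        have "measure ?Q (Pair x -` ?E) \<le> measure ?Q {col \<in> space ?Q. card \<E> < card (col ` \<E>) + t}"
        proof (rule finite_measure.finite_measure_mono)
          show "finite_measure ?Q" using PQ(2) by (rule prob_space.finite_measure)
          show "{col \<in> space ?Q. card \<E> < card (col ` \<E>) + t} \<in> sets ?Q" by (simp add: random_coloring_sets)
          show "Pair x -` ?E \<subseteq> {col \<in> space ?Q. card \<E> < card (col ` \<E>) + t}"
          proof
            fix col assume col: "col \<in> Pair x -` ?E"
            have "card \<E> < card (col ` \<E>) + t"
            proof (rule ccontr)
              assume "\<not> card \<E> < card (col ` \<E>) + t"
              then have "ereal (real (t div 3) / (10000 * (16002 * real k))) \<le> Z_rainbow n x col - Z_opt n x"
                using n by (intro rainbow_gap[OF _ k(1) \<E>(1) bspec[OF \<E>(3)]]) auto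
              then show False using col c_le by (auto dest: order_trans[of "ereal (c * sqrt (real n))", rotated])
            qed
            then show "col \<in> {col \<in> space ?Q. card \<E> < card (col ` \<E>) + t}"
              using col by (simp add: space_pair_measure)
          qed
        qed
        also have "\<dots> = cond_prob (edges n) (q n) (\<lambda>col. card \<E> < card (col ` \<E>) + t) {} (\<lambda>_. 0)"
          by (rule measure_random_coloring[OF qn(3)])
        also have "\<dots> \<le> exp (real t - real (l - t) * real (card \<E> - l) / (2 * real (q n)))"
          using qn(3) by (intro prob_few_repeats_exp finite_edges \<E>(1) tl lE lq) auto
        also have "\<dots> \<le> d n" unfolding d_def using exponent by simp
        finally show "measure ?Q (Pair x -` ?E) \<le> d n" .
      qed
      then show ?case
        using prob_space_pair[OF PQ] good_sets A(2) by (simp add: case_prod_unfold)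
    qed
  qed
  then show ?thesis using c by blast
qed

theorem theorem2:
  fixes \<epsilon> :: real and q :: "nat \<Rightarrow> nat"
  assumes "\<epsilon> > 0"
    and "\<And>n. \<bar>real (q n) - (1 + \<epsilon>) * real n\<bar> < 1"
  shows "(\<exists>C>0. whp (\<lambda>n. random_points n \<Otimes>\<^sub>M random_coloring n (q n))
            (\<lambda>n (x, col). Z_rainbow n x col \<le> ereal (C * sqrt (real n) * ln (real n))))
       \<and> (\<exists>c>0. whp (\<lambda>n. random_points n \<Otimes>\<^sub>M random_coloring n (q n))
            (\<lambda>n (x, col). Z_rainbow n x col - Z_opt n x \<ge> ereal (c * sqrt (real n))))
       \<and> (\<exists>C>0. \<forall>x :: nat \<Rightarrow> nat \<Rightarrow> real \<times> real.
            (\<forall>n. inj_on (x n) {..<n} \<and> x n ` {..<n} \<subseteq> unit_square) \<longrightarrow>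
            whp (\<lambda>n. random_coloring n (q n))
              (\<lambda>n col. Z_rainbow n (x n) col \<le> ereal (C * sqrt (real n) * ln (real n))))"
proof -
  obtain C where C: "C > 0" and bound: "\<forall>\<^sub>F n in sequentially. q n > 0 \<and> (\<forall>x. (\<forall>i<n. x i \<in> unit_square) \<longrightarrow>
    measure (random_coloring n (q n)) {col \<in> space (random_coloring n (q n)).
      \<not> Z_rainbow n x col \<le> ereal (C * sqrt (real n) * ln (real n))} \<le> 3 / real n)"
    using rainbow_tour_whp[OF assms] by blast
  have lim: "(\<lambda>n. 3 / real n) \<longlonglongrightarrow> 0" using tendsto_mult[OF tendsto_const lim_1_over_n, of 3] by simp
  have fixed: "whp (\<lambda>n. random_coloring n (q n))
      (\<lambda>n col. Z_rainbow n (x n) col \<le> ereal (C * sqrt (real n) * ln (real n)))"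
    if x: "\<forall>n. inj_on (x n) {..<n} \<and> x n ` {..<n} \<subseteq> unit_square" for x :: "nat \<Rightarrow> nat \<Rightarrow> real \<times> real"
  proof (rule whp_bound[OF lim])
    show "\<forall>\<^sub>F n in sequentially. prob_space (random_coloring n (q n)) \<and>
      {w \<in> space (random_coloring n (q n)). Z_rainbow n (x n) w \<le> ereal (C * sqrt (real n) * ln (real n))}
        \<in> sets (random_coloring n (q n)) \<and>
      measure (random_coloring n (q n)) {w \<in> space (random_coloring n (q n)).
        \<not> Z_rainbow n (x n) w \<le> ereal (C * sqrt (real n) * ln (real n))} \<le> 3 / real n"
      using bound
    proof eventually_elim
      case (elim n)
      have "\<forall>i<n. x n i \<in> unit_square" using x by blast
      then show ?case using elim prob_space_random_coloring by (auto simp: random_coloring_sets)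
    qed
  qed
  have "whp (\<lambda>n. random_points n \<Otimes>\<^sub>M random_coloring n (q n))
      (\<lambda>n (x, col). Z_rainbow n x col \<le> ereal (C * sqrt (real n) * ln (real n)))"
  proof (rule whp_bound[OF lim])
    show "\<forall>\<^sub>F n in sequentially. prob_space (random_points n \<Otimes>\<^sub>M random_coloring n (q n)) \<and>
      {w \<in> space (random_points n \<Otimes>\<^sub>M random_coloring n (q n)).
        case w of (x, col) \<Rightarrow> Z_rainbow n x col \<le> ereal (C * sqrt (real n) * ln (real n))}
        \<in> sets (random_points n \<Otimes>\<^sub>M random_coloring n (q n)) \<and>
      measure (random_points n \<Otimes>\<^sub>M random_coloring n (q n)) {w \<in> space (random_points n \<Otimes>\<^sub>M random_coloring n (q n)).
        \<not> (case w of (x, col) \<Rightarrow> Z_rainbow n x col \<le> ereal (C * sqrt (real n) * ln (real n)))} \<le> 3 / real n"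
      using bound
    proof eventually_elim
      case (elim n)
      let ?P = "random_points n" and ?Q = "random_coloring n (q n)"
      let ?z = "ereal (C * sqrt (real n) * ln (real n))"
      let ?E = "{w \<in> space (?P \<Otimes>\<^sub>M ?Q). \<not> (case w of (x, col) \<Rightarrow> Z_rainbow n x col \<le> ?z)}"
      have PQ: "prob_space ?P" "prob_space ?Q"
        using prob_space_random_points prob_space_random_coloring elim by auto
      have [measurable]: "(\<lambda>w. Z_rainbow n (fst w) (snd w)) \<in> borel_measurable (?P \<Otimes>\<^sub>M ?Q)"
        by (rule Z_rainbow_measurable)
      have good_sets: "{w \<in> space (?P \<Otimes>\<^sub>M ?Q). Z_rainbow n (fst w) (snd w) \<le> ?z} \<in> sets (?P \<Otimes>\<^sub>M ?Q)"
        and E_sets: "{w \<in> space (?P \<Otimes>\<^sub>M ?Q). \<not> Z_rainbow n (fst w) (snd w) \<le> ?z} \<in> sets (?P \<Otimes>\<^sub>M ?Q)"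
        by measurable
      interpret P: prob_space ?P by (rule PQ(1))
      interpret S: prob_space uniform_square by (rule prob_space_uniform_square)
      interpret U: finite_product_prob_space "\<lambda>_. uniform_square" "{..<n}" by unfold_locales simp
      \<comment> \<open>Each point is formally distributed on the whole plane, so positions outside
        the square have to be removed as a null set.\<close>
      define A where "A = space ?P - PiE {..<n} (\<lambda>_. unit_square)"
      have inside: "PiE {..<n} (\<lambda>_. unit_square) \<in> sets ?P"
        unfolding random_points_def by (intro sets_PiM_I_finite) auto
      have "measure ?P (PiE {..<n} (\<lambda>_. unit_square)) = (\<Prod>i<n. measure uniform_square unit_square)"
        unfolding random_points_def by (intro U.finite_measure_PiM_emb) auto
      also have "measure uniform_square unit_square = 1"
        by (simp add: measure_def emeasure_uniform_measure emeasure_unit_square)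
      finally have A0: "measure ?P A = 0" unfolding A_def using inside by (simp add: P.prob_compl)
      have "measure (?P \<Otimes>\<^sub>M ?Q) ?E \<le> measure ?P A + 3 / real n"
      proof (rule pair_measure_le[OF PQ])
        show "?E \<in> sets (?P \<Otimes>\<^sub>M ?Q)" using E_sets by (simp add: case_prod_unfold)
        show "A \<in> sets ?P" using inside by (simp add: A_def)
        fix x assume x: "x \<in> space ?P - A"
        then have "\<forall>i<n. x i \<in> unit_square" by (auto simp: A_def PiE_iff)
        then have "measure ?Q {col \<in> space ?Q. \<not> Z_rainbow n x col \<le> ?z} \<le> 3 / real n" using elim by blast
        moreover have "Pair x -` ?E = {col \<in> space ?Q. \<not> Z_rainbow n x col \<le> ?z}"
          using x by (auto simp: space_pair_measure)
        ultimately show "measure ?Q (Pair x -` ?E) \<le> 3 / real n" by simp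
      qed simp
      then show ?case
        using prob_space_pair[OF PQ] good_sets A0 by (simp add: case_prod_unfold)
    qed
  qed
  then show ?thesis using C fixed rainbow_gap_whp[OF assms] by blast
qed

end
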